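(* For any $m=m(n)$, $k=k(n)$ and $c=c(n)$ such that $3\le c\le k-1<\frac{n}{2\ln n}$, there are unsatisfiable $8$-CNF formulas $F_n$ with $O(mk^2(2n)^{c+1})$ variables and formula size $S(F_n)=O(m^4k^2(2n)^{c+1})$ which resolution can refute in size $O(m^{k+4}k^2(4n)^k)$, but for which every resolution refutation of size at most $\left(\frac{m+1}{2}\right)^{k+c}$ has depth at least $\Omega(n^k)$.
   Context: A clause is a disjunction of literals over distinct variables; an $8$-CNF is a set of clauses each of width (number of literals) at most $8$; formula size is the sum of clause widths. A resolution refutation is a sequence of clauses ending in the empty clause, each in the formula or derived from earlier $C\lor x$, $D\lor\neg x$ as $C\lor D$; size is the number of clauses and depth the number of edges on a longest path in the derivation DAG (edges from premises to derived clauses). *)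

theory Defs
  imports Complex_Main "HOL-Library.Landau_Symbols"
begin

datatype 'v literal = Pos (var: 'v) | Neg (var: 'v)

text \<open>Disjunctions are sets of literals; the width of a clause is its cardinality.\<close>

type_synonym 'v cls = "'v literal set"

type_synonym 'v formula = "'v cls set"

definition is_clause :: "'v cls \<Rightarrow> bool" where
  "is_clause C \<longleftrightarrow> finite C \<and> inj_on var C"

definition is_cnf :: "nat \<Rightarrow> 'v formula \<Rightarrow> bool" where
  "is_cnf w F \<longleftrightarrow> finite F \<and> (\<forall>C\<in>F. is_clause C \<and> card C \<le> w)"

definition vars :: "'v formula \<Rightarrow> 'v set" where
  "vars F = (\<Union>C\<in>F. var ` C)"

definition formula_size :: "'v formula \<Rightarrow> nat" where
  "formula_size F = (\<Sum>C\<in>F. card C)"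

primrec lit_true :: "('v \<Rightarrow> bool) \<Rightarrow> 'v literal \<Rightarrow> bool" where
  "lit_true \<alpha> (Pos x) = \<alpha> x"
| "lit_true \<alpha> (Neg x) = (\<not> \<alpha> x)"

definition satisfiable :: "'v formula \<Rightarrow> bool" where
  "satisfiable F \<longleftrightarrow> (\<exists>\<alpha>. \<forall>C\<in>F. \<exists>l\<in>C. lit_true \<alpha> l)"

text \<open>The non-membership conditions express that \<open>C \<or> x\<close> and \<open>D \<or> \<not> x\<close> are disjunctions over
  distinct variables, so that the pivot is really removed.\<close>

definition resolves_to :: "'v cls \<Rightarrow> 'v cls \<Rightarrow> 'v cls \<Rightarrow> bool" where
  "resolves_to A B E \<longleftrightarrow>
     (\<exists>x C D. Pos x \<notin> C \<and> Neg x \<notin> D \<and>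
        A = insert (Pos x) C \<and> B = insert (Neg x) D \<and> E = C \<union> D)"

text \<open>The derivation DAG is not determined by the sequence of clauses alone, so every line also
  records how it is obtained: as a clause of the formula, or by resolving the lines at the two
  given earlier positions.\<close>

datatype justification = Axiom | Resolvent nat nat

type_synonym 'v derivation = "('v cls \<times> justification) list"

definition is_refutation :: "'v formula \<Rightarrow> 'v derivation \<Rightarrow> bool" where
  "is_refutation F R \<longleftrightarrow>
     R \<noteq> [] \<and> fst (last R) = {} \<and>
     (\<forall>i<length R. is_clause (fst (R ! i)) \<and>
        (case snd (R ! i) of
           Axiom \<Rightarrow> fst (R ! i) \<in> F
         | Resolvent a b \<Rightarrow>
             a < i \<and> b < i \<and> resolves_to (fst (R ! a)) (fst (R ! b)) (fst (R ! i))))"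

definition refutation_size :: "'v derivation \<Rightarrow> nat" where
  "refutation_size R = length R"

definition dag_edges :: "'v derivation \<Rightarrow> (nat \<times> nat) set" where
  "dag_edges R =
     {(j, i). i < length R \<and> (\<exists>a b. snd (R ! i) = Resolvent a b \<and> j \<in> {a, b})}"

text \<open>In a refutation all edges point to later positions, so walks are paths of bounded length
  and the maximum is taken over a finite set; it contains 0.\<close>

definition depth :: "'v derivation \<Rightarrow> nat" where
  "depth R = Max {d. dag_edges R ^^ d \<noteq> {}}"

end

(* Fix k primes between n and 2n. The base formula is a Tseitin formula on a cylinder with k cyclic
   rows, whose number of columns is about 4k times the product of the primes. It is compressed by
   identifying the edges of every row periodically: the period is 8k times the product of c + 1 of
   the primes. Every prime is used by c + 1 rows, so any k - c rows determine a column by the Chinese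
   remainder theorem. Sweeping the cylinder column by column refutes the formula in width about k.

   In a refutation of width less than k + c consider the edges that occur in a clause. If they do not
   separate the two ends of the cylinder, the violated constraint can be moved from one end to the
   other along a straight row or along a path that switches periodically between two rows. If they
   do, all rows that contain only one of these edges are blocked near a common virtual column, the
   cordon, which moves by at most 2k columns in one resolution step. Choosing the violated
   constraint always in the end that is far from the cordon yields a path of length about n^k.

   Substituting every variable by m copies with a selector turns width into size: after a random
   selection and a random assignment to the other copies a clause remains falsifiable with at least
   w live variables with probability at most ((m + 1) / 2)^(-w). *)

theory Submission
  imports Defs "HOL-Number_Theory.Number_Theory" "HOL-Library.Countable_Set" "HOL-Real_Asymp.Real_Asymp"
begin

section \<open>Resolution refutations\<close>

text \<open>Compression is the obstacle: an edge of a compressed row blocks that row in a whole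
  residue class of columns, so a few edges may separate the ends without lying near any common
  column. Only a virtual column modulo \<open>B * Q\<close> is meaningful. The cylinder covers about
  half of that cycle, so that every cordon is far from one of the ends. The parameters fit together
  as follows. A falsifiable line has fewer than \<open>k + c\<close> live edges, so the set
  \<open>Y\<close> of a resolution step has at most \<open>k + c\<close>. If every row needs an
  edge, at most \<open>c\<close> rows can have more than one, while a prime is shared by
  \<open>c + 1\<close> rows: some row with a single edge still determines the residue modulo that
  prime. As \<open>c < k\<close>, such sets have fewer than \<open>2 * k\<close> edges. Hence fewer
  than \<open>k\<close> vertical edges are left to block a change of rows, which is the origin of
  the tolerance \<open>k\<close> in \<open>near\<close>, and each end of \<open>2 * k\<close>
  columns has a free one. Half the distance between the ends is about \<open>2 * k * Q\<close> and
  one step costs \<open>2 * k\<close>, which leaves about \<open>Q\<close> steps; \<open>Q\<close>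
  is at least \<open>n ^ k\<close>.\<close>

lemma is_clause_subset: "is_clause D \<Longrightarrow> C \<subseteq> D \<Longrightarrow> is_clause C"
  by (auto simp: is_clause_def finite_subset inj_on_subset)

text \<open>Without the demand for a final empty clause, derivations can be extended and truncated
  line by line; validity of line \<open>i\<close> depends only on the lines up to
  \<open>i\<close>.\<close>

definition valid_line :: "'v formula \<Rightarrow> 'v derivation \<Rightarrow> nat \<Rightarrow> bool" where
  "valid_line F R i \<longleftrightarrow> is_clause (fst (R ! i)) \<and>
     (case snd (R ! i) of
        Axiom \<Rightarrow> fst (R ! i) \<in> F
      | Resolvent a b \<Rightarrow> a < i \<and> b < i \<and> resolves_to (fst (R ! a)) (fst (R ! b)) (fst (R ! i)))"

definition is_derivation :: "'v formula \<Rightarrow> 'v derivation \<Rightarrow> bool" where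
  "is_derivation F R \<longleftrightarrow> (\<forall>i<length R. valid_line F R i)"

lemma is_refutation_iff:
  "is_refutation F R \<longleftrightarrow> R \<noteq> [] \<and> fst (last R) = {} \<and> is_derivation F R"
  by (simp add: is_refutation_def is_derivation_def valid_line_def)

lemma valid_line_cong:
  assumes "\<And>j. j \<le> i \<Longrightarrow> R ! j = R' ! j"
  shows "valid_line F R i \<longleftrightarrow> valid_line F R' i"
  using assms by (auto simp: valid_line_def split: justification.splits)

text \<open>Unsatisfiability of the constructed formulas is read off from the refutation that proves
  the upper bound.\<close>

lemma refutation_unsat:
  assumes "is_refutation F R"
  shows "\<not> satisfiable F"
proof
  assume "satisfiable F"
  then obtain \<alpha> where \<alpha>: "\<And>C. C \<in> F \<Longrightarrow> \<exists>l\<in>C. lit_true \<alpha> l"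
    by (auto simp: satisfiable_def)
  have sat: "\<exists>l\<in>fst (R ! i). lit_true \<alpha> l" if "i < length R" for i
    using that
  proof (induction i rule: less_induct)
    case (less i)
    then have line: "valid_line F R i"
      using assms by (simp add: is_refutation_iff is_derivation_def)
    show ?case
    proof (cases "snd (R ! i)")
      case Axiom
      then show ?thesis using line \<alpha> by (auto simp: valid_line_def)
    next
      case (Resolvent a b)
      with line have ab: "a < i" "b < i" and r: "resolves_to (fst (R ! a)) (fst (R ! b)) (fst (R ! i))"
        by (auto simp: valid_line_def)
      obtain l l' where l: "l \<in> fst (R ! a)" "lit_true \<alpha> l" "l' \<in> fst (R ! b)" "lit_true \<alpha> l'"
        using less.IH[OF ab(1)] less.IH[OF ab(2)] ab less.prems by auto
      obtain x C D where x: "fst (R ! a) = insert (Pos x) C" "fst (R ! b) = insert (Neg x) D"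
        "fst (R ! i) = C \<union> D"
        using r unfolding resolves_to_def by blast
      show ?thesis
        using l x by (cases "\<alpha> x") force+
    qed
  qed
  have "R \<noteq> []" and empty: "fst (R ! (length R - 1)) = {}"
    using assms by (auto simp: is_refutation_def last_conv_nth)
  then show False using sat[of "length R - 1"] by simp
qed

lemma is_derivation_snoc:
  assumes "is_derivation F R" "valid_line F (R @ [L]) (length R)"
  shows "is_derivation F (R @ [L])"
  unfolding is_derivation_def
proof (intro allI impI)
  fix i assume "i < length (R @ [L])"
  then consider "i < length R" | "i = length R" by fastforce
  then show "valid_line F (R @ [L]) i"
  proof cases
    case 1
    then have "valid_line F R i" using assms(1) by (simp add: is_derivation_def)
    then show ?thesis using valid_line_cong[of i R "R @ [L]" F] 1 by (simp add: nth_append)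
  qed (use assms(2) in simp)
qed

lemma is_derivation_copy:
  assumes "is_derivation F R" "a < length R"
  shows "is_derivation F (R @ [R ! a])"
proof (rule is_derivation_snoc[OF assms(1)])
  have "valid_line F R a" using assms by (simp add: is_derivation_def)
  then show "valid_line F (R @ [R ! a]) (length R)"
    using assms(2) by (auto simp: valid_line_def nth_append split: justification.splits)
qed

lemma is_derivation_take:
  assumes "is_derivation F R"
  shows "is_derivation F (take n R)"
  unfolding is_derivation_def
proof (intro allI impI)
  fix i assume i: "i < length (take n R)"
  then have "valid_line F R i" using assms by (simp add: is_derivation_def)
  then show "valid_line F (take n R) i" using valid_line_cong[of i "take n R" R F] i by simp
qed

text \<open>A node may be a strict weakening of the clause that is really derived for it; if the pivot
  is missing in a premise, that premise is repeated instead of resolved.\<close>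

lemma refutation_of_nodes:
  fixes cl :: "'a \<Rightarrow> 'v cls" and root :: 'a and rk :: "'a \<Rightarrow> nat"
  assumes fin: "finite N" and root: "root \<in> N" "cl root = {}"
    and cl: "\<And>\<nu>. \<nu> \<in> N \<Longrightarrow> is_clause (cl \<nu>)"
    and step: "\<And>\<nu>. \<nu> \<in> N \<Longrightarrow> (\<exists>C\<in>F. C \<subseteq> cl \<nu>)
      \<or> (\<exists>\<mu>\<in>N. rk \<mu> < rk \<nu> \<and> cl \<mu> \<subseteq> cl \<nu>)
      \<or> (\<exists>x. \<exists>\<mu>\<in>N. \<exists>\<mu>'\<in>N. rk \<mu> < rk \<nu> \<and> rk \<mu>' < rk \<nu>
            \<and> cl \<mu> \<subseteq> insert (Pos x) (cl \<nu>) \<and> cl \<mu>' \<subseteq> insert (Neg x) (cl \<nu>))"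
  shows "\<exists>R. is_refutation F R \<and> refutation_size R \<le> card N"
proof -
  obtain ys where ys: "set ys = N" "distinct ys"
    using finite_distinct_list[OF fin] by blast
  \<comment> \<open>In order of rank, every node comes after those from which it is derived.\<close>
  define xs where "xs = sort_key rk ys"
  have xs: "set xs = N" "distinct xs" "sorted (map rk xs)" "length xs = card N"
    using ys by (auto simp: xs_def distinct_card[symmetric])
  have before: "\<exists>a<n. xs ! a = \<mu>" if "\<mu> \<in> N" "rk \<mu> < rk (xs ! n)" "n < length xs" for \<mu> n
  proof -
    have "\<mu> \<in> set xs" using that(1) xs(1) by simp
    then obtain a where a: "a < length xs" "xs ! a = \<mu>"
      by (auto simp: in_set_conv_nth)
    have "\<not> n \<le> a"
    proof
      assume "n \<le> a"
      then have "map rk xs ! n \<le> map rk xs ! a"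
        using a xs(3) by (intro sorted_nth_mono) auto
      then show False using a that by auto
    qed
    with a show ?thesis by (intro exI[of _ a]) auto
  qed
  have "\<exists>R. length R = n \<and> is_derivation F R \<and> (\<forall>i<n. fst (R ! i) \<subseteq> cl (xs ! i))"
    if "n \<le> length xs" for n
    using that
  proof (induction n)
    case 0
    show ?case by (intro exI[of _ "[]"]) (auto simp: is_derivation_def)
  next
    case (Suc n)
    then obtain R where R: "length R = n" "is_derivation F R" "\<And>i. i < n \<Longrightarrow> fst (R ! i) \<subseteq> cl (xs ! i)"
      by auto
    let ?\<nu> = "xs ! n"
    have \<nu>: "?\<nu> \<in> N" using Suc.prems xs(1) by auto
    have extend: ?case if "is_derivation F (R @ [L])" "fst L \<subseteq> cl ?\<nu>" for L
      using that R by (intro exI[of _ "R @ [L]"]) (auto simp: nth_append less_Suc_eq)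
    have copy: ?case if "a < n" "fst (R ! a) \<subseteq> cl ?\<nu>" for a
      using extend[of "R ! a"] is_derivation_copy[OF R(2)] that R(1) by blast
    consider C where "C \<in> F" "C \<subseteq> cl ?\<nu>"
      | \<mu> where "\<mu> \<in> N" "rk \<mu> < rk ?\<nu>" "cl \<mu> \<subseteq> cl ?\<nu>"
      | x \<mu> \<mu>' where "\<mu> \<in> N" "\<mu>' \<in> N" "rk \<mu> < rk ?\<nu>" "rk \<mu>' < rk ?\<nu>"
          "cl \<mu> \<subseteq> insert (Pos x) (cl ?\<nu>)" "cl \<mu>' \<subseteq> insert (Neg x) (cl ?\<nu>)"
      using step[OF \<nu>] by blast
    then show ?case
    proof cases
      case 1
      then show ?thesis
        using is_clause_subset[OF cl[OF \<nu>]]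
        by (intro extend[of "(C, Axiom)"] is_derivation_snoc[OF R(2)]) (auto simp: valid_line_def)
    next
      case 2
      then obtain a where "a < n" "xs ! a = \<mu>" using before[of \<mu> n] Suc.prems by auto
      then show ?thesis using 2 R(3)[of a] by (intro copy[of a]) auto
    next
      case 3
      obtain a where a: "a < n" "xs ! a = \<mu>" using before[of \<mu> n] 3 Suc.prems by auto
      obtain b where b: "b < n" "xs ! b = \<mu>'" using before[of \<mu>' n] 3 Suc.prems by auto
      let ?A = "fst (R ! a)" and ?B = "fst (R ! b)"
      have AB: "?A \<subseteq> insert (Pos x) (cl ?\<nu>)" "?B \<subseteq> insert (Neg x) (cl ?\<nu>)"
        using R(3)[of a] R(3)[of b] a b 3 by auto
      show ?thesis
      proof (cases "Pos x \<in> ?A \<and> Neg x \<in> ?B")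
        case True
        let ?E = "(?A - {Pos x}) \<union> (?B - {Neg x})"
        have E: "?E \<subseteq> cl ?\<nu>" using AB by auto
        have "resolves_to ?A ?B ?E"
          unfolding resolves_to_def
          by (intro exI[of _ x] exI[of _ "?A - {Pos x}"] exI[of _ "?B - {Neg x}"]) (use True in auto)
        then show ?thesis
          using E a b R(1) is_clause_subset[OF cl[OF \<nu>] E]
          by (intro extend[of "(?E, Resolvent a b)"] is_derivation_snoc[OF R(2)])
             (auto simp: valid_line_def nth_append)
      next
        case False
        then show ?thesis using AB copy[OF a(1)] copy[OF b(1)] by blast
      qed
    qed
  qed
  from this[OF order_refl] obtain R where R: "length R = card N" "is_derivation F R"
    "\<And>i. i < card N \<Longrightarrow> fst (R ! i) \<subseteq> cl (xs ! i)" using xs(4) by auto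
  obtain r where r: "r < card N" "xs ! r = root"
    using root(1) xs(1,4) by (auto simp: in_set_conv_nth)
  \<comment> \<open>The root need not have the largest rank, so the derivation is cut off right
    after it.\<close>
  let ?R = "take (Suc r) R"
  have "fst (last ?R) = {}"
    using r R root(2) R(3)[of r] by (simp add: take_Suc_conv_app_nth)
  moreover have "?R \<noteq> []" using r R by auto
  ultimately have "is_refutation F ?R"
    using is_derivation_take[OF R(2), of "Suc r"] by (simp add: is_refutation_iff)
  then show ?thesis using r R by (intro exI[of _ ?R]) (auto simp: refutation_size_def)
qed

text \<open>Edges lead to strictly later positions, which bounds the length of a walk. This makes
  the set under \<open>Max\<close> in \<open>depth\<close> finite, so that a walk gives a lower
  bound.\<close>

lemma dag_edges_relpow_less:
  assumes "is_refutation F R" "(i, j) \<in> dag_edges R ^^ d"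
  shows "i + d \<le> j" and "d > 0 \<Longrightarrow> j < length R"
proof -
  have edge: "i < j \<and> j < length R" if "(i, j) \<in> dag_edges R" for i j
    using that assms(1) by (fastforce simp: dag_edges_def is_refutation_def)
  have "i + d \<le> j \<and> (d > 0 \<longrightarrow> j < length R)"
    using assms(2)
  proof (induction d arbitrary: j)
    case (Suc d)
    then obtain l where "(i, l) \<in> dag_edges R ^^ d" "(l, j) \<in> dag_edges R" by auto
    then show ?case using Suc.IH edge by fastforce
  qed auto
  then show "i + d \<le> j" and "d > 0 \<Longrightarrow> j < length R" by auto
qed

lemma depth_ge:
  assumes "is_refutation F R" "(i, j) \<in> dag_edges R ^^ d"
  shows "d \<le> depth R"
proof -
  have "{d. dag_edges R ^^ d \<noteq> {}} \<subseteq> {..length R}"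
  proof
    fix e assume "e \<in> {d. dag_edges R ^^ d \<noteq> {}}"
    then obtain i j where ij: "(i, j) \<in> dag_edges R ^^ e" by auto
    show "e \<in> {..length R}"
      using dag_edges_relpow_less[OF assms(1) ij] by (cases "e = 0") auto
  qed
  then have "finite {d. dag_edges R ^^ d \<noteq> {}}" by (rule finite_subset) auto
  then show ?thesis unfolding depth_def using assms(2) by (intro Max_ge) auto
qed

section \<open>Transport of formulas and refutations along a renaming\<close>

definition rename :: "('v \<Rightarrow> 'w) \<Rightarrow> 'v cls \<Rightarrow> 'w cls" where
  "rename f C = map_literal f ` C"

lemma inj_map_literal: "inj f \<Longrightarrow> inj (map_literal f)"
  by (rule literal.inj_map)

lemma var_map_literal [simp]: "var (map_literal f l) = f (var l)"
  by (cases l) auto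

lemma card_rename: "inj f \<Longrightarrow> card (rename f C) = card C"
  unfolding rename_def by (rule card_image) (rule inj_on_subset[OF inj_map_literal], auto)

lemma is_clause_rename:
  assumes "inj f"
  shows "is_clause (rename f C) \<longleftrightarrow> is_clause C"
proof -
  have "inj_on var (map_literal f ` C) \<longleftrightarrow> inj_on (var \<circ> map_literal f) C"
    by (rule comp_inj_on_iff) (rule inj_on_subset[OF inj_map_literal[OF assms]], auto)
  also have "var \<circ> map_literal f = f \<circ> var" by auto
  also have "inj_on (f \<circ> var) C \<longleftrightarrow> inj_on var C"
    using assms by (auto simp: inj_on_def)
  finally have "inj_on var (map_literal f ` C) \<longleftrightarrow> inj_on var C" .
  moreover have "finite (map_literal f ` C) \<longleftrightarrow> finite C"
    by (rule finite_image_iff) (rule inj_on_subset[OF inj_map_literal[OF assms]], auto)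
  ultimately show ?thesis by (simp add: is_clause_def rename_def)
qed

lemma is_cnf_rename:
  assumes "inj f"
  shows "is_cnf w (rename f ` F) \<longleftrightarrow> is_cnf w F"
proof -
  have "inj (rename f)"
    using inj_map_literal[OF assms] by (auto simp: inj_def rename_def inj_image_eq_iff)
  then have "finite (rename f ` F) \<longleftrightarrow> finite F"
    by (meson finite_image_iff inj_on_subset subset_UNIV)
  then show ?thesis
    by (auto simp: is_cnf_def is_clause_rename[OF assms] card_rename[OF assms])
qed

lemma formula_size_rename:
  assumes "inj f"
  shows "formula_size (rename f ` F) = formula_size F"
proof -
  have "inj_on (rename f) F"
    using inj_map_literal[OF assms] by (auto simp: inj_on_def rename_def inj_image_eq_iff)
  then show ?thesis
    by (simp add: formula_size_def sum.reindex card_rename[OF assms])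
qed

lemma vars_rename: "vars (rename f ` F) = f ` vars F"
  by (force simp: vars_def rename_def)

definition rename_derivation :: "('v \<Rightarrow> 'w) \<Rightarrow> 'v derivation \<Rightarrow> 'w derivation" where
  "rename_derivation f R = map (map_prod (rename f) id) R"

lemma length_rename_derivation [simp]: "length (rename_derivation f R) = length R"
  by (simp add: rename_derivation_def)

lemma depth_rename_derivation: "depth (rename_derivation f R) = depth R"
proof -
  have "dag_edges (rename_derivation f R) = dag_edges R"
    by (auto simp: dag_edges_def rename_derivation_def)
  then show ?thesis by (simp add: depth_def)
qed

lemma resolves_to_rename:
  assumes "inj f" "resolves_to A B E"
  shows "resolves_to (rename f A) (rename f B) (rename f E)"
proof -
  obtain x C D where x: "Pos x \<notin> C" "Neg x \<notin> D" "A = insert (Pos x) C" "B = insert (Neg x) D"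
    "E = C \<union> D"
    using assms(2) by (auto simp: resolves_to_def)
  have "Pos (f x) \<notin> rename f C" "Neg (f x) \<notin> rename f D"
    using x(1,2) inj_image_mem_iff[OF inj_map_literal[OF assms(1)]]
    unfolding rename_def by (metis literal.simps(9), metis literal.simps(10))
  then show ?thesis
    unfolding resolves_to_def x(3-5)
    by (intro exI[of _ "f x"] exI[of _ "rename f C"] exI[of _ "rename f D"])
       (auto simp: rename_def)
qed

text \<open>The construction uses variables of type \<open>edge gvar\<close>, the theorem asks for
  \<open>nat\<close>. A bijection carries the short refutation over, and its inverse carries
  arbitrary refutations back for the depth bound.\<close>

lemma is_refutation_rename:
  assumes "inj f" "is_refutation F R"
  shows "is_refutation (rename f ` F) (rename_derivation f R)"
proof -
  let ?S = "rename_derivation f R"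
  have "valid_line (rename f ` F) ?S i" if i: "i < length R" for i
  proof -
    have "valid_line F R i" using assms(2) i by (simp add: is_refutation_iff is_derivation_def)
    then show ?thesis
      using i by (auto simp: valid_line_def rename_derivation_def is_clause_rename[OF assms(1)]
          intro: resolves_to_rename[OF assms(1)] split: justification.splits)
  qed
  moreover have "R \<noteq> []" "fst (last R) = {}"
    using assms(2) by (auto simp: is_refutation_def)
  then have "?S \<noteq> []" "fst (last ?S) = {}"
    by (auto simp: rename_derivation_def last_map rename_def)
  ultimately show ?thesis by (simp add: is_refutation_iff is_derivation_def)
qed

section \<open>Lifting by a selector gadget\<close>

text \<open>\<open>Sel x i\<close> selects the copy \<open>Val x i\<close> of \<open>x\<close>, and \<open>Ch x t\<close> states that some copy with index at
  least \<open>t\<close> is selected.\<close>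

datatype 'a gvar = Sel 'a nat | Val 'a nat | Ch 'a nat

instance gvar :: (countable) countable
  by countable_datatype

text \<open>To be read as: if copy \<open>g x\<close> is selected, then it makes the literal true.
  Two literals for one turn the width 4 of the parity constraints into 8.\<close>

primrec lift_lit :: "('a \<Rightarrow> nat) \<Rightarrow> 'a literal \<Rightarrow> 'a gvar cls" where
  "lift_lit g (Pos x) = {Neg (Sel x (g x)), Pos (Val x (g x))}"
| "lift_lit g (Neg x) = {Neg (Sel x (g x)), Neg (Val x (g x))}"

definition lift_cls :: "('a \<Rightarrow> nat) \<Rightarrow> 'a cls \<Rightarrow> 'a gvar cls" where
  "lift_cls g C = (\<Union>l\<in>C. lift_lit g l)"

text \<open>The chain of \<open>Ch\<close> variables expresses in width 3 that some copy is
  selected, where a single clause would have width \<open>m\<close>.\<close>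

definition selector_axioms :: "nat \<Rightarrow> 'a \<Rightarrow> 'a gvar formula" where
  "selector_axioms m x = {{Pos (Ch x 0)}, {Neg (Ch x m)}} \<union>
     (\<lambda>t. {Neg (Ch x t), Pos (Sel x t), Pos (Ch x (Suc t))}) ` {..<m}"

definition lift_formula :: "nat \<Rightarrow> 'a formula \<Rightarrow> 'a gvar formula" where
  "lift_formula m F =
     (\<Union>C\<in>F. (\<lambda>g. lift_cls g C) ` (var ` C \<rightarrow>\<^sub>E {..<m})) \<union> (\<Union>x\<in>vars F. selector_axioms m x)"

section \<open>Width and size of the lifted formula\<close>

lemma finite_lift_lit [simp]: "finite (lift_lit g l)"
  by (cases l) auto

lemma finite_lift_cls: "finite C \<Longrightarrow> finite (lift_cls g C)"
  by (auto simp: lift_cls_def)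

lemma card_lift_cls_le:
  assumes "finite C"
  shows "card (lift_cls g C) \<le> 2 * card C"
proof -
  have "card (lift_cls g C) \<le> (\<Sum>l\<in>C. card (lift_lit g l))"
    unfolding lift_cls_def by (rule card_UN_le[OF assms])
  also have "\<dots> \<le> (\<Sum>l\<in>C. 2)"
  proof (rule sum_mono)
    fix l show "card (lift_lit g l) \<le> 2" by (cases l) auto
  qed
  finally show ?thesis by simp
qed

lemma lift_cls_cong: "(\<And>x. x \<in> var ` C \<Longrightarrow> g x = g' x) \<Longrightarrow> lift_cls g C = lift_cls g' C"
proof -
  assume g: "\<And>x. x \<in> var ` C \<Longrightarrow> g x = g' x"
  have "lift_lit g l = lift_lit g' l" if "l \<in> C" for l
    using g[OF imageI[OF that]] by (cases l) auto
  then show ?thesis by (simp add: lift_cls_def)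
qed

lemma lift_cls_mono: "C \<subseteq> D \<Longrightarrow> lift_cls g C \<subseteq> lift_cls g D"
  by (auto simp: lift_cls_def)

lemma lift_cls_insert: "lift_cls g (insert l C) = lift_lit g l \<union> lift_cls g C"
  by (auto simp: lift_cls_def)

lemma lift_clsE:
  assumes "l \<in> lift_cls g C"
  obtains x where "Pos x \<in> C \<or> Neg x \<in> C" "l = Neg (Sel x (g x))"
  | x where "Pos x \<in> C" "l = Pos (Val x (g x))"
  | x where "Neg x \<in> C" "l = Neg (Val x (g x))"
proof -
  obtain l' where "l' \<in> C" "l \<in> lift_lit g l'" using assms by (auto simp: lift_cls_def)
  then show ?thesis using that by (cases l') auto
qed

lemma in_var_image_iff: "y \<in> var ` C \<longleftrightarrow> Pos y \<in> C \<or> Neg y \<in> C"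
proof
  assume "y \<in> var ` C"
  then obtain l where "l \<in> C" "y = var l" by auto
  then show "Pos y \<in> C \<or> Neg y \<in> C" by (cases l) auto
qed (auto intro: rev_image_eqI)

lemma is_clause_no_clash: "is_clause C \<Longrightarrow> Pos x \<in> C \<Longrightarrow> Neg x \<notin> C"
  by (auto simp: is_clause_def inj_on_def) force

lemma is_clause_lift_cls:
  assumes "is_clause C"
  shows "is_clause (lift_cls g C)"
proof -
  have "inj_on var (lift_cls g C)"
    by (rule inj_onI, elim lift_clsE) (use is_clause_no_clash[OF assms] in auto)
  moreover have "finite (lift_cls g C)"
    using assms by (intro finite_lift_cls) (auto simp: is_clause_def)
  ultimately show ?thesis by (simp add: is_clause_def)
qed

lemma is_clause_selector_axioms: "C \<in> selector_axioms m x \<Longrightarrow> is_clause C \<and> card C \<le> 3"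
  by (auto simp: selector_axioms_def is_clause_def card_insert_if)

lemma finite_vars: "is_cnf w F \<Longrightarrow> finite (vars F)"
  by (auto simp: vars_def is_cnf_def is_clause_def)

lemma card_vars_le:
  assumes "is_cnf w F"
  shows "card (vars F) \<le> w * card F"
proof -
  have F: "finite F" and C: "\<And>C. C \<in> F \<Longrightarrow> finite C \<and> card C \<le> w"
    using assms by (auto simp: is_cnf_def is_clause_def)
  have "card (vars F) \<le> (\<Sum>C\<in>F. card (var ` C))"
    unfolding vars_def by (rule card_UN_le[OF F])
  also have "\<dots> \<le> (\<Sum>C\<in>F. w)"
    by (rule sum_mono) (meson C card_image_le le_trans)
  finally show ?thesis by (simp add: mult.commute)
qed

lemma is_cnf_lift_formula:
  assumes "is_cnf w F" "2 \<le> w"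
  shows "is_cnf (2 * w) (lift_formula m F)"
  unfolding is_cnf_def
proof (intro conjI ballI)
  have F: "finite F" and C: "\<And>C. C \<in> F \<Longrightarrow> is_clause C \<and> finite C \<and> card C \<le> w"
    using assms(1) by (auto simp: is_cnf_def is_clause_def)
  show "finite (lift_formula m F)"
    using finite_vars[OF assms(1)] F C
    by (auto simp: lift_formula_def selector_axioms_def intro!: finite_PiE)
  fix D assume "D \<in> lift_formula m F"
  then consider C g where "C \<in> F" "D = lift_cls g C" | x where "D \<in> selector_axioms m x"
    by (auto simp: lift_formula_def)
  then have "is_clause D \<and> card D \<le> 2 * w"
  proof cases
    case 1
    then show ?thesis
      using is_clause_lift_cls[of C g] card_lift_cls_le[of C g] C[of C] by auto
  next
    case 2
    then show ?thesis using is_clause_selector_axioms[of D m x] assms(2) by auto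
  qed
  then show "is_clause D" "card D \<le> 2 * w" by auto
qed

lemma card_lift_formula_le:
  assumes "is_cnf w F" "1 \<le> m" "1 \<le> w"
  shows "card (lift_formula m F) \<le> (1 + 3 * w) * m ^ w * card F"
proof -
  have F: "finite F" and C: "\<And>C. C \<in> F \<Longrightarrow> finite C \<and> card C \<le> w"
    using assms(1) by (auto simp: is_cnf_def is_clause_def)
  have "card (\<Union>C\<in>F. (\<lambda>g. lift_cls g C) ` (var ` C \<rightarrow>\<^sub>E {..<m})) \<le> (\<Sum>C\<in>F. m ^ w)"
  proof (rule order_trans[OF card_UN_le[OF F]], rule sum_mono)
    fix D assume D: "D \<in> F"
    have "card ((\<lambda>g. lift_cls g D) ` (var ` D \<rightarrow>\<^sub>E {..<m})) \<le> card (var ` D \<rightarrow>\<^sub>E {..<m})"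
      using C[OF D] by (intro card_image_le finite_PiE) auto
    also have "\<dots> = m ^ card (var ` D)"
      using C[OF D] by (subst card_PiE) auto
    also have "\<dots> \<le> m ^ w"
      using C[OF D] card_image_le[of D var] assms(2) by (intro power_increasing) auto
    finally show "card ((\<lambda>g. lift_cls g D) ` (var ` D \<rightarrow>\<^sub>E {..<m})) \<le> m ^ w" .
  qed
  moreover have "card (\<Union>x\<in>vars F. selector_axioms m x) \<le> (\<Sum>x\<in>vars F. 3 * m ^ w)"
  proof (rule order_trans[OF card_UN_le[OF finite_vars[OF assms(1)]]], rule sum_mono)
    fix x :: 'a
    have "card (selector_axioms m x) \<le> card {{Pos (Ch x 0)}, {Neg (Ch x m)}}
        + card ((\<lambda>t. {Neg (Ch x t), Pos (Sel x t), Pos (Ch x (Suc t))}) ` {..<m})"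
      unfolding selector_axioms_def by (rule card_Un_le)
    also have "\<dots> \<le> 2 + m"
      using card_image_le[of "{..<m}" "\<lambda>t. {Neg (Ch x t), Pos (Sel x t), Pos (Ch x (Suc t))}"]
      by (intro add_mono) (auto simp: card_insert_if)
    also have "\<dots> \<le> 3 * m" using assms(2) by simp
    also have "m ^ 1 \<le> m ^ w" using assms(2,3) by (intro power_increasing) auto
    then have "3 * m \<le> 3 * m ^ w" by simp
    finally show "card (selector_axioms m x) \<le> 3 * m ^ w" by simp
  qed
  ultimately have "card (lift_formula m F) \<le> card F * m ^ w + card (vars F) * (3 * m ^ w)"
    unfolding lift_formula_def by (intro order_trans[OF card_Un_le] add_mono) auto
  also have "\<dots> \<le> card F * m ^ w + (w * card F) * (3 * m ^ w)"
    using card_vars_le[OF assms(1)] by (intro add_left_mono mult_right_mono) auto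
  finally show ?thesis by (simp add: algebra_simps)
qed

lemma card_vars_lift_formula_le:
  assumes "is_cnf w F" "1 \<le> m"
  shows "card (vars (lift_formula m F)) \<le> 4 * m * (w * card F)"
proof -
  have "vars (lift_formula m F) \<subseteq>
      (\<Union>x\<in>vars F. Sel x ` {..<m} \<union> Val x ` {..<m} \<union> Ch x ` {..m})"
    (is "_ \<subseteq> ?U")
  proof
    fix y assume "y \<in> vars (lift_formula m F)"
    then obtain D l where D: "D \<in> lift_formula m F" "l \<in> D" "y = var l"
      by (auto simp: vars_def)
    from D(1) consider C g where "C \<in> F" "g \<in> var ` C \<rightarrow>\<^sub>E {..<m}" "D = lift_cls g C"
      | x where "x \<in> vars F" "D \<in> selector_axioms m x"
      by (auto simp: lift_formula_def)
    then show "y \<in> ?U"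
    proof cases
      case 1
      obtain x where x: "x \<in> var ` C" "y = Sel x (g x) \<or> y = Val x (g x)"
        using D(2)[unfolded 1(3)] D(3) by (elim lift_clsE) (auto simp: in_var_image_iff)
      then have "g x < m" "x \<in> vars F" using 1 by (auto simp: vars_def)
      then show ?thesis using x(2) by (intro UN_I[of x]) auto
    next
      case 2
      then have "y \<in> Sel x ` {..<m} \<union> Val x ` {..<m} \<union> Ch x ` {..m}"
        using D(2,3) by (auto simp: selector_axioms_def)
      then show ?thesis using 2(1) by (intro UN_I[of x])
    qed
  qed
  then have "card (vars (lift_formula m F)) \<le> card ?U"
    using finite_vars[OF assms(1)] by (intro card_mono) auto
  also have "\<dots> \<le> (\<Sum>x\<in>vars F. 4 * m)"
  proof (rule order_trans[OF card_UN_le[OF finite_vars[OF assms(1)]]], rule sum_mono)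
    fix x :: 'a
    have "card (Sel x ` {..<m} \<union> Val x ` {..<m} \<union> Ch x ` {..m}) \<le>
        card (Sel x ` {..<m}) + card (Val x ` {..<m}) + card (Ch x ` {..m})"
      by (intro order_trans[OF card_Un_le] add_right_mono card_Un_le)
    also have "\<dots> \<le> m + m + Suc m"
      using card_image_le[of "{..<m}" "Sel x"] card_image_le[of "{..<m}" "Val x"]
        card_image_le[of "{..m}" "Ch x"] by auto
    also have "\<dots> \<le> 4 * m" using assms(2) by simp
    finally show "card (Sel x ` {..<m} \<union> Val x ` {..<m} \<union> Ch x ` {..m}) \<le> 4 * m" .
  qed
  also have "\<dots> = 4 * m * card (vars F)" by simp
  also have "\<dots> \<le> 4 * m * (w * card F)"
    using card_vars_le[OF assms(1)] by (intro mult_left_mono) auto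
  finally show ?thesis .
qed

lemma formula_size_le: "is_cnf w F \<Longrightarrow> formula_size F \<le> w * card F"
  unfolding formula_size_def is_cnf_def
  using sum_bounded_above[of F card w] by (auto simp: mult.commute)

text \<open>A node becomes one lifted clause for every choice \<open>g\<close> of copies for its
  variables. A query of \<open>x\<close> becomes a scan along the chain of \<open>x\<close> for a
  selected copy \<open>t\<close>, followed by a query of \<open>Val x t\<close>. Each variable
  contributes a factor \<open>m\<close>; the scan costs a further \<open>7 * m\<close>, but only at
  nodes of width at most \<open>w\<close>.\<close>

lemma lifted_refutation:
  fixes cl :: "'n \<Rightarrow> 'a cls" and root :: 'n and rk :: "'n \<Rightarrow> nat"
  assumes fin: "finite N" and root: "root \<in> N" "cl root = {}" and m: "1 \<le> m"
    and cl: "\<And>\<nu>. \<nu> \<in> N \<Longrightarrow> is_clause (cl \<nu>) \<and> card (cl \<nu>) \<le> Suc w"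
    and step: "\<And>\<nu>. \<nu> \<in> N \<Longrightarrow> (\<exists>C\<in>F. C \<subseteq> cl \<nu>)
      \<or> (\<exists>\<mu>\<in>N. rk \<mu> < rk \<nu> \<and> cl \<mu> \<subseteq> cl \<nu>)
      \<or> (card (cl \<nu>) \<le> w \<and> (\<exists>x\<in>vars F. x \<notin> var ` cl \<nu> \<and> (\<exists>\<mu>\<in>N. \<exists>\<mu>'\<in>N. rk \<mu> < rk \<nu> \<and> rk \<mu>' < rk \<nu>
            \<and> cl \<mu> \<subseteq> insert (Pos x) (cl \<nu>) \<and> cl \<mu>' \<subseteq> insert (Neg x) (cl \<nu>))))"
  shows "\<exists>R. is_refutation (lift_formula m F) R \<and> refutation_size R \<le> card N * (7 * m ^ Suc w)"
proof -
  define leaf where "leaf \<nu> \<longleftrightarrow> (\<exists>C\<in>F. C \<subseteq> cl \<nu>) \<or> (\<exists>\<mu>\<in>N. rk \<mu> < rk \<nu> \<and> cl \<mu> \<subseteq> cl \<nu>)" for \<nu>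
  define query where "query \<nu> x \<longleftrightarrow> card (cl \<nu>) \<le> w \<and> x \<in> vars F \<and> x \<notin> var ` cl \<nu> \<and>
    (\<exists>\<mu>\<in>N. rk \<mu> < rk \<nu> \<and> cl \<mu> \<subseteq> insert (Pos x) (cl \<nu>)) \<and>
    (\<exists>\<mu>\<in>N. rk \<mu> < rk \<nu> \<and> cl \<mu> \<subseteq> insert (Neg x) (cl \<nu>))" for \<nu> x
  have "\<forall>\<nu>\<in>{\<nu> \<in> N. \<not> leaf \<nu>}. \<exists>x. query \<nu> x"
  proof
    fix \<nu> assume "\<nu> \<in> {\<nu> \<in> N. \<not> leaf \<nu>}"
    then have \<nu>: "\<nu> \<in> N" "\<not> leaf \<nu>" by auto
    obtain x \<mu> \<mu>' where "card (cl \<nu>) \<le> w" "x \<in> vars F" "x \<notin> var ` cl \<nu>" "\<mu> \<in> N" "\<mu>' \<in> N"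
      "rk \<mu> < rk \<nu>" "rk \<mu>' < rk \<nu>" "cl \<mu> \<subseteq> insert (Pos x) (cl \<nu>)" "cl \<mu>' \<subseteq> insert (Neg x) (cl \<nu>)"
      using step[OF \<nu>(1)] \<nu>(2) unfolding leaf_def by (elim disjE conjE bexE) auto
    then show "\<exists>x. query \<nu> x"
      unfolding query_def by (intro exI[of _ x] conjI bexI[of _ \<mu>] bexI[of _ \<mu>'])
  qed
  from bchoice[OF this] obtain p where "\<forall>\<nu>\<in>{\<nu> \<in> N. \<not> leaf \<nu>}. query \<nu> (p \<nu>)" ..
  then have p: "query \<nu> (p \<nu>)" if "\<nu> \<in> N" "\<not> leaf \<nu>" for \<nu> using that by simp
  note p = p[unfolded query_def]
  define G where "G \<nu> = (var ` cl \<nu> \<rightarrow>\<^sub>E {..<m})" for \<nu>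
  define K :: "'n \<Rightarrow> (nat \<times> nat) set" where "K \<nu> = insert (0, 0) (if leaf \<nu> then {} else insert (4, 0) ({1} \<times> {..m} \<union> {2, 3, 5} \<times> {..<m}))"
    for \<nu>
  \<comment> \<open>The tag \<open>a\<close> is 0 for the node itself, 1 for the scan at position
    \<open>t\<close>, and 2 or 3 if copy \<open>t\<close> turned out to be selected or not. The
    clauses with tags 4 and 5, and with tag 1 at \<open>t = m\<close>, contain selector
    axioms.\<close>
  define extra :: "'n \<Rightarrow> nat \<Rightarrow> nat \<Rightarrow> 'a gvar cls" where
    "extra \<nu> a t = (if a = 0 then {} else if a = 1 then {Neg (Ch (p \<nu>) t)}
       else if a = 2 then {Neg (Sel (p \<nu>) t)}
       else if a = 3 then {Neg (Ch (p \<nu>) t), Pos (Sel (p \<nu>) t)}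
       else if a = 4 then {Pos (Ch (p \<nu>) 0)}
       else {Neg (Ch (p \<nu>) t), Pos (Sel (p \<nu>) t), Pos (Ch (p \<nu>) (Suc t))})" for \<nu> a t
  define cl' where "cl' = (\<lambda>(\<nu>, g, a, t). lift_cls g (cl \<nu>) \<union> extra \<nu> a t)"
  \<comment> \<open>Lexicographic in the old rank and the progress of the scan; the factor exceeds
    every offset.\<close>
  define rk' :: "'n \<times> ('a \<Rightarrow> nat) \<times> nat \<times> nat \<Rightarrow> nat" where
    "rk' = (\<lambda>(\<nu>, g, a, t). rk \<nu> * (4 * m + 10) +
       (if a = 0 then 4 * m + 9 else 4 * (m - t) + (if a = 1 then 3 else if a < 4 then 1 else 0)))"
  define N' where "N' = (SIGMA \<nu>:N. G \<nu> \<times> K \<nu>)"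
  have memN': "(\<nu>, g, a, t) \<in> N' \<longleftrightarrow> \<nu> \<in> N \<and> g \<in> G \<nu> \<and> (a, t) \<in> K \<nu>" for \<nu> g a t
    by (auto simp: N'_def)
  have finG: "finite (G \<nu>)" if "\<nu> \<in> N" for \<nu>
    unfolding G_def using cl[OF that] by (intro finite_PiE) (auto simp: is_clause_def)
  have finK: "finite (K \<nu>)" for \<nu> by (auto simp: K_def)
  have finN': "finite N'"
    unfolding N'_def using fin finG finK by (intro finite_SigmaI) auto
  have "card N' = (\<Sum>\<nu>\<in>N. card (G \<nu>) * card (K \<nu>))"
    unfolding N'_def using fin finG finK by (subst card_SigmaI) (auto simp: card_cartesian_product)
  also have "\<dots> \<le> (\<Sum>\<nu>\<in>N. 7 * m ^ Suc w)"
  proof (rule sum_mono)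
    fix \<nu> assume \<nu>: "\<nu> \<in> N"
    have G: "card (G \<nu>) = m ^ card (cl \<nu>)"
      unfolding G_def using cl[OF \<nu>] by (subst card_PiE) (auto simp: is_clause_def card_image)
    show "card (G \<nu>) * card (K \<nu>) \<le> 7 * m ^ Suc w"
    \<comment> \<open>A leaf may have \<open>w + 1\<close> variables, but it needs no scan.\<close>
    proof (cases "leaf \<nu>")
      case True
      then have "card (K \<nu>) = 1" by (simp add: K_def)
      moreover have "m ^ card (cl \<nu>) \<le> m ^ Suc w"
        using cl[OF \<nu>] m by (intro power_increasing) auto
      ultimately show ?thesis using G by simp
    next
      case False
      have "card ({1::nat} \<times> {..m} \<union> {2, 3, 5::nat} \<times> {..<m}) \<le> Suc m + 3 * m"
        by (rule order_trans[OF card_Un_le]) (auto simp: card_cartesian_product)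
      then have "card (insert (4::nat, 0) ({1} \<times> {..m} \<union> {2, 3, 5} \<times> {..<m})) \<le> 4 * m + 2"
        by (subst card_insert_if) auto
      then have "card (K \<nu>) \<le> 4 * m + 3"
        using False by (simp add: K_def card_insert_if)
      then have "card (K \<nu>) \<le> 7 * m" using m by simp
      moreover have "m ^ card (cl \<nu>) \<le> m ^ w"
        using p[OF \<nu> False] m by (intro power_increasing) auto
      ultimately have "card (G \<nu>) * card (K \<nu>) \<le> m ^ w * (7 * m)"
        unfolding G by (intro mult_mono) auto
      then show ?thesis by (simp add: mult_ac)
    qed
  qed
  finally have card: "card N' \<le> card N * (7 * m ^ Suc w)" by simp
  \<comment> \<open>A premise may contain fewer variables; \<open>restrict\<close> forgets the
    copies chosen for the others.\<close>
  have sub: "\<exists>\<mu>'\<in>N'. \<exists>g'. \<mu>' = (\<mu>, g', 0, 0) \<and> cl' \<mu>' \<subseteq> lift_cls h (cl \<mu>)"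
    if "\<mu> \<in> N" "\<And>x. x \<in> var ` cl \<mu> \<Longrightarrow> h x < m" for \<mu> h
  proof (intro bexI exI conjI)
    show "(\<mu>, restrict h (var ` cl \<mu>), 0, 0) \<in> N'"
      using that by (auto simp: memN' G_def K_def)
    show "cl' (\<mu>, restrict h (var ` cl \<mu>), 0, 0) \<subseteq> lift_cls h (cl \<mu>)"
      using lift_cls_cong[of "cl \<mu>" "restrict h (var ` cl \<mu>)" h] by (auto simp: cl'_def extra_def)
  qed (rule refl)
  have rk_less: "rk \<mu> * (4 * m + 10) + (4 * m + 9) < rk \<nu> * (4 * m + 10)" if "rk \<mu> < rk \<nu>" for \<mu> \<nu>
  proof -
    have "Suc (rk \<mu>) * (4 * m + 10) \<le> rk \<nu> * (4 * m + 10)"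
      using that by (intro mult_right_mono) auto
    then show ?thesis by simp
  qed
  have cl': "is_clause (cl' \<nu>')" if "\<nu>' \<in> N'" for \<nu>'
  proof -
    obtain \<nu> g a t where \<nu>': "\<nu>' = (\<nu>, g, a, t)" by (metis prod_cases4)
    with that have \<nu>: "\<nu> \<in> N" "(a, t) \<in> K \<nu>" by (auto simp: memN')
    have L: "is_clause (lift_cls g (cl \<nu>))" using is_clause_lift_cls cl \<nu> by blast
    show ?thesis
    proof (cases "leaf \<nu>")
      case True
      then show ?thesis using L \<nu> by (auto simp: cl'_def \<nu>' K_def extra_def)
    next
      case False
      have px: "p \<nu> \<notin> var ` cl \<nu>" using p[OF \<nu>(1) False] by auto
      have new: "Ch (p \<nu>) s \<notin> var ` lift_cls g (cl \<nu>)" "Sel (p \<nu>) s \<notin> var ` lift_cls g (cl \<nu>)" for s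
        using px by (force elim!: lift_clsE)+
      show ?thesis
        using L new by (auto simp: is_clause_def cl'_def \<nu>' extra_def)
    qed
  qed
  have "\<exists>g. (root, g, 0, 0) \<in> N' \<and> cl' (root, g, 0, 0) = {}"
    using root by (intro exI[of _ "\<lambda>_. undefined"])
      (auto simp: memN' G_def K_def cl'_def extra_def lift_cls_def)
  then obtain g0 where g0: "(root, g0, 0, 0) \<in> N'" "cl' (root, g0, 0, 0) = {}" by blast
  have axiom_sel: "C \<in> lift_formula m F" if "x \<in> vars F" "C \<in> selector_axioms m x" for x C
    using that by (auto simp: lift_formula_def)
  have "\<exists>R. is_refutation (lift_formula m F) R \<and> refutation_size R \<le> card N'"
  proof (rule refutation_of_nodes[where N = N' and cl = cl' and rk = rk', OF finN' g0 cl'])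
    fix \<nu>' assume "\<nu>' \<in> N'"
    moreover obtain \<nu> g a t where \<nu>': "\<nu>' = (\<nu>, g, a, t)" by (metis prod_cases4)
    ultimately have \<nu>: "\<nu> \<in> N" and g: "g \<in> G \<nu>" and K: "(a, t) \<in> K \<nu>" by (auto simp: memN')
    have gm: "g x < m" if "x \<in> var ` cl \<nu>" for x using g that by (auto simp: G_def)
    let ?Q = "\<lambda>\<nu>'. (\<exists>C\<in>lift_formula m F. C \<subseteq> cl' \<nu>')
      \<or> (\<exists>\<mu>\<in>N'. rk' \<mu> < rk' \<nu>' \<and> cl' \<mu> \<subseteq> cl' \<nu>')
      \<or> (\<exists>x. \<exists>\<mu>\<in>N'. \<exists>\<mu>'\<in>N'. rk' \<mu> < rk' \<nu>' \<and> rk' \<mu>' < rk' \<nu>'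
            \<and> cl' \<mu> \<subseteq> insert (Pos x) (cl' \<nu>') \<and> cl' \<mu>' \<subseteq> insert (Neg x) (cl' \<nu>'))"
    show "?Q \<nu>'"
    proof (cases "leaf \<nu>")
      case True
      then have at: "a = 0" "t = 0" using K by (auto simp: K_def)
      consider C where "C \<in> F" "C \<subseteq> cl \<nu>" | \<mu> where "\<mu> \<in> N" "rk \<mu> < rk \<nu>" "cl \<mu> \<subseteq> cl \<nu>"
        using True by (auto simp: leaf_def)
      then show ?thesis
      proof cases
        case 1
        have "lift_cls (restrict g (var ` C)) C \<in> lift_formula m F"
          using 1 gm by (auto simp: lift_formula_def intro!: bexI[of _ C] imageI)
        moreover have "lift_cls (restrict g (var ` C)) C = lift_cls g C"
          by (rule lift_cls_cong) auto
        ultimately show ?thesis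
          using lift_cls_mono[OF 1(2), of g] by (auto simp: \<nu>' at cl'_def extra_def)
      next
        case 2
        have "g x < m" if "x \<in> var ` cl \<mu>" for x using gm 2(3) that by blast
        from sub[where h = g, OF 2(1) this] obtain g' where g': "(\<mu>, g', 0, 0) \<in> N'"
          "cl' (\<mu>, g', 0, 0) \<subseteq> lift_cls g (cl \<mu>)" by blast
        have "rk' (\<mu>, g', 0, 0) < rk' \<nu>'" using 2(2) by (simp add: rk'_def \<nu>' at)
        moreover have "cl' (\<mu>, g', 0, 0) \<subseteq> cl' \<nu>'"
          using g'(2) lift_cls_mono[OF 2(3), of g] by (auto simp: \<nu>' at cl'_def extra_def)
        ultimately show ?thesis using g'(1) by blast
      qed
    next
      case False
      let ?x = "p \<nu>"
      note px = p[OF \<nu> False]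
      obtain \<mu>1 \<mu>2 where \<mu>: "\<mu>1 \<in> N" "rk \<mu>1 < rk \<nu>" "cl \<mu>1 \<subseteq> insert (Pos ?x) (cl \<nu>)"
         "\<mu>2 \<in> N" "rk \<mu>2 < rk \<nu>" "cl \<mu>2 \<subseteq> insert (Neg ?x) (cl \<nu>)" using px by blast
      have inN': "(\<nu>, g, b, s) \<in> N'"
        if "b = 1 \<and> s \<le> m \<or> (b = 2 \<or> b = 3 \<or> b = 5) \<and> s < m \<or> b = 4 \<and> s = 0" for b s
        using that \<nu> g False by (auto simp: memN' K_def)
      have child: "\<exists>\<mu>'\<in>N'. rk' \<mu>' < rk \<nu> * (4 * m + 10) \<and> cl' \<mu>' \<subseteq> lift_lit (g(?x := t)) l \<union> lift_cls g (cl \<nu>)"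
        if \<mu>: "\<mu> \<in> N" "rk \<mu> < rk \<nu>" "cl \<mu> \<subseteq> insert l (cl \<nu>)" and l: "var l = ?x" and t: "t < m" for \<mu> l
      proof -
        have "(g(?x := t)) x < m" if "x \<in> var ` cl \<mu>" for x
          using that \<mu>(3) l gm t by auto
        from sub[where h = "g(?x := t)", OF \<mu>(1) this] obtain g' where g': "(\<mu>, g', 0, 0) \<in> N'"
          "cl' (\<mu>, g', 0, 0) \<subseteq> lift_cls (g(?x := t)) (cl \<mu>)" by blast
        have "lift_cls (g(?x := t)) (cl \<mu>) \<subseteq> lift_lit (g(?x := t)) l \<union> lift_cls (g(?x := t)) (cl \<nu>)"
          using lift_cls_mono[OF \<mu>(3)] by (simp add: lift_cls_insert)
        also have "lift_cls (g(?x := t)) (cl \<nu>) = lift_cls g (cl \<nu>)"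
        proof (rule lift_cls_cong)
          fix x assume "x \<in> var ` cl \<nu>"
          then have "x \<noteq> ?x" using px by metis
          then show "(g(?x := t)) x = g x" by simp
        qed
        finally have "cl' (\<mu>, g', 0, 0) \<subseteq> lift_lit (g(?x := t)) l \<union> lift_cls g (cl \<nu>)"
          using g'(2) by blast
        then show ?thesis
          using g'(1) rk_less[OF \<mu>(2)] by (intro bexI[of _ "(\<mu>, g', 0, 0)"]) (auto simp: rk'_def)
      qed
      from K False consider "a = 0" "t = 0" | "a = 1" "t < m" | "a = 1" "t = m"
        | "a = 2" "t < m" | "a = 3" "t < m" | "a = 4" "t = 0" | "a = 5" "t < m"
        by (force simp: K_def)
      then show ?thesis
      proof cases
        case 1
        have "?Q (\<nu>, g, 0, 0)"
          by (intro disjI2 exI[of _ "Ch ?x 0"] bexI[of _ "(\<nu>, g, 4, 0)"] bexI[of _ "(\<nu>, g, 1, 0)"] conjI)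
             (auto simp: rk'_def cl'_def extra_def intro!: inN')
        then show ?thesis by (simp add: \<nu>' 1)
      next
        case 2
        have "?Q (\<nu>, g, 1, t)"
          by (intro disjI2 exI[of _ "Sel ?x t"] bexI[of _ "(\<nu>, g, 3, t)"] bexI[of _ "(\<nu>, g, 2, t)"] conjI)
             (use 2 in \<open>auto simp: rk'_def cl'_def extra_def intro!: inN'\<close>)
        then show ?thesis by (simp add: \<nu>' 2)
      next
        case 3
        then show ?thesis
          using axiom_sel[of ?x "{Neg (Ch ?x m)}"] px
          by (intro disjI1 bexI[of _ "{Neg (Ch ?x m)}"]) (auto simp: \<nu>' cl'_def extra_def selector_axioms_def)
      next
        case 4
        obtain \<mu>1' \<mu>2' where "\<mu>1' \<in> N'" "rk' \<mu>1' < rk \<nu> * (4 * m + 10)"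
            "cl' \<mu>1' \<subseteq> lift_lit (g(?x := t)) (Pos ?x) \<union> lift_cls g (cl \<nu>)"
            "\<mu>2' \<in> N'" "rk' \<mu>2' < rk \<nu> * (4 * m + 10)"
            "cl' \<mu>2' \<subseteq> lift_lit (g(?x := t)) (Neg ?x) \<union> lift_cls g (cl \<nu>)"
          using child[OF \<mu>(1-3)] child[OF \<mu>(4-6)] 4(2) by auto
        then have "?Q (\<nu>, g, 2, t)"
          by (intro disjI2 exI[of _ "Val ?x t"] bexI[of _ \<mu>1'] bexI[of _ \<mu>2'] conjI)
             (auto simp: rk'_def cl'_def extra_def)
        then show ?thesis by (simp add: \<nu>' 4)
      next
        case 5
        have "?Q (\<nu>, g, 3, t)"
          by (intro disjI2 exI[of _ "Ch ?x (Suc t)"] bexI[of _ "(\<nu>, g, 5, t)"] bexI[of _ "(\<nu>, g, 1, Suc t)"] conjI)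
             (use 5 in \<open>auto simp: rk'_def cl'_def extra_def intro!: inN'\<close>)
        then show ?thesis by (simp add: \<nu>' 5)
      next
        case 6
        then show ?thesis
          using axiom_sel[of ?x "{Pos (Ch ?x 0)}"] px
          by (intro disjI1 bexI[of _ "{Pos (Ch ?x 0)}"]) (auto simp: \<nu>' cl'_def extra_def selector_axioms_def)
      next
        case 7
        then show ?thesis
          using axiom_sel[of ?x "{Neg (Ch ?x t), Pos (Sel ?x t), Pos (Ch ?x (Suc t))}"] px
          by (intro disjI1 bexI[of _ "{Neg (Ch ?x t), Pos (Sel ?x t), Pos (Ch ?x (Suc t))}"])
             (auto simp: \<nu>' cl'_def extra_def selector_axioms_def)
      qed
    qed
  qed
  then show ?thesis using card by (meson le_trans)
qed

subsection \<open>Restrictions that select one copy of every variable\<close>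

definition falsifies :: "('v \<Rightarrow> bool) \<Rightarrow> 'v cls \<Rightarrow> bool" where
  "falsifies \<tau> C \<longleftrightarrow> (\<forall>l\<in>C. \<not> lit_true \<tau> l)"

text \<open>The selected copies carry \<open>\<sigma>\<close> and all others the noise
  \<open>\<beta>\<close>. For \<open>\<iota> x < m\<close> all selector axioms of \<open>x\<close>
  are satisfied, so only lifted clauses can be falsified.\<close>

primrec gadget_assignment ::
    "('a \<Rightarrow> nat) \<Rightarrow> ('a \<Rightarrow> nat \<Rightarrow> bool) \<Rightarrow> ('a \<Rightarrow> bool) \<Rightarrow> 'a gvar \<Rightarrow> bool" where
  "gadget_assignment \<iota> \<beta> \<sigma> (Sel x j) = (j = \<iota> x)"
| "gadget_assignment \<iota> \<beta> \<sigma> (Ch x t) = (t \<le> \<iota> x)"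
| "gadget_assignment \<iota> \<beta> \<sigma> (Val x j) = (if j = \<iota> x then \<sigma> x else \<beta> x j)"

text \<open>With \<open>\<iota>\<close> and \<open>\<beta>\<close> fixed, only these variables of
  the base formula influence whether \<open>C\<close> is falsified; their number plays the part of
  the width.\<close>

definition live :: "('a \<Rightarrow> nat) \<Rightarrow> 'a gvar cls \<Rightarrow> 'a set" where
  "live \<iota> C = {x. Val x (\<iota> x) \<in> var ` C}"

lemma finite_live:
  assumes "finite C"
  shows "finite (live \<iota> C)"
proof -
  have "inj_on (\<lambda>x. Val x (\<iota> x)) (live \<iota> C)" by (auto simp: inj_on_def)
  moreover have "(\<lambda>x. Val x (\<iota> x)) ` live \<iota> C \<subseteq> var ` C" by (auto simp: live_def)
  ultimately show ?thesis using assms finite_subset finite_imageD by blast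
qed

lemma falsifies_cong_live:
  assumes "falsifies (gadget_assignment \<iota> \<beta> \<sigma>) C" "\<And>x. x \<in> live \<iota> C \<Longrightarrow> \<sigma> x = \<sigma>' x"
  shows "falsifies (gadget_assignment \<iota> \<beta> \<sigma>') C"
  unfolding falsifies_def
proof
  fix l assume l: "l \<in> C"
  have *: "\<not> lit_true (gadget_assignment \<iota> \<beta> \<sigma>) l" using assms(1) l by (auto simp: falsifies_def)
  have "gadget_assignment \<iota> \<beta> \<sigma>' (var l) = gadget_assignment \<iota> \<beta> \<sigma> (var l)"
  proof (cases "var l")
    case (Val x j)
    then show ?thesis using assms(2)[of x] imageI[OF l, of var] by (auto simp: live_def)
  qed auto
  then show "\<not> lit_true (gadget_assignment \<iota> \<beta> \<sigma>') l" using * by (cases l) auto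
qed

text \<open>The pivot belongs to the gadget of a single base variable \<open>x\<close>, and only
  \<open>x\<close> can be live in a premise but not in the resolvent.\<close>

lemma falsifies_resolvent:
  assumes "resolves_to A B E"
  obtains x where "live \<iota> A \<subseteq> insert x (live \<iota> E)" "live \<iota> B \<subseteq> insert x (live \<iota> E)"
    "\<And>\<tau>. falsifies \<tau> E \<Longrightarrow> falsifies \<tau> A \<or> falsifies \<tau> B"
proof -
  obtain y C D where y: "A = insert (Pos y) C" "B = insert (Neg y) D" "E = C \<union> D"
    using assms by (auto simp: resolves_to_def)
  define x where "x = (case y of Val z j \<Rightarrow> z | Sel z j \<Rightarrow> z | Ch z j \<Rightarrow> z)"
  have "live \<iota> A \<subseteq> insert x (live \<iota> E)" "live \<iota> B \<subseteq> insert x (live \<iota> E)"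
    by (auto simp: live_def y x_def split: gvar.splits)
  moreover have "falsifies \<tau> A \<or> falsifies \<tau> B" if "falsifies \<tau> E" for \<tau>
    using that by (cases "\<tau> y") (auto simp: falsifies_def y)
  ultimately show ?thesis using that by blast
qed

text \<open>A falsified lifted clause must have guessed the selected copy of each of its variables,
  because its literals \<open>Neg (Sel x (g x))\<close> are false; what remains is the original
  clause under \<open>\<sigma>\<close>.\<close>

lemma falsifies_lift_formula:
  assumes "D \<in> lift_formula m F" "falsifies (gadget_assignment \<iota> \<beta> \<sigma>) D" "\<And>x. \<iota> x < m"
  obtains C where "C \<in> F" "falsifies \<sigma> C" "var ` C \<subseteq> live \<iota> D"
proof -
  from assms(1) consider C g where "C \<in> F" "D = lift_cls g C" | x where "D \<in> selector_axioms m x"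
    by (auto simp: lift_formula_def)
  then show ?thesis
  proof cases
    case 1
    have l: "\<not> lit_true \<sigma> l \<and> var l \<in> live \<iota> D" if "l \<in> C" for l
    proof -
      have sub: "lift_lit g l \<subseteq> D" using that by (auto simp: 1 lift_cls_def)
      then have f: "\<not> lit_true (gadget_assignment \<iota> \<beta> \<sigma>) l'" if "l' \<in> lift_lit g l" for l'
        using assms(2) that by (auto simp: falsifies_def)
      show ?thesis
      proof (cases l)
        case (Pos x)
        then have "g x = \<iota> x" using f[of "Neg (Sel x (g x))"] by auto
        then show ?thesis using f[of "Pos (Val x (g x))"] sub Pos
          by (auto simp: live_def image_iff intro!: bexI[of _ "Pos (Val x (g x))"])
      next
        case (Neg x)
        then have "g x = \<iota> x" using f[of "Neg (Sel x (g x))"] by auto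
        then show ?thesis using f[of "Neg (Val x (g x))"] sub Neg
          by (auto simp: live_def image_iff intro!: bexI[of _ "Neg (Val x (g x))"])
      qed
    qed
    then show ?thesis using that[of C] 1 by (auto simp: falsifies_def)
  next
    case 2
    then show ?thesis using assms(2) assms(3)[of x]
      by (auto simp: selector_axioms_def falsifies_def)
  qed
qed

lemma card_Pow_prescribed:
  assumes "finite M" "J \<subseteq> M" "K \<subseteq> J"
  shows "card {b \<in> Pow M. b \<inter> J = K} = 2 ^ card (M - J)"
proof -
  have "{b \<in> Pow M. b \<inter> J = K} = (\<lambda>c. c \<union> K) ` Pow (M - J)"
  proof (intro equalityI subsetI)
    fix b assume "b \<in> {b \<in> Pow M. b \<inter> J = K}"
    then show "b \<in> (\<lambda>c. c \<union> K) ` Pow (M - J)"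
      by (intro image_eqI[of _ _ "b - J"]) auto
  qed (use assms in auto)
  moreover have "inj_on (\<lambda>c. c \<union> K) (Pow (M - J))"
    using assms(3) by (auto simp: inj_on_def)
  ultimately show ?thesis
    using assms(1) by (simp add: card_image card_Pow)
qed

text \<open>\<open>(m + 1) / 2\<close> is the largest weight for which the average over a block never exceeds 1; it is
  attained if exactly one copy occurs in the clause.\<close>

definition block_weight :: "nat \<Rightarrow> 'a gvar cls \<Rightarrow> 'a \<Rightarrow> nat \<times> nat set \<Rightarrow> real" where
  "block_weight m C x = (\<lambda>(i, b).
     if \<forall>j\<in>{..<m} - {i}. (Pos (Val x j) \<in> C \<longrightarrow> j \<notin> b) \<and> (Neg (Val x j) \<in> C \<longrightarrow> j \<in> b)
     then if Val x i \<in> var ` C then (real m + 1) / 2 else 1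
     else 0)"

text \<open>If \<open>a\<close> of the copies of \<open>x\<close> occur in \<open>C\<close>, the
  average weight is \<open>(a + 1) / 2 ^ a\<close>, which is at most 1.\<close>

lemma sum_block_weight_le:
  assumes "is_clause C"
  shows "(\<Sum>\<rho>\<in>{..<m} \<times> Pow {..<m}. block_weight m C x \<rho>) \<le> real m * 2 ^ m"
proof -
  define P where "P = {j \<in> {..<m}. Pos (Val x j) \<in> C}"
  define N where "N = {j \<in> {..<m}. Neg (Val x j) \<in> C}"
  define I where "I = P \<union> N"
  define a where "a = card I"
  have PN: "P \<inter> N = {}" using is_clause_no_clash[OF assms] by (auto simp: P_def N_def)
  have I: "I \<subseteq> {..<m}" "finite I" by (auto simp: I_def P_def N_def)
  have am: "a \<le> m" unfolding a_def using card_mono[OF _ I(1)] by simp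
  have occ: "Val x i \<in> var ` C \<longleftrightarrow> i \<in> I" if "i < m" for i
    using that by (auto simp: I_def P_def N_def in_var_image_iff)
  \<comment> \<open>If the selected copy occurs in \<open>C\<close>, its noise bit is unconstrained;
    the factor 2 gained cancels the denominator of \<open>(m + 1) / 2\<close>.\<close>
  have inner: "(\<Sum>b\<in>Pow {..<m}. block_weight m C x (i, b)) =
      (if i \<in> I then 2 ^ (m - a) * (real m + 1) else 2 ^ (m - a))" if i: "i < m" for i
  proof -
    have "(\<forall>j\<in>{..<m} - {i}. (Pos (Val x j) \<in> C \<longrightarrow> j \<notin> b) \<and> (Neg (Val x j) \<in> C \<longrightarrow> j \<in> b))
        \<longleftrightarrow> b \<inter> (I - {i}) = N - {i}" if "b \<subseteq> {..<m}" for b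
      using that PN by (auto simp: I_def P_def N_def)
    then have "(\<Sum>b\<in>Pow {..<m}. block_weight m C x (i, b)) =
        (\<Sum>b\<in>Pow {..<m}. if b \<inter> (I - {i}) = N - {i} then (if i \<in> I then (real m + 1) / 2 else 1) else 0)"
      using occ[OF i] by (intro sum.cong) (auto simp: block_weight_def)
    also have "\<dots> = real (card {b \<in> Pow {..<m}. b \<inter> (I - {i}) = N - {i}}) * (if i \<in> I then (real m + 1) / 2 else 1)"
      by (subst sum.inter_filter[symmetric]) auto
    also have "card {b \<in> Pow {..<m}. b \<inter> (I - {i}) = N - {i}} = 2 ^ card ({..<m} - (I - {i}))"
      using I by (intro card_Pow_prescribed) (auto simp: I_def)
    also have "card ({..<m} - (I - {i})) = (if i \<in> I then Suc (m - a) else m - a)"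
    proof -
      have "i \<in> I \<Longrightarrow> 0 < card I" using I by (auto simp: card_gt_0_iff)
      then show ?thesis
        using I am by (subst card_Diff_subset) (auto simp: a_def card_Diff_singleton_if)
    qed
    finally show ?thesis by (auto simp: field_simps)
  qed
  have "(\<Sum>\<rho>\<in>{..<m} \<times> Pow {..<m}. block_weight m C x \<rho>) =
      (\<Sum>i<m. \<Sum>b\<in>Pow {..<m}. block_weight m C x (i, b))"
    by (simp add: sum.cartesian_product)
  also have "\<dots> = (\<Sum>i<m. if i \<in> I then 2 ^ (m - a) * (real m + 1) else 2 ^ (m - a))"
    by (intro sum.cong) (auto simp: inner)
  also have "\<dots> = (\<Sum>i<m. 2 ^ (m - a) + (if i \<in> I then 2 ^ (m - a) * real m else 0))"
    by (intro sum.cong) (auto simp: algebra_simps)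
  also have "\<dots> = real m * 2 ^ (m - a) + real a * (2 ^ (m - a) * real m)"
    using I by (simp add: sum.distrib sum.inter_restrict[symmetric] Int_absorb1 a_def)
  also have "\<dots> = real m * (2 ^ (m - a) * (real a + 1))" by (simp add: algebra_simps)
  also have "\<dots> \<le> real m * (2 ^ (m - a) * 2 ^ a)"
  proof -
    have "a + 1 \<le> 2 ^ a" using less_exp[of a] by linarith
    then have "real (a + 1) \<le> real (2 ^ a)" by (simp only: of_nat_le_iff)
    then have "real a + 1 \<le> 2 ^ a" by simp
    then show ?thesis by (intro mult_left_mono) auto
  qed
  also have "(2::real) ^ (m - a) * 2 ^ a = 2 ^ m" using am by (simp flip: power_add)
  finally show ?thesis .
qed

lemma prod_block_weight_falsified:
  assumes "finite X" "live \<iota> C \<subseteq> X" "\<And>x. x \<in> X \<Longrightarrow> \<iota> x < m"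
    and f: "falsifies (gadget_assignment \<iota> (\<lambda>x j. j \<in> b x) \<sigma>) C"
  shows "(\<Prod>x\<in>X. block_weight m C x (\<iota> x, b x)) = ((real m + 1) / 2) ^ card (live \<iota> C)"
proof -
  have "block_weight m C x (\<iota> x, b x) = (if x \<in> live \<iota> C then (real m + 1) / 2 else 1)" for x
  proof -
    have "(Pos (Val x j) \<in> C \<longrightarrow> j \<notin> b x) \<and> (Neg (Val x j) \<in> C \<longrightarrow> j \<in> b x)" if "j \<noteq> \<iota> x" for j
      using f[unfolded falsifies_def, THEN bspec, of "Pos (Val x j)"]
        f[unfolded falsifies_def, THEN bspec, of "Neg (Val x j)"] that by auto
    then show ?thesis by (auto simp: block_weight_def live_def)
  qed
  then have "(\<Prod>x\<in>X. block_weight m C x (\<iota> x, b x)) = (\<Prod>x\<in>X. if x \<in> live \<iota> C then (real m + 1) / 2 else 1)"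
    by simp
  also have "\<dots> = (\<Prod>x\<in>X \<inter> live \<iota> C. (real m + 1) / 2)"
    using assms(1) by (subst prod.inter_restrict) auto
  also have "X \<inter> live \<iota> C = live \<iota> C" using assms(2) by auto
  finally show ?thesis by simp
qed

text \<open>The averages over all restrictions of the weights of the clauses are at most 1. If every
  restriction left a falsifiable clause with \<open>w\<close> live variables, then this clause and the empty
  one would together have weight greater than the number of lines.\<close>

lemma restriction_exists:
  fixes R :: "'a gvar cls list"
  assumes m: "1 \<le> m" and w: "1 \<le> w" and R: "\<And>C. C \<in> set R \<Longrightarrow> is_clause C" "{} \<in> set R"
    and small: "real (length R) \<le> ((real m + 1) / 2) ^ w"
  obtains \<iota> \<beta> where "\<And>x. \<iota> x < m"
    "\<And>C \<sigma>. C \<in> set R \<Longrightarrow> falsifies (gadget_assignment \<iota> \<beta> \<sigma>) C \<Longrightarrow> card (live \<iota> C) < w"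
proof -
  let ?r = "(real m + 1) / 2"
  have r1: "1 \<le> ?r" using m by simp
  define X where "X = {x. \<exists>C\<in>set R. \<exists>j. Val x j \<in> var ` C}"
  define vr :: "'a gvar \<Rightarrow> 'a" where "vr y = (case y of Val z j \<Rightarrow> z | Sel z j \<Rightarrow> z | Ch z j \<Rightarrow> z)" for y
  have "X \<subseteq> vr ` (\<Union>C\<in>set R. var ` C)"
  proof
    fix x assume "x \<in> X"
    then obtain C j where "C \<in> set R" "Val x j \<in> var ` C" by (auto simp: X_def)
    then show "x \<in> vr ` (\<Union>C\<in>set R. var ` C)"
      by (intro image_eqI[of _ _ "Val x j"]) (auto simp: vr_def)
  qed
  then have finX: "finite X"
    by (rule finite_subset) (use R in \<open>auto simp: is_clause_def\<close>)
  define W where "W C \<rho> = (\<Prod>x\<in>X. block_weight m C x (\<rho> x))" for C and \<rho> :: "'a \<Rightarrow> nat \<times> nat set"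
  define \<Omega> where "\<Omega> = (X \<rightarrow>\<^sub>E {..<m} \<times> Pow {..<m})"
  have fin\<Omega>: "finite \<Omega>" unfolding \<Omega>_def using finX by (intro finite_PiE) auto
  have card\<Omega>: "card \<Omega> = (m * 2 ^ m) ^ card X"
    unfolding \<Omega>_def using finX by (subst card_PiE) (auto simp: card_cartesian_product card_Pow)
  have \<Omega>pos: "0 < card \<Omega>" using card\<Omega> m by simp
  have Wpos: "0 \<le> W C \<rho>" for C \<rho>
    unfolding W_def by (intro prod_nonneg) (auto simp: block_weight_def split: prod.splits)
  have W1: "W {} \<rho> = 1" for \<rho>
    unfolding W_def by (intro prod.neutral) (auto simp: block_weight_def split: prod.splits)
  have sumW: "(\<Sum>\<rho>\<in>\<Omega>. W C \<rho>) \<le> real (card \<Omega>)" if "C \<in> set R" for C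
  proof -
    have "(\<Sum>\<rho>\<in>\<Omega>. W C \<rho>) = (\<Prod>x\<in>X. \<Sum>\<rho>\<in>{..<m} \<times> Pow {..<m}. block_weight m C x \<rho>)"
      unfolding W_def \<Omega>_def using finX by (subst prod_sum_PiE) auto
    also have "\<dots> \<le> (\<Prod>x\<in>X. real m * 2 ^ m)"
      using sum_block_weight_le[OF R(1)[OF that]]
      by (intro prod_mono) (auto intro!: sum_nonneg simp: block_weight_def split: prod.splits)
    finally show ?thesis by (simp add: card\<Omega>)
  qed
  have "\<exists>\<rho>\<in>\<Omega>. \<forall>C\<in>set R. \<forall>\<sigma>. falsifies (gadget_assignment (\<lambda>x. if x \<in> X then fst (\<rho> x) else 0)
      (\<lambda>x j. j \<in> snd (\<rho> x)) \<sigma>) C \<longrightarrow> card (live (\<lambda>x. if x \<in> X then fst (\<rho> x) else 0) C) < w"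
  proof (rule ccontr)
    assume "\<not> ?thesis"
    then have bad: "\<exists>C\<in>set R. \<exists>\<sigma>. falsifies (gadget_assignment (\<lambda>x. if x \<in> X then fst (\<rho> x) else 0)
      (\<lambda>x j. j \<in> snd (\<rho> x)) \<sigma>) C \<and> w \<le> card (live (\<lambda>x. if x \<in> X then fst (\<rho> x) else 0) C)"
      if "\<rho> \<in> \<Omega>" for \<rho> using that by (meson not_less)
    have "?r ^ w + 1 \<le> (\<Sum>C\<in>set R. W C \<rho>)" if \<rho>: "\<rho> \<in> \<Omega>" for \<rho>
    proof -
      let ?\<iota> = "\<lambda>x. if x \<in> X then fst (\<rho> x) else 0"
      obtain C \<sigma> where C: "C \<in> set R" "w \<le> card (live ?\<iota> C)"
        "falsifies (gadget_assignment ?\<iota> (\<lambda>x j. j \<in> snd (\<rho> x)) \<sigma>) C"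
        using bad[OF \<rho>] by blast
      have "(\<Prod>x\<in>X. block_weight m C x (?\<iota> x, snd (\<rho> x))) = ?r ^ card (live ?\<iota> C)"
      proof (rule prod_block_weight_falsified[OF finX _ _ C(3)])
        show "live ?\<iota> C \<subseteq> X" using C(1) by (auto simp: live_def X_def)
        show "?\<iota> x < m" if "x \<in> X" for x using that \<rho> by (auto simp: \<Omega>_def dest: PiE_mem)
      qed
      also have "(\<Prod>x\<in>X. block_weight m C x (?\<iota> x, snd (\<rho> x))) = W C \<rho>"
        unfolding W_def by (intro prod.cong) auto
      finally have "?r ^ w \<le> W C \<rho>" using r1 C(2) by (simp add: power_increasing)
      moreover have "C \<noteq> {}" using C(2) w by (auto simp: live_def)
      then have "W C \<rho> + W {} \<rho> = (\<Sum>C\<in>{C, {}}. W C \<rho>)" by simp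
      moreover have "(\<Sum>C\<in>{C, {}}. W C \<rho>) \<le> (\<Sum>C\<in>set R. W C \<rho>)"
        using C(1) R(2) Wpos by (intro sum_mono2) auto
      ultimately show ?thesis using W1 by simp
    qed
    then have "(\<Sum>\<rho>\<in>\<Omega>. ?r ^ w + 1) \<le> (\<Sum>\<rho>\<in>\<Omega>. \<Sum>C\<in>set R. W C \<rho>)" by (intro sum_mono) auto
    also have "\<dots> = (\<Sum>C\<in>set R. \<Sum>\<rho>\<in>\<Omega>. W C \<rho>)" by (rule sum.swap)
    also have "\<dots> \<le> (\<Sum>C\<in>set R. real (card \<Omega>))" by (intro sum_mono sumW)
    also have "\<dots> \<le> real (length R) * real (card \<Omega>)" by (simp add: card_length mult_right_mono)
    also have "\<dots> \<le> ?r ^ w * real (card \<Omega>)" using small by (intro mult_right_mono) auto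
    finally show False using \<Omega>pos by (simp add: algebra_simps)
  qed
  then obtain \<rho> where \<rho>: "\<rho> \<in> \<Omega>" "\<And>C \<sigma>. C \<in> set R \<Longrightarrow>
      falsifies (gadget_assignment (\<lambda>x. if x \<in> X then fst (\<rho> x) else 0)
      (\<lambda>x j. j \<in> snd (\<rho> x)) \<sigma>) C \<Longrightarrow> card (live (\<lambda>x. if x \<in> X then fst (\<rho> x) else 0) C) < w"
    by blast
  show ?thesis
  proof (rule that[OF _ \<rho>(2)])
    show "(if x \<in> X then fst (\<rho> x) else 0) < m" for x
      using \<rho>(1) m by (auto simp: \<Omega>_def dest: PiE_mem)
  qed
qed

section \<open>Parity constraints on a compressed cylinder\<close>

text \<open>The clause that excludes the assignment to \<open>W\<close> with the true variables
  \<open>\<alpha>\<close>. A parity constraint consists of these clauses for all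
  \<open>\<alpha>\<close> of the wrong parity.\<close>

definition pclause :: "'v set \<Rightarrow> 'v set \<Rightarrow> 'v cls" where
  "pclause W \<alpha> = (\<lambda>x. if x \<in> \<alpha> then Neg x else Pos x) ` W"

lemma var_image_pclause [simp]: "var ` pclause W \<alpha> = W"
proof -
  have "(\<lambda>x. var (if x \<in> \<alpha> then Neg x else Pos x)) ` W = (\<lambda>x. x) ` W"
    by (rule image_cong) auto
  then show ?thesis unfolding pclause_def image_image by (simp only: image_ident)
qed

lemma inj_on_pclause_lit: "inj_on (\<lambda>x. if x \<in> \<alpha> then Neg x else Pos x) W"
  by (auto simp: inj_on_def split: if_splits)

lemma card_pclause [simp]: "card (pclause W \<alpha>) = card W"
  unfolding pclause_def by (rule card_image[OF inj_on_pclause_lit])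

lemma is_clause_pclause: "finite W \<Longrightarrow> is_clause (pclause W \<alpha>)"
  by (auto simp: is_clause_def pclause_def inj_on_def)

lemma falsifies_pclause: "falsifies \<sigma> (pclause W \<alpha>) \<longleftrightarrow> (\<forall>x\<in>W. \<sigma> x \<longleftrightarrow> x \<in> \<alpha>)"
  by (auto simp: falsifies_def pclause_def simp del: if_image_distrib split: if_splits)

lemma pclause_subset: "V \<subseteq> W \<Longrightarrow> pclause V (\<alpha> \<inter> V) \<subseteq> pclause W \<alpha>"
  by (auto simp: pclause_def)

datatype edge = H nat nat | V nat nat

text \<open>The uncompressed graph has the vertices \<open>(i, j)\<close> with cyclic rows \<open>i < k\<close> and columns \<open>j < T\<close>.
  Away from the first and last \<open>E\<close> columns the horizontal edges of row \<open>i\<close> are identified modulo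
  \<open>h_period i\<close>, and the vertical edges below row \<open>i\<close> modulo \<open>v_period i\<close>. The factor
  \<open>B\<close> makes small distances between columns well-defined modulo all these periods.\<close>

locale compressed_cylinder =
  fixes k c :: nat and p :: "nat \<Rightarrow> nat"
  assumes c_pos: "2 \<le> c" and c_less: "c < k"
    and p_pos: "\<And>q. q < k \<Longrightarrow> 0 < p q"
    and p_coprime: "\<And>q q'. q < k \<Longrightarrow> q' < k \<Longrightarrow> q \<noteq> q' \<Longrightarrow> coprime (p q) (p q')"
    and Q_ge: "2 \<le> (\<Prod>q<k. p q)"
begin

definition "B = 8 * k"
text \<open>More columns per end than a set of fewer than \<open>2 * k\<close> edges can
  meet.\<close>

definition "E = 2 * k"
definition "Q = (\<Prod>q<k. p q)"
text \<open>About half of the cycle of length \<open>B * Q\<close> on which cordons live, so that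
  none is close to both ends.\<close>

definition "T = B * (Q div 2)"

text \<open>Row \<open>i\<close> gets a cyclic window of primes starting at \<open>i\<close>.
  Conversely the rows that use a given prime are consecutive, so one can pass between two of them
  along vertical edges whose periods also contain this prime.\<close>

definition P :: "nat \<Rightarrow> nat set" where
  "P i = {q. q < k \<and> (q + k - i) mod k \<le> c}"

definition nxt :: "nat \<Rightarrow> nat" where "nxt i = (if Suc i = k then 0 else Suc i)"
definition prv :: "nat \<Rightarrow> nat" where "prv i = (if i = 0 then k - 1 else i - 1)"

definition "h_period i = B * (\<Prod>q\<in>P i. p q)"
text \<open>Only common primes count: the period divides those of both adjacent rows, so shifting a
  vertex by the period of its row preserves its vertical edges.\<close>

definition "v_period i = B * (\<Prod>q\<in>P i \<inter> P (nxt i). p q)"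

text \<open>The ends stay uncompressed, so that distinct columns of an end have no edges in
  common.\<close>

definition rep :: "nat \<Rightarrow> nat \<Rightarrow> nat" where
  "rep N j = (if E \<le> j \<and> j < T - E then E + (j - E) mod N else j)"

definition h :: "nat \<Rightarrow> nat \<Rightarrow> edge" where "h i j = H i (rep (h_period i) j)"
definition v :: "nat \<Rightarrow> nat \<Rightarrow> edge" where "v i j = V i (rep (v_period i) j)"

definition star :: "nat \<Rightarrow> nat \<Rightarrow> edge set" where
  "star i j = {v i j, v (prv i) j} \<union> (if j + 1 < T then {h i j} else {}) \<union>
     (if 0 < j then {h i (j - 1)} else {})"

text \<open>Only the vertex \<open>(0, 0)\<close> demands odd parity, so the total charge is odd;
  \<open>\<alpha>\<close> ranges over the forbidden assignments.\<close>

definition G :: "edge formula" where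
  "G = (\<Union>i<k. \<Union>j<T. pclause (star i j) `
      {\<alpha>. \<alpha> \<subseteq> star i j \<and> odd (card \<alpha>) \<noteq> (i = 0 \<and> j = 0)})"

section \<open>Compression and the number of clauses\<close>

lemma k_ge: "3 \<le> k" using c_pos c_less by simp

lemma B_ge: "24 \<le> B" using k_ge by (simp add: B_def)

lemma T_ge: "8 * k \<le> T"
proof -
  have "1 \<le> Q div 2" using Q_ge by (simp add: Q_def)
  then have "B * 1 \<le> T" unfolding T_def by (rule mult_left_mono) simp
  then show ?thesis by (simp add: B_def)
qed

lemma P_subset: "P i \<subseteq> {..<k}" by (auto simp: P_def)

lemma finite_P [simp]: "finite (P i)" by (rule finite_subset[OF P_subset]) simp

lemma prod_p_pos: "S \<subseteq> {..<k} \<Longrightarrow> 0 < (\<Prod>q\<in>S. p q)"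
  by (rule prod_pos) (use p_pos in auto)

lemma h_period_ge: "B \<le> h_period i"
  unfolding h_period_def using mult_le_mono2[OF Suc_leI[OF prod_p_pos[OF P_subset]], of B i]
  by (simp del: prod_pos_nat_iff)

lemma rep_eq_iff:
  "rep N j = rep N j' \<longleftrightarrow> j = j' \<or> (E \<le> j \<and> j < T - E \<and> E \<le> j' \<and> j' < T - E \<and> [j = j'] (mod N))"
proof -
  have le: "E + (j - E) mod N \<le> j" if "E \<le> j" for j
    using that mod_less_eq_dividend[of "j - E" N] by linarith
  show ?thesis
  proof (cases "E \<le> j \<and> j < T - E \<and> E \<le> j' \<and> j' < T - E")
    case True
    then have "[j = j'] (mod N) \<longleftrightarrow> [j - E + E = j' - E + E] (mod N)" by simp
    also have "\<dots> \<longleftrightarrow> [j - E = j' - E] (mod N)" by (rule cong_add_rcancel_nat)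
    also have "\<dots> \<longleftrightarrow> (j - E) mod N = (j' - E) mod N" by (simp only: unique_euclidean_semiring_class.cong_def)
    also have "\<dots> \<longleftrightarrow> rep N j = rep N j'" using True by (simp add: rep_def)
    finally show ?thesis using True by blast
  next
    case False
    then show ?thesis using le[of j] le[of j'] by (simp add: rep_def) linarith
  qed
qed

text \<open>The two horizontal edges at a vertex are never identified, so they do not cancel in its
  constraint.\<close>

lemma rep_Suc_neq: "B \<le> N \<Longrightarrow> rep N (Suc j) \<noteq> rep N j"
  using B_ge by (auto simp: rep_eq_iff unique_euclidean_semiring_class.cong_def mod_Suc split: if_splits)

lemma h_eq_iff: "h i j = h i' j' \<longleftrightarrow> i = i' \<and> rep (h_period i) j = rep (h_period i) j'"
  by (auto simp: h_def)

lemma v_eq_iff: "v i j = v i' j' \<longleftrightarrow> i = i' \<and> rep (v_period i) j = rep (v_period i) j'"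
  by (auto simp: v_def)

lemma h_neq_v [simp]: "h i j \<noteq> v i' j'" "v i' j' \<noteq> h i j"
  by (auto simp: h_def v_def)

lemma h_Suc_neq: "h i (Suc j) \<noteq> h i' j"
  using rep_Suc_neq[OF h_period_ge] by (auto simp: h_eq_iff)

lemma prv_neq: "i < k \<Longrightarrow> prv i \<noteq> i"
  using k_ge by (auto simp: prv_def)

lemma finite_star [simp]: "finite (star i j)" by (simp add: star_def)

lemma card_star_le: "card (star i j) \<le> 4"
  by (auto simp: star_def card_insert_if)

lemma G_clause: "C \<in> G \<Longrightarrow> \<exists>i j \<alpha>. i < k \<and> j < T \<and> C = pclause (star i j) \<alpha> \<and> \<alpha> \<subseteq> star i j
    \<and> odd (card \<alpha>) \<noteq> (i = 0 \<and> j = 0)"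
  by (auto simp: G_def)

lemma G_memI: "i < k \<Longrightarrow> j < T \<Longrightarrow> \<alpha> \<subseteq> star i j \<Longrightarrow> odd (card \<alpha>) \<noteq> (i = 0 \<and> j = 0) \<Longrightarrow>
    pclause (star i j) \<alpha> \<in> G"
  unfolding G_def by blast

lemma is_cnf_G: "is_cnf 4 G"
proof -
  have "finite {\<alpha>. \<alpha> \<subseteq> star i j \<and> odd (card \<alpha>) \<noteq> (i = 0 \<and> j = 0)}" for i j
    by (rule finite_subset[of _ "Pow (star i j)"]) auto
  then have "finite G" unfolding G_def by (intro finite_UN_I) auto
  moreover have "is_clause C \<and> card C \<le> 4" if "C \<in> G" for C
    using G_clause[OF that] card_star_le by (auto simp: is_clause_pclause)
  ultimately show ?thesis by (simp add: is_cnf_def)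
qed

lemma star_in_vars: "i < k \<Longrightarrow> j < T \<Longrightarrow> star i j \<subseteq> vars G"
proof -
  assume ij: "i < k" "j < T"
  have "\<exists>\<alpha>\<subseteq>star i j. odd (card \<alpha>) \<noteq> (i = 0 \<and> j = 0)"
  proof (cases "i = 0 \<and> j = 0")
    case False
    then show ?thesis by (intro exI[of _ "{v i j}"]) (auto simp: star_def)
  qed (intro exI[of _ "{}"], auto)
  then obtain \<alpha> where "pclause (star i j) \<alpha> \<in> G" using G_memI[OF ij] by blast
  then have "var ` pclause (star i j) \<alpha> \<subseteq> vars G" unfolding vars_def by blast
  then show ?thesis by simp
qed

lemma h_cong: "E \<le> j \<Longrightarrow> j < T - E \<Longrightarrow> E \<le> j' \<Longrightarrow> j' < T - E \<Longrightarrow> [j = j'] (mod h_period i) \<Longrightarrow> h i j = h i j'"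
  by (simp add: h_eq_iff rep_eq_iff)

lemma v_cong: "E \<le> j \<Longrightarrow> j < T - E \<Longrightarrow> E \<le> j' \<Longrightarrow> j' < T - E \<Longrightarrow> [j = j'] (mod v_period i) \<Longrightarrow> v i j = v i j'"
  by (simp add: v_eq_iff rep_eq_iff)

lemma nxt_prv: "i < k \<Longrightarrow> nxt (prv i) = i"
  by (auto simp: nxt_def prv_def)

lemma prv_less: "i < k \<Longrightarrow> prv i < k"
  by (auto simp: prv_def)

lemma v_period_dvd:
  assumes "i < k"
  shows "v_period i dvd h_period i" "v_period (prv i) dvd h_period i"
  unfolding v_period_def h_period_def nxt_prv[OF assms]
  by (intro mult_dvd_mono prod_dvd_prod_subset dvd_refl finite_P Int_lower1 Int_lower2)+

text \<open>The extra 1 in the lower bound keeps the left edge, in column \<open>j - 1\<close>,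
  inside the compressed part after the shift.\<close>

lemma star_shift:
  assumes "i < k" "E + 1 + h_period i \<le> j" "j + 1 \<le> T - E"
  shows "star i j = star i (j - h_period i)"
proof -
  let ?j = "j - h_period i"
  have c: "[j = ?j] (mod h_period i)" "[j - 1 = ?j - 1] (mod h_period i)"
    using assms by (auto simp: unique_euclidean_semiring_class.cong_def mod_if[of "j - 1"] le_mod_geq)
  have "h i j = h i ?j" "h i (j - 1) = h i (?j - 1)"
    using assms c by (auto intro!: h_cong)
  moreover have "v i j = v i ?j" "v (prv i) j = v (prv i) ?j"
    using assms c(1) v_period_dvd[OF assms(1)]
    by (auto intro!: v_cong intro: cong_dvd_modulus_nat)
  moreover have "j + 1 < T" using assms T_ge k_ge by (simp add: E_def)
  ultimately show ?thesis using assms by (auto simp: star_def)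
qed

lemma star_rep:
  assumes "i < k" "j < T" "h_period i \<le> M"
  shows "\<exists>j'. j' < T \<and> (j' < E + 1 + M \<or> T - E \<le> j') \<and> star i j = star i j' \<and> (j = 0 \<longleftrightarrow> j' = 0)"
  using assms(2)
proof (induction j rule: less_induct)
  case (less j)
  show ?case
  proof (cases "j < E + 1 + M \<or> T - E \<le> j")
    case False
    then have j: "E + 1 + h_period i \<le> j" "j + 1 \<le> T - E" using assms(3) by auto
    moreover have "0 < h_period i" using h_period_ge[of i] B_ge by simp
    ultimately have "j - h_period i < j" "j - h_period i < T" using less.prems by auto
    then obtain j' where "j' < T \<and> (j' < E + 1 + M \<or> T - E \<le> j') \<and>
        star i (j - h_period i) = star i j' \<and> (j - h_period i = 0 \<longleftrightarrow> j' = 0)"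
      using less.IH[of "j - h_period i"] by (elim meta_impE exE) (assumption, assumption, rule that)
    then show ?thesis
      using star_shift[OF assms(1) j] j by (intro exI[of _ j']) auto
  qed (use less.prems in blast)
qed

text \<open>The gain from compression: a constraint repeats after one period of its row, so only the
  ends and one period contribute, with at most \<open>2 ^ 4\<close> clauses per vertex.\<close>

lemma card_G_le:
  assumes "\<And>i. i < k \<Longrightarrow> h_period i \<le> M"
  shows "card G \<le> 16 * (k * (2 * E + 1 + M))"
proof -
  define J where "J = {..<E + 1 + M} \<union> {T - E..<T}"
  have "card J \<le> (E + 1 + M) + E"
    unfolding J_def by (rule order_trans[OF card_Un_le]) simp
  have "G \<subseteq> (\<Union>(i, j)\<in>{..<k} \<times> J. pclause (star i j) ` Pow (star i j))"
  proof
    fix C assume "C \<in> G"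
    then obtain i j \<alpha> where C: "i < k" "j < T" "C = pclause (star i j) \<alpha>" "\<alpha> \<subseteq> star i j"
      using G_clause by blast
    obtain j' where "j' \<in> J" "star i j = star i j'"
      using star_rep[OF C(1,2) assms[OF C(1)]] by (auto simp: J_def)
    then show "C \<in> (\<Union>(i, j)\<in>{..<k} \<times> J. pclause (star i j) ` Pow (star i j))"
      using C by (intro UN_I[of "(i, j')"]) auto
  qed
  then have "card G \<le> card (\<Union>(i, j)\<in>{..<k} \<times> J. pclause (star i j) ` Pow (star i j))"
    by (rule card_mono[rotated]) (auto simp: J_def)
  also have "\<dots> \<le> (\<Sum>(i, j)\<in>{..<k} \<times> J. card (pclause (star i j) ` Pow (star i j)))"
    using card_UN_le[of "{..<k} \<times> J" "\<lambda>(i, j). pclause (star i j) ` Pow (star i j)"]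
    by (simp add: J_def case_prod_unfold)
  also have "\<dots> \<le> (\<Sum>(i, j)\<in>{..<k} \<times> J. 16)"
  proof (rule sum_mono, clarify)
    fix i j
    have "card (pclause (star i j) ` Pow (star i j)) \<le> 2 ^ card (star i j)"
      by (metis card_Pow card_image_le finite_Pow_iff finite_star)
    also have "\<dots> \<le> 2 ^ 4" using card_star_le by (intro power_increasing) auto
    finally show "card (pclause (star i j) ` Pow (star i j)) \<le> 16" by simp
  qed
  also have "\<dots> = 16 * (k * card J)" by (simp add: card_cartesian_product)
  also have "\<dots> \<le> 16 * (k * (2 * E + 1 + M))"
    using \<open>card J \<le> (E + 1 + M) + E\<close> by (intro mult_left_mono) auto
  finally show ?thesis .
qed

subsection \<open>The refutation that sweeps the cylinder\<close>

text \<open>The support of the sum modulo 2 of the first \<open>s\<close> constraints, in column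
  order.\<close>

primrec cut :: "nat \<Rightarrow> edge set" where
  "cut 0 = {}"
| "cut (Suc s) = sym_diff (cut s) (star (s mod k) (s div k))"

definition cut_form :: "nat \<Rightarrow> nat \<Rightarrow> edge set" where
  "cut_form j i = {h r j |r. r < i \<and> j + 1 < T} \<union> {h r (j - 1) |r. i \<le> r \<and> r < k \<and> 0 < j} \<union>
     (if 0 < i \<and> i < k then {v (i - 1) j, v (k - 1) j} else {})"

lemma cut_form_Suc:
  assumes "i < k"
  shows "sym_diff (cut_form j i) (star i j) = cut_form j (Suc i)"
proof (rule Set.set_eqI)
  fix x
  have *: "h i j \<noteq> h i (j - 1)" if "0 < j" using that h_Suc_neq[of i "j - 1" i] by simp
  show "x \<in> sym_diff (cut_form j i) (star i j) \<longleftrightarrow> x \<in> cut_form j (Suc i)"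
  proof (cases x)
    case (H r y)
    show ?thesis
    proof (cases "r = i")
      case True
      have "x \<in> cut_form j i \<longleftrightarrow> 0 < j \<and> x = h i (j - 1)" "x \<in> star i j \<longleftrightarrow> j + 1 < T \<and> x = h i j \<or> 0 < j \<and> x = h i (j - 1)"
        "x \<in> cut_form j (Suc i) \<longleftrightarrow> j + 1 < T \<and> x = h i j"
        using assms by (auto simp: H True cut_form_def star_def h_def v_def)
      then show ?thesis using * by auto
    next
      case False
      then have "x \<notin> star i j" by (auto simp: H star_def h_def v_def)
      moreover have "x \<in> cut_form j i \<longleftrightarrow> x \<in> cut_form j (Suc i)"
        using False by (auto simp: H cut_form_def h_def v_def less_Suc_eq le_less)
      ultimately show ?thesis by simp
    qed
  next
    case (V r y)
    have h: "x \<noteq> h a b" for a b by (simp add: V h_def)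
    have v: "v a j = v b j \<longleftrightarrow> a = b" for a b by (auto simp: v_def)
    have star: "x \<in> star i j \<longleftrightarrow> x = v i j \<or> x = v (prv i) j" by (simp add: star_def h)
    have cut: "x \<in> cut_form j i' \<longleftrightarrow> 0 < i' \<and> i' < k \<and> (x = v (i' - 1) j \<or> x = v (k - 1) j)" for i'
      by (simp add: cut_form_def h)
    have ex: "\<not> (x = v a j \<and> x = v b j)" if "a \<noteq> b" for a b using v that by metis
    \<comment> \<open>The first row opens the cyclic column with two vertical edges, an inner row
      exchanges one of them, and the last row removes both.\<close>
    consider "i = 0" | "0 < i" "Suc i < k" | "0 < i" "Suc i = k" using assms by linarith
    then show ?thesis
    proof cases
      case 1
      then have "prv i = k - 1" "i \<noteq> k - 1" "1 < k" using k_ge by (auto simp: prv_def)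
      with 1 show ?thesis unfolding Un_iff Diff_iff star cut by simp
    next
      case 2
      then have "prv i = i - 1" "Suc i - 1 = i" "i < k" by (auto simp: prv_def)
      moreover have "i \<noteq> i - 1" "i \<noteq> k - 1" "i - 1 \<noteq> k - 1" using 2 by auto
      note ex[OF this(1)] ex[OF this(2)] ex[OF this(3)]
      ultimately show ?thesis unfolding Un_iff Diff_iff star cut using 2
        by (simp only: diff_Suc_1 zero_less_Suc simp_thms) blast
    next
      case 3
      then have pr: "prv i = i - 1" by (simp add: prv_def)
      have k1: "k - 1 = i" using 3(2) by linarith
      have lt: "(Suc i < k) = False" "(i < k) = True" using 3(2) by auto
      show ?thesis unfolding Un_iff Diff_iff star cut pr k1 lt using 3(1)
        by (simp only: simp_thms) blast
    qed
  qed
qed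

lemma cut_eq: "j < T \<Longrightarrow> i \<le> k \<Longrightarrow> cut (j * k + i) = cut_form j i"
proof (induction j arbitrary: i)
  case 0
  from 0(2) show ?case
  proof (induction i)
    case 0
    then show ?case by (simp add: cut_form_def)
  next
    case (Suc i)
    then show ?case using cut_form_Suc[of i 0] by simp
  qed
next
  case (Suc j)
  from Suc.prems(2) show ?case
  proof (induction i)
    case 0
    have "cut (Suc j * k + 0) = cut (j * k + k)" by (simp add: add.commute)
    also have "\<dots> = cut_form j k" using Suc by simp
    also have "\<dots> = cut_form (Suc j) 0" using Suc.prems(1) by (auto simp: cut_form_def)
    finally show ?case .
  next
    case (Suc i)
    then have "(Suc j * k + i) mod k = i" "(Suc j * k + i) div k = Suc j"
      by (simp_all only: mod_mult_self3 div_mult_self3) auto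
    then show ?case using Suc cut_form_Suc[of i "Suc j"] by simp
  qed
qed

lemma cut_last: "cut (k * T) = {}"
proof -
  have "k * T = (T - 1) * k + k" using T_ge k_ge by (cases T) auto
  then have "cut (k * T) = cut_form (T - 1) k" using cut_eq[of "T - 1" k] T_ge k_ge by simp
  also have "\<dots> = {}" by (auto simp: cut_form_def)
  finally show ?thesis .
qed

lemma cut_Un_star:
  assumes "s < k * T"
  shows "finite (cut s \<union> star (s mod k) (s div k))" "card (cut s \<union> star (s mod k) (s div k)) \<le> k + 4"
proof -
  let ?i = "s mod k" and ?j = "s div k"
  have ij: "?i < k" "?j < T" using assms k_ge by (auto simp: less_mult_imp_div_less mult.commute)
  have "cut s = cut_form ?j ?i" using cut_eq[OF ij(2), of ?i] ij(1) by simp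
  then have sub: "cut s \<union> star ?i ?j \<subseteq> (\<lambda>r. if r < ?i then h r ?j else h r (?j - 1)) ` {..<k} \<union>
      {v (?i - 1) ?j, v (k - 1) ?j, h ?i ?j, v ?i ?j}" (is "_ \<subseteq> ?I \<union> ?D")
    using ij(1) by (auto simp: cut_form_def star_def prv_def)
  then show "finite (cut s \<union> star ?i ?j)" by (rule finite_subset) auto
  have "card (cut s \<union> star ?i ?j) \<le> card (?I \<union> ?D)" using sub by (intro card_mono) auto
  also have "\<dots> \<le> card ?I + card ?D" by (rule card_Un_le)
  also have "card ?I \<le> k" by (rule order_trans[OF card_image_le]) auto
  also have "card ?D \<le> 4" by (auto simp: card_insert_if)
  finally show "card (cut s \<union> star ?i ?j) \<le> k + 4" by simp
qed

lemma odd_card_sym_diff: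
  assumes "finite A" "finite C"
  shows "odd (card (sym_diff A C)) \<longleftrightarrow> odd (card A) \<noteq> odd (card C)"
proof -
  have "card A = card (A - C) + card (A \<inter> C)" "card C = card (C - A) + card (A \<inter> C)"
    using assms by (metis Diff_Int_distrib2 add.commute card_Diff_subset_Int card_Int_Diff,
        metis Int_commute add.commute card_Int_Diff)
  moreover have "card (sym_diff A C) = card (A - C) + card (C - A)"
    using assms by (intro card_Un_disjoint) auto
  ultimately show ?thesis by presburger
qed

text \<open>A node records even parity on \<open>cut (Suc s)\<close>, contradicting the odd charge
  at \<open>(0, 0)\<close>. Once the rest of \<open>U s\<close> has been queried, either the
  constraint at vertex \<open>s\<close> is violated or the parity is even on the previous cut as
  well, and the search continues there.\<close>

lemma lifted_G_refutation:
  assumes "1 \<le> m"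
  shows "\<exists>R. is_refutation (lift_formula m G) R \<and>
    refutation_size R \<le> k * T * 2 ^ (k + 8) * (7 * m ^ (k + 4))"
proof -
  define st where "st s = star (s mod k) (s div k)" for s
  define U where "U s = cut s \<union> st s" for s
  have U: "finite (U s)" "card (U s) \<le> k + 4" if "s < k * T" for s
    using cut_Un_star[OF that] by (auto simp: U_def st_def)
  have cutU: "cut (Suc s) \<subseteq> U s" for s by (auto simp: U_def st_def)
  define A where "A s W = {\<alpha> \<in> Pow W. even (card (\<alpha> \<inter> cut (Suc s)))}" for s W
  define N where "N = (SIGMA s:{..<k * T}. SIGMA W:{W \<in> Pow (U s). W \<inter> cut (Suc s) = cut (Suc s)}. A s W)"
  define cl where "cl = (\<lambda>(s::nat, W, \<alpha>). pclause W \<alpha> :: edge cls)"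
  define rk where "rk = (\<lambda>(s, W, \<alpha>::edge set). s * (k + 10) + card (U s - W))"
  have memN: "(s, W, \<alpha>) \<in> N \<longleftrightarrow> s < k * T \<and> cut (Suc s) \<subseteq> W \<and> W \<subseteq> U s \<and> \<alpha> \<subseteq> W
      \<and> even (card (\<alpha> \<inter> cut (Suc s)))" for s W \<alpha>
    by (auto simp: N_def A_def)
  have finA: "finite (A s W)" if "s < k * T" "W \<subseteq> U s" for s W
    using U[OF that(1)] that(2) unfolding A_def by (simp add: finite_subset)
  have finN: "finite N"
    unfolding N_def using U finA by (intro finite_SigmaI) auto
  have "card N = (\<Sum>s<k * T. \<Sum>W\<in>{W \<in> Pow (U s). W \<inter> cut (Suc s) = cut (Suc s)}. card (A s W))"
  proof -
    let ?S = "\<lambda>s. {W \<in> Pow (U s). W \<inter> cut (Suc s) = cut (Suc s)}"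
    have fS: "finite (?S s)" if "s \<in> {..<k * T}" for s
      by (rule finite_subset[of _ "Pow (U s)"]) (use U that in auto)
    have fA: "finite (A s W)" if "s \<in> {..<k * T}" "W \<in> ?S s" for s W
      using finA that by blast
    have fSA: "finite (SIGMA W:?S s. A s W)" if "s \<in> {..<k * T}" for s
      by (rule finite_SigmaI[OF fS[OF that] fA[OF that]])
    have "card N = (\<Sum>s<k * T. card (SIGMA W:?S s. A s W))"
      unfolding N_def by (rule card_SigmaI) (simp, rule ballI, erule fSA)
    also have "\<dots> = (\<Sum>s<k * T. \<Sum>W\<in>?S s. card (A s W))"
      by (rule sum.cong[OF refl], rule card_SigmaI, erule fS, rule ballI, erule fA, assumption)
    finally show ?thesis .
  qed
  also have "\<dots> \<le> (\<Sum>s<k * T. 2 ^ (k + 8))"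
  proof (rule sum_mono)
    fix s assume "s \<in> {..<k * T}"
    then have s: "s < k * T" by simp
    have "card (A s W) \<le> 2 ^ (k + 4)" if W: "W \<subseteq> U s" for W
    proof -
      have fW: "finite W" using W U(1)[OF s] finite_subset by blast
      have "card (A s W) \<le> card (Pow W)" unfolding A_def using fW by (intro card_mono) auto
      also have "\<dots> = 2 ^ card W" using fW by (rule card_Pow)
      also have "card W \<le> k + 4" using card_mono[OF U(1)[OF s] W] U(2)[OF s] by simp
      then have "2 ^ card W \<le> (2::nat) ^ (k + 4)" by (intro power_increasing) auto
      finally show ?thesis .
    qed
    then have "(\<Sum>W\<in>{W \<in> Pow (U s). W \<inter> cut (Suc s) = cut (Suc s)}. card (A s W)) \<le>
        card {W \<in> Pow (U s). W \<inter> cut (Suc s) = cut (Suc s)} * 2 ^ (k + 4)"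
      by (intro sum_bounded_above[where 'a = nat, simplified]) auto
    also have "card {W \<in> Pow (U s). W \<inter> cut (Suc s) = cut (Suc s)} = 2 ^ card (U s - cut (Suc s))"
      using U(1)[OF s] cutU by (intro card_Pow_prescribed) auto
    \<comment> \<open>Outside the new cut only edges of the current star are left, hence at most
      \<open>2 ^ 4\<close> sets \<open>W\<close>.\<close>
    also have "card (U s - cut (Suc s)) \<le> card (st s)"
      by (intro card_mono) (auto simp: U_def st_def)
    then have "(2::nat) ^ card (U s - cut (Suc s)) \<le> 2 ^ 4"
      using card_star_le[of "s mod k" "s div k"] by (intro power_increasing) (auto simp: st_def)
    finally show "(\<Sum>W\<in>{W \<in> Pow (U s). W \<inter> cut (Suc s) = cut (Suc s)}. card (A s W)) \<le> 2 ^ (k + 8)"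
      by (simp add: power_add)
  qed
  finally have cardN: "card N \<le> k * T * 2 ^ (k + 8)" by simp
  have kT: "0 < k * T" using T_ge k_ge by simp
  have root: "(k * T - 1, {}, {}) \<in> N" "cl (k * T - 1, {}, {}) = {}"
    using cut_last kT by (auto simp: memN cl_def pclause_def)
  have "\<exists>R. is_refutation (lift_formula m G) R \<and> refutation_size R \<le> card N * (7 * m ^ Suc (k + 3))"
  proof (rule lifted_refutation[where cl = cl and rk = rk, OF finN root assms])
    fix \<nu> assume "\<nu> \<in> N"
    moreover obtain s W \<alpha> where \<nu>: "\<nu> = (s, W, \<alpha>)" by (cases \<nu>)
    ultimately have s: "s < k * T" and W: "cut (Suc s) \<subseteq> W" "W \<subseteq> U s" and \<alpha>: "\<alpha> \<subseteq> W"
      and ev: "even (card (\<alpha> \<inter> cut (Suc s)))" by (auto simp: memN)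
    have fW: "finite W" using W U(1)[OF s] finite_subset by blast
    show "is_clause (cl \<nu>) \<and> card (cl \<nu>) \<le> Suc (k + 3)"
      using card_mono[OF U(1)[OF s] W(2)] U(2)[OF s] fW by (auto simp: \<nu> cl_def is_clause_pclause)
    have ij: "s mod k < k" "s div k < T"
      using s k_ge by (auto simp: less_mult_imp_div_less mult.commute)
    let ?leaf = "(\<exists>C\<in>G. C \<subseteq> cl \<nu>) \<or> (\<exists>\<mu>\<in>N. rk \<mu> < rk \<nu> \<and> cl \<mu> \<subseteq> cl \<nu>)"
    let ?query = "card (cl \<nu>) \<le> k + 3 \<and> (\<exists>x\<in>vars G. x \<notin> var ` cl \<nu> \<and>
        (\<exists>\<mu>\<in>N. \<exists>\<mu>'\<in>N. rk \<mu> < rk \<nu> \<and> rk \<mu>' < rk \<nu>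
            \<and> cl \<mu> \<subseteq> insert (Pos x) (cl \<nu>) \<and> cl \<mu>' \<subseteq> insert (Neg x) (cl \<nu>)))"
    have "?leaf \<or> ?query"
    proof (cases "W = U s")
      case True
      have fin: "finite (\<alpha> \<inter> cut s)" "finite (\<alpha> \<inter> st s)"
        using \<alpha> fW finite_subset by blast+
      have "\<alpha> \<inter> cut (Suc s) = sym_diff (\<alpha> \<inter> cut s) (\<alpha> \<inter> st s)" by (auto simp: st_def)
      then have par: "odd (card (\<alpha> \<inter> cut s)) \<longleftrightarrow> odd (card (\<alpha> \<inter> st s))"
        using ev odd_card_sym_diff[OF fin] by auto
      show ?thesis
      proof (cases "odd (card (\<alpha> \<inter> st s)) \<noteq> (s mod k = 0 \<and> s div k = 0)")
        case True
        have "pclause (st s) (\<alpha> \<inter> st s) \<in> G"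
          unfolding st_def by (rule G_memI[OF ij]) (use True in \<open>auto simp: st_def\<close>)
        moreover have "pclause (st s) (\<alpha> \<inter> st s) \<subseteq> cl \<nu>"
          unfolding \<nu> cl_def prod.case \<open>W = U s\<close> by (rule pclause_subset) (auto simp: U_def)
        ultimately have "\<exists>C\<in>G. C \<subseteq> cl \<nu>" by (rule bexI[rotated])
        then show ?thesis by (intro disjI1)
      next
        case False
        \<comment> \<open>For \<open>s = 0\<close> the old cut is empty, so the star has even parity
          and the odd constraint at \<open>(0, 0)\<close> is violated.\<close>
        then have "s \<noteq> 0" using par by (intro notI) auto
        moreover have "s = 0 \<longleftrightarrow> s mod k = 0 \<and> s div k = 0"
          using k_ge by (auto simp: div_eq_0_iff dest: dvd_imp_le)
        ultimately have ev': "even (card (\<alpha> \<inter> cut s))" using False par by auto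
        obtain s' where s': "s = Suc s'" using \<open>s \<noteq> 0\<close> not0_implies_Suc by blast
        let ?\<mu> = "(s', cut s, \<alpha> \<inter> cut s)"
        have "?\<mu> \<in> N" using ev' s cutU[of s'] by (auto simp: memN s' simp del: cut.simps)
        moreover have "rk ?\<mu> < rk \<nu>"
        proof -
          have "card (U s' - cut s) \<le> card (U s')" using U(1)[of s'] s s' by (intro card_mono) auto
          then show ?thesis using U(2)[of s'] s s' by (simp add: rk_def \<nu>)
        qed
        moreover have "cl ?\<mu> \<subseteq> cl \<nu>"
          unfolding \<nu> cl_def prod.case \<open>W = U s\<close> by (rule pclause_subset) (auto simp: U_def)
        ultimately have "\<exists>\<mu>\<in>N. rk \<mu> < rk \<nu> \<and> cl \<mu> \<subseteq> cl \<nu>" by blast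
        then show ?thesis by (intro disjI1 disjI2)
      qed
    next
      case False
      then obtain x where x: "x \<in> U s" "x \<notin> W" using W by auto
      have "x \<in> vars G"
      proof -
        have "x \<in> vars G" if "x \<in> cut t" "t \<le> s" for t
          using that
        proof (induction t)
          case (Suc t)
          have "t mod k < k" "t div k < T"
            using Suc.prems s k_ge by (auto simp: less_mult_imp_div_less mult.commute)
          then have "star (t mod k) (t div k) \<subseteq> vars G" by (rule star_in_vars)
          then show ?case using Suc by auto
        qed simp
        then show ?thesis using x star_in_vars[OF ij] by (auto simp: U_def st_def)
      qed
      moreover have "card W < card (U s)"
        using False W U(1)[OF s] by (intro psubset_card_mono) auto
      then have "card (cl \<nu>) \<le> k + 3" using U(2)[OF s] by (simp add: \<nu> cl_def)
      moreover have "x \<notin> var ` cl \<nu>" using x by (simp add: \<nu> cl_def)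
      moreover have "(s, insert x W, \<alpha>) \<in> N" "(s, insert x W, insert x \<alpha>) \<in> N"
      proof -
        have "insert x \<alpha> \<inter> cut (Suc s) = \<alpha> \<inter> cut (Suc s)" using x W by auto
        then show "(s, insert x W, \<alpha>) \<in> N" "(s, insert x W, insert x \<alpha>) \<in> N"
          using s W \<alpha> ev x by (auto simp: memN simp del: cut.simps)
      qed
      moreover have "card (U s - insert x W) < card (U s - W)"
        using x U(1)[OF s] by (intro psubset_card_mono) auto
      then have "rk (s, insert x W, \<alpha>) < rk \<nu>" "rk (s, insert x W, insert x \<alpha>) < rk \<nu>"
        by (auto simp: rk_def \<nu>)
      moreover have "cl (s, insert x W, \<alpha>) \<subseteq> insert (Pos x) (cl \<nu>)"
        "cl (s, insert x W, insert x \<alpha>) \<subseteq> insert (Neg x) (cl \<nu>)"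
        using x \<alpha> by (auto simp: cl_def \<nu> pclause_def)
      ultimately have ?query by blast
      then show ?thesis ..
    qed
    then show "(\<exists>C\<in>G. C \<subseteq> cl \<nu>) \<or> (\<exists>\<mu>\<in>N. rk \<mu> < rk \<nu> \<and> cl \<mu> \<subseteq> cl \<nu>) \<or> ?query"
      unfolding disj_assoc .
  qed
  then obtain R where "is_refutation (lift_formula m G) R" "refutation_size R \<le> card N * (7 * m ^ Suc (k + 3))"
    by blast
  moreover have "card N * (7 * m ^ Suc (k + 3)) \<le> k * T * 2 ^ (k + 8) * (7 * m ^ (k + 4))"
    using cardN by (intro mult_mono) (auto simp: eval_nat_numeral)
  ultimately show ?thesis by (meson le_trans)
qed

end

subsection \<open>Moving the violated constraint\<close>

lemma odd_card_filter_insert: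
  assumes "finite A" "a \<notin> A"
  shows "odd (card {x \<in> insert a A. \<sigma> x}) \<longleftrightarrow> \<sigma> a \<noteq> odd (card {x \<in> A. \<sigma> x})"
proof (cases "\<sigma> a")
  case True
  then have "{x \<in> insert a A. \<sigma> x} = insert a {x \<in> A. \<sigma> x}" by auto
  then show ?thesis using True assms by simp
next
  case False
  then have "{x \<in> insert a A. \<sigma> x} = {x \<in> A. \<sigma> x}" by auto
  then show ?thesis using False by simp
qed

context compressed_cylinder
begin

definition parity :: "(edge \<Rightarrow> bool) \<Rightarrow> nat \<Rightarrow> nat \<Rightarrow> bool" where
  "parity \<sigma> i j \<longleftrightarrow> odd (card {x \<in> star i j. \<sigma> x})"

lemma parity_eq:
  assumes "i < k"
  shows "parity \<sigma> i j \<longleftrightarrow> ((\<sigma> (v i j) \<noteq> \<sigma> (v (prv i) j)) \<noteq>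
     ((j + 1 < T \<and> \<sigma> (h i j)) \<noteq> (0 < j \<and> \<sigma> (h i (j - 1)))))"
proof -
  let ?A = "(if 0 < j then {h i (j - 1)} else {})"
  let ?A' = "(if j + 1 < T then {h i j} else {}) \<union> ?A"
  have v: "v i j \<noteq> v (prv i) j" using prv_neq[OF assms] by (auto simp: v_def)
  have h: "h i j \<noteq> h i (j - 1)" if "0 < j" using that h_Suc_neq[of i "j - 1" i] by simp
  have A: "odd (card {x \<in> ?A. \<sigma> x}) \<longleftrightarrow> 0 < j \<and> \<sigma> (h i (j - 1))"
    using odd_card_filter_insert[of "{}" "h i (j - 1)" \<sigma>] by simp
  have A': "odd (card {x \<in> ?A'. \<sigma> x}) \<longleftrightarrow> (j + 1 < T \<and> \<sigma> (h i j)) \<noteq> odd (card {x \<in> ?A. \<sigma> x})"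
  proof (cases "j + 1 < T")
    case True
    then have "?A' = insert (h i j) ?A" by simp
    then show ?thesis using odd_card_filter_insert[of ?A "h i j" \<sigma>] h True by simp
  next
    case False
    then have "?A' = ?A" by simp
    then show ?thesis using False by simp
  qed
  have star: "star i j = insert (v i j) (insert (v (prv i) j) ?A')"
    unfolding star_def by (simp only: Un_insert_left Un_empty_left)
  have "parity \<sigma> i j \<longleftrightarrow> \<sigma> (v i j) \<noteq> odd (card {x \<in> insert (v (prv i) j) ?A'. \<sigma> x})"
    unfolding parity_def star by (rule odd_card_filter_insert) (use v in auto)
  moreover have "odd (card {x \<in> insert (v (prv i) j) ?A'. \<sigma> x}) \<longleftrightarrow> \<sigma> (v (prv i) j) \<noteq> odd (card {x \<in> ?A'. \<sigma> x})"
    by (rule odd_card_filter_insert) auto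
  ultimately have "parity \<sigma> i j \<longleftrightarrow> \<sigma> (v i j) \<noteq> (\<sigma> (v (prv i) j) \<noteq> odd (card {x \<in> ?A'. \<sigma> x}))"
    by blast
  then show ?thesis unfolding A' A by blast
qed

lemma parity_xor:
  assumes "i < k"
  shows "parity (\<lambda>x. \<sigma> x \<noteq> F x) i j \<longleftrightarrow> parity \<sigma> i j \<noteq> parity F i j"
  unfolding parity_eq[OF assms] by blast

lemma falsifies_G:
  assumes "C \<in> G" "falsifies \<sigma> C"
  obtains i j where "i < k" "j < T" "var ` C = star i j" "parity \<sigma> i j \<noteq> (i = 0 \<and> j = 0)"
proof -
  obtain i j \<alpha> where C: "i < k" "j < T" "C = pclause (star i j) \<alpha>" "\<alpha> \<subseteq> star i j"
    "odd (card \<alpha>) \<noteq> (i = 0 \<and> j = 0)" using G_clause[OF assms(1)] by blast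
  have "{x \<in> star i j. \<sigma> x} = \<alpha>"
    using assms(2) C(4) unfolding C(3) falsifies_pclause by blast
  then have "parity \<sigma> i j \<noteq> (i = 0 \<and> j = 0)" using C(5) by (simp add: parity_def)
  then show ?thesis using that C by simp
qed

section \<open>Arcs in the cycle of rows\<close>

text \<open>\<open>row_dist q i\<close> decreases by 1 when passing from \<open>i\<close> to the next row, so the rows that
  contain \<open>q\<close> form a cyclic interval.\<close>

definition row_dist :: "nat \<Rightarrow> nat \<Rightarrow> nat" where
  "row_dist q i = (q + k - i) mod k"

lemma row_dist_eq: "q < k \<Longrightarrow> i < k \<Longrightarrow> row_dist q i = (if i \<le> q then q - i else q + k - i)"
  by (auto simp: row_dist_def mod_if)

lemma row_dist_prv: "q < k \<Longrightarrow> r < k \<Longrightarrow> row_dist q (prv r) = (if row_dist q r = k - 1 then 0 else row_dist q r + 1)"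
  by (auto simp: row_dist_eq prv_def)

lemma row_dist_nxt: "q < k \<Longrightarrow> r < k \<Longrightarrow> 0 < row_dist q r \<Longrightarrow> row_dist q (nxt r) = row_dist q r - 1"
  by (auto simp: row_dist_eq nxt_def split: if_splits)

lemma row_dist_less: "q < k \<Longrightarrow> r < k \<Longrightarrow> row_dist q r < k"
  by (auto simp: row_dist_def)

lemma row_dist_inj: "q < k \<Longrightarrow> r < k \<Longrightarrow> r' < k \<Longrightarrow> row_dist q r = row_dist q r' \<longleftrightarrow> r = r'"
  by (auto simp: row_dist_eq split: if_splits)

lemma mem_P_iff: "q < k \<Longrightarrow> q \<in> P i \<longleftrightarrow> row_dist q i \<le> c"
  by (auto simp: P_def row_dist_def)

text \<open>\<open>A\<close> stands for vertical edges of one column, \<open>r\<close> for the edge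
  between \<open>r\<close> and \<open>nxt r\<close>; the boundary of \<open>A\<close> modulo 2
  consists of the rows \<open>i\<close> and \<open>i'\<close>, or is empty if they coincide.\<close>

definition joins_rows :: "nat set \<Rightarrow> nat \<Rightarrow> nat \<Rightarrow> bool" where
  "joins_rows A i i' \<longleftrightarrow> (\<forall>r<k. ((r \<in> A) \<noteq> (prv r \<in> A)) = ((r = i) \<noteq> (r = i')))"

text \<open>Passing from \<open>r\<close> to \<open>prv r\<close> raises \<open>row_dist q\<close>
  by 1 cyclically, so membership in an interval of distances changes exactly at its two
  limits.\<close>

lemma joins_rows_arc:
  assumes q: "q < k" and i: "i < k" "i' < k" and le: "row_dist q i' \<le> row_dist q i"
  shows "joins_rows {r. r < k \<and> row_dist q i' < row_dist q r \<and> row_dist q r \<le> row_dist q i} i i'"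
  unfolding joins_rows_def
proof (intro allI impI)
  fix r assume r: "r < k"
  let ?d = "row_dist q"
  let ?A = "{r. r < k \<and> ?d i' < ?d r \<and> ?d r \<le> ?d i}"
  have arith: "((b < d \<and> d \<le> a) \<noteq> (b < (if d = k - 1 then 0 else d + 1) \<and> (if d = k - 1 then 0 else d + 1) \<le> a))
      = ((d = a) \<noteq> (d = b))" if "b \<le> a" "a < k" "d < k" for a b d :: nat
    using that by (cases "d = k - 1") (simp_all, linarith+)
  have "r \<in> ?A \<longleftrightarrow> ?d i' < ?d r \<and> ?d r \<le> ?d i"
    "prv r \<in> ?A \<longleftrightarrow> ?d i' < ?d (prv r) \<and> ?d (prv r) \<le> ?d i"
    using r prv_less[OF r] by simp_all
  moreover have "r = i \<longleftrightarrow> ?d r = ?d i" "r = i' \<longleftrightarrow> ?d r = ?d i'"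
    using row_dist_inj[OF q r i(1)] row_dist_inj[OF q r i(2)] by simp_all
  ultimately show "((r \<in> ?A) \<noteq> (prv r \<in> ?A)) = ((r = i) \<noteq> (r = i'))"
    unfolding row_dist_prv[OF q r] using arith[OF le row_dist_less[OF q i(1)] row_dist_less[OF q r]]
    by argo
qed

lemma joins_rows_sym: "joins_rows A i i' \<Longrightarrow> joins_rows A i' i"
  unfolding joins_rows_def by blast

lemma joins_rows_exists:
  assumes "i < k" "i' < k"
  shows "\<exists>A\<subseteq>{..<k}. joins_rows A i i'"
proof -
  have "\<exists>A\<subseteq>{..<k}. joins_rows A i i'" if "i < k" "i' < k" "row_dist 0 i' \<le> row_dist 0 i" for i i'
    by (rule exI, rule conjI[OF _ joins_rows_arc[of 0]]) (use that in auto)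
  from this[OF assms] this[OF assms(2,1)] show ?thesis
    using joins_rows_sym nat_le_linear by blast
qed

text \<open>Both rows lie in the cyclic interval of rows that contain \<open>q\<close>, and so does
  the arc between them. Its vertical edges therefore have periods divisible by
  \<open>B * p q\<close>, which permits switching rows with that period.\<close>

lemma joins_rows_common:
  assumes "i < k" "i' < k" "q \<in> P i" "q \<in> P i'"
  shows "\<exists>A\<subseteq>{..<k}. joins_rows A i i' \<and> (\<forall>r\<in>A. q \<in> P r \<inter> P (nxt r))"
proof -
  have q: "q < k" using assms(3) by (simp add: P_def)
  have "\<exists>A\<subseteq>{..<k}. joins_rows A i i' \<and> (\<forall>r\<in>A. q \<in> P r \<inter> P (nxt r))"
    if i: "i < k" "i' < k" "q \<in> P i" "row_dist q i' \<le> row_dist q i" for i i'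
  proof (intro exI[of _ "{r. r < k \<and> row_dist q i' < row_dist q r \<and> row_dist q r \<le> row_dist q i}"] conjI ballI)
    fix r assume "r \<in> {r. r < k \<and> row_dist q i' < row_dist q r \<and> row_dist q r \<le> row_dist q i}"
    then have r: "r < k" "0 < row_dist q r" "row_dist q r \<le> c" using i(3) mem_P_iff[OF q] by auto
    then show "q \<in> P r \<inter> P (nxt r)" using row_dist_nxt[OF q r(1,2)] mem_P_iff[OF q] by simp
  qed (use joins_rows_arc[OF q i(1,2,4)] in auto)
  from this[OF assms(1,2,3)] this[OF assms(2,1,4)] show ?thesis
    using joins_rows_sym nat_le_linear by blast
qed

section \<open>Paths along which the violated constraint moves\<close>

definition free_column :: "edge set \<Rightarrow> nat \<Rightarrow> bool" where
  "free_column Z a \<longleftrightarrow> (\<forall>r<k. v r a \<notin> Z)"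

definition moves :: "(edge \<Rightarrow> bool) \<Rightarrow> nat \<Rightarrow> nat \<Rightarrow> nat \<Rightarrow> nat \<Rightarrow> bool" where
  "moves F r0 a r1 a' \<longleftrightarrow> (\<forall>r<k. \<forall>j<T. parity F r j = ((r = r0 \<and> j = a) \<noteq> (r = r1 \<and> j = a')))"

text \<open>The edges of \<open>Z\<close> must not be flipped. All pairs of rows are covered, since
  within a free column the violation can change to any row.\<close>

definition joined :: "edge set \<Rightarrow> nat \<Rightarrow> nat \<Rightarrow> bool" where
  "joined Z a a' \<longleftrightarrow> (\<forall>r0<k. \<forall>r1<k. \<exists>F. (\<forall>e\<in>Z. \<not> F e) \<and> moves F r0 a r1 a')"

lemma joined_sym: "joined Z a a' \<Longrightarrow> joined Z a' a"
  unfolding joined_def moves_def by metis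

definition in_ends :: "nat \<Rightarrow> bool" where
  "in_ends a \<longleftrightarrow> a < T \<and> (a < E \<or> T - E \<le> a)"

definition mid_cong :: "nat \<Rightarrow> nat \<Rightarrow> nat \<Rightarrow> bool" where
  "mid_cong N j j' \<longleftrightarrow> E \<le> j \<and> j < T - E \<and> E \<le> j' \<and> j' < T - E \<and> [j = j'] (mod N)"

lemma h_eq_mid_cong: "h i j = h i' j' \<longleftrightarrow> i = i' \<and> (j = j' \<or> mid_cong (h_period i) j j')"
  by (auto simp: h_eq_iff rep_eq_iff mid_cong_def)

lemma v_eq_mid_cong: "v i j = v i' j' \<longleftrightarrow> i = i' \<and> (j = j' \<or> mid_cong (v_period i) j j')"
  by (auto simp: v_eq_iff rep_eq_iff mid_cong_def)

text \<open>The image under identification of a path given in the uncompressed graph. It agrees with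
  \<open>hp\<close> and \<open>vp\<close> if these respect the identification.\<close>

definition flip :: "(nat \<Rightarrow> nat \<Rightarrow> bool) \<Rightarrow> (nat \<Rightarrow> nat \<Rightarrow> bool) \<Rightarrow> edge \<Rightarrow> bool" where
  "flip hp vp e \<longleftrightarrow> (\<exists>r j. j + 1 < T \<and> e = h r j \<and> hp r j) \<or> (\<exists>r j. j < T \<and> e = v r j \<and> vp r j)"

lemma flip_h:
  assumes "\<And>r j j'. mid_cong (h_period r) j j' \<Longrightarrow> hp r j \<Longrightarrow> hp r j'" "j + 1 < T"
  shows "flip hp vp (h r j) \<longleftrightarrow> hp r j"
  using assms by (auto simp: flip_def h_eq_mid_cong mid_cong_def cong_sym_eq)

lemma flip_v:
  assumes "\<And>r j j'. mid_cong (v_period r) j j' \<Longrightarrow> vp r j \<Longrightarrow> vp r j'" "j < T"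
  shows "flip hp vp (v r j) \<longleftrightarrow> vp r j"
  using assms by (auto simp: flip_def v_eq_mid_cong mid_cong_def cong_sym_eq)

lemma joined_refl:
  assumes "in_ends a" "free_column Z a"
  shows "joined Z a a"
  unfolding joined_def
proof (intro allI impI)
  fix r0 r1 assume r: "r0 < k" "r1 < k"
  obtain A where A: "A \<subseteq> {..<k}" "joins_rows A r0 r1" using joins_rows_exists[OF r] by blast
  let ?hp = "\<lambda>r j. False" and ?vp = "\<lambda>r j. j = a \<and> r \<in> A"
  let ?F = "flip ?hp ?vp"
  have Fh: "\<not> ?F (h r j)" for r j by (auto simp: flip_def)
  have Fv: "?F (v r j) \<longleftrightarrow> ?vp r j" if "j < T" for r j
    by (rule flip_v[OF _ that]) (use assms(1) in \<open>auto simp: mid_cong_def in_ends_def\<close>)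
  have "\<not> ?F e" if "e \<in> Z" for e
    using that assms(2) A(1) unfolding flip_def free_column_def by blast
  moreover have "moves ?F r0 a r1 a"
    unfolding moves_def
  proof (intro allI impI)
    fix r j assume rj: "r < k" "j < T"
    show "parity ?F r j = ((r = r0 \<and> j = a) \<noteq> (r = r1 \<and> j = a))"
      unfolding parity_eq[OF rj(1)] Fv[OF rj(2)]
      using A(2) rj(1) Fh unfolding joins_rows_def by auto
  qed
  ultimately show "\<exists>F. (\<forall>e\<in>Z. \<not> F e) \<and> moves F r0 a r1 a" by blast
qed

text \<open>The path uses row \<open>i1\<close> in the columns with \<open>S\<close> and row \<open>i0\<close> elsewhere, and changes between
  the two rows in the columns with \<open>Sw\<close>.\<close>

lemma joined_path:
  assumes a: "a < a'" "in_ends a" "in_ends a'" and free: "free_column Z a" "free_column Z a'"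
    and i: "i0 < k" "i1 < k" and A: "A \<subseteq> {..<k}" "joins_rows A i0 i1"
    and Sw: "\<And>j. 0 < j \<Longrightarrow> Sw j \<longleftrightarrow> S j \<noteq> S (j - 1)"
    and S_cong: "\<And>j j'. mid_cong (h_period i0) j j' \<or> mid_cong (h_period i1) j j' \<Longrightarrow> S j \<longleftrightarrow> S j'"
    and Sw_cong: "\<And>r j j'. r \<in> A \<Longrightarrow> mid_cong (v_period r) j j' \<Longrightarrow> Sw j \<longleftrightarrow> Sw j'"
    and avoid_h: "\<And>j. a \<le> j \<Longrightarrow> j < a' \<Longrightarrow> h (if S j then i1 else i0) j \<notin> Z"
    and avoid_v: "\<And>r j. a < j \<Longrightarrow> j < a' \<Longrightarrow> Sw j \<Longrightarrow> r \<in> A \<Longrightarrow> v r j \<notin> Z"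
  shows "joined Z a a'"
  unfolding joined_def
proof (intro allI impI)
  fix r0 r1 assume r: "r0 < k" "r1 < k"
  define f where "f j = (if S j then i1 else i0)" for j
  have fk: "f j < k" for j using i by (simp add: f_def)
  \<comment> \<open>In the free columns \<open>a\<close> and \<open>a'\<close> the path may turn to
    arbitrary rows.\<close>
  obtain A0 where A0: "A0 \<subseteq> {..<k}" "joins_rows A0 r0 (f a)" using joins_rows_exists[OF r(1) fk] by blast
  obtain A1 where A1: "A1 \<subseteq> {..<k}" "joins_rows A1 (f (a' - 1)) r1" using joins_rows_exists[OF fk r(2)] by blast
  let ?hp = "\<lambda>r j. a \<le> j \<and> j < a' \<and> r = f j"
  let ?vp = "\<lambda>r j. (a < j \<and> j < a' \<and> r \<in> A \<and> Sw j) \<or> (j = a \<and> r \<in> A0) \<or> (j = a' \<and> r \<in> A1)"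
  let ?F = "flip ?hp ?vp"
  \<comment> \<open>Both end columns are uncompressed, so identified columns lie on the same side of
    each of them; truncating the path therefore respects the identification.\<close>
  have mid: "(a \<le> j \<longleftrightarrow> a \<le> j') \<and> (j < a' \<longleftrightarrow> j' < a') \<and> (a < j \<longleftrightarrow> a < j') \<and> j \<noteq> a \<and> j \<noteq> a' \<and> j' \<noteq> a \<and> j' \<noteq> a'"
    if "mid_cong N j j'" for N j j'
    using that a by (auto simp: mid_cong_def in_ends_def)
  have aT: "a' < T" using a by (simp add: in_ends_def)
  have Fh: "?F (h r j) \<longleftrightarrow> ?hp r j" if "j + 1 < T" for r j
  proof (rule flip_h[OF _ that])
    fix r j j' assume m: "mid_cong (h_period r) j j'" and hp: "?hp r j"
    then have "mid_cong (h_period i0) j j' \<or> mid_cong (h_period i1) j j'" by (auto simp: f_def split: if_splits)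
    then have "f j = f j'" using S_cong[of j j'] by (simp add: f_def)
    then show "?hp r j'" using hp mid[OF m] by simp
  qed
  have Fv: "?F (v r j) \<longleftrightarrow> ?vp r j" if "j < T" for r j
  proof (rule flip_v[OF _ that])
    fix r j j' assume m: "mid_cong (v_period r) j j'" and vp: "?vp r j"
    then have "r \<in> A" "Sw j" "a < j" "j < a'" using mid[OF m] by auto
    then show "?vp r j'" using Sw_cong[OF _ m] mid[OF m] by simp
  qed
  have "\<not> ?F e" if e: "e \<in> Z" for e
  proof
    assume "?F e"
    then consider r j where "j + 1 < T" "e = h r j" "?hp r j" | r j where "j < T" "e = v r j" "?vp r j"
      unfolding flip_def by blast
    then show False
    proof cases
      case 1
      then show False using avoid_h[of j] e by (auto simp: f_def)
    next
      case 2
      then show False using avoid_v[of j r] free A0(1) A1(1) e unfolding free_column_def by blast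
    qed
  qed
  moreover have "moves ?F r0 a r1 a'"
    unfolding moves_def
  proof (intro allI impI)
    fix r j assume rj: "r < k" "j < T"
    note J = A(2)[unfolded joins_rows_def, rule_format, OF rj(1)]
      A0(2)[unfolded joins_rows_def, rule_format, OF rj(1)]
      A1(2)[unfolded joins_rows_def, rule_format, OF rj(1)]
    have hr: "(j + 1 < T \<and> ?F (h r j)) \<longleftrightarrow> a \<le> j \<and> j < a' \<and> r = f j"
      using Fh[of j r] aT by auto
    have hl: "(0 < j \<and> ?F (h r (j - 1))) \<longleftrightarrow> 0 < j \<and> a \<le> j - 1 \<and> j - 1 < a' \<and> r = f (j - 1)"
      using Fh[of "j - 1" r] rj(2) by auto
    define x y x' y' where "x = ?vp r j" and "y = ?vp (prv r) j"
      and "x' = (a \<le> j \<and> j < a' \<and> r = f j)" and "y' = (0 < j \<and> a \<le> j - 1 \<and> j - 1 < a' \<and> r = f (j - 1))"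
    note d = x_def y_def x'_def y'_def
    consider "j < a" | "j = a" | "a < j" "j < a'" | "j = a'" | "a' < j" by linarith
    then have "((x \<noteq> y) \<noteq> (x' \<noteq> y')) = ((r = r0 \<and> j = a) \<noteq> (r = r1 \<and> j = a'))"
    proof cases
      case 1
      then have "\<not> a \<le> j - 1" by linarith
      then have "\<not> x" "\<not> y" "\<not> x'" "\<not> y'" "j \<noteq> a" "j \<noteq> a'" using 1 a(1) by (simp_all add: d)
      then show ?thesis by blast
    next
      case 2
      then have "\<not> (0 < j \<and> a \<le> j - 1)" by linarith
      then have "\<not> y'" unfolding d by blast
      have "x \<longleftrightarrow> r \<in> A0" "y \<longleftrightarrow> prv r \<in> A0" "x' \<longleftrightarrow> r = f a" "j = a" "j \<noteq> a'"
        using 2 a(1) by (simp_all add: d)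
      then show ?thesis using J(2) \<open>\<not> y'\<close> by blast
    next
      case 3
      then have "a \<le> j - 1" "j - 1 < a'" "0 < j" by linarith+
      then have "x \<longleftrightarrow> r \<in> A \<and> Sw j" "y \<longleftrightarrow> prv r \<in> A \<and> Sw j" "x' \<longleftrightarrow> r = f j" "y' \<longleftrightarrow> r = f (j - 1)"
        "j \<noteq> a" "j \<noteq> a'"
        using 3 by (simp_all add: d)
      moreover have "(r = f j) \<noteq> (r = f (j - 1)) \<longleftrightarrow> Sw j \<and> ((r = i0) \<noteq> (r = i1))"
        using Sw[of j] 3 by (auto simp: f_def)
      ultimately show ?thesis using J(1) by blast
    next
      case 4
      then have "a \<le> j - 1" "j - 1 < a'" "0 < j" using a(1) by linarith+
      then have "x \<longleftrightarrow> r \<in> A1" "y \<longleftrightarrow> prv r \<in> A1" "\<not> x'" "y' \<longleftrightarrow> r = f (a' - 1)" "j \<noteq> a" "j = a'"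
        using 4 a(1) by (simp_all add: d)
      then show ?thesis using J(3) by blast
    next
      case 5
      then have "\<not> j - 1 < a'" by linarith
      then have "\<not> x" "\<not> y" "\<not> x'" "\<not> y'" "j \<noteq> a" "j \<noteq> a'" using a(1) 5 by (simp_all add: d)
      then show ?thesis by blast
    qed
    then show "parity ?F r j = ((r = r0 \<and> j = a) \<noteq> (r = r1 \<and> j = a'))"
      unfolding parity_eq[OF rj(1)] Fv[OF rj(2)] hr hl d .
  qed
  ultimately show "\<exists>F. (\<forall>e\<in>Z. \<not> F e) \<and> moves F r0 a r1 a'" by blast
qed

definition row_edges :: "edge set \<Rightarrow> nat \<Rightarrow> edge set" where
  "row_edges Z i = {e \<in> Z. \<exists>j. j + 1 < T \<and> e = h i j}"

definition column_edges :: "edge set \<Rightarrow> edge set" where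
  "column_edges Z = {e \<in> Z. \<exists>i j. e = v i j}"

text \<open>Otherwise the straight path along row \<open>i\<close>, without any change of rows,
  would join the columns.\<close>

lemma row_edge_if_not_joined:
  assumes "a < a'" "in_ends a" "in_ends a'" "free_column Z a" "free_column Z a'"
    "\<not> joined Z a a'" "i < k"
  shows "\<exists>j. a \<le> j \<and> j < a' \<and> h i j \<in> Z"
proof (rule ccontr)
  assume none: "\<not> ?thesis"
  have "joined Z a a'"
    by (rule joined_path[OF assms(1-5,7,7), of "{}" "\<lambda>_. False" "\<lambda>_. False"])
       (use none in \<open>auto simp: joins_rows_def\<close>)
  then show False using assms(6) by simp
qed

lemma card_row_edges_le:
  assumes "finite Z"
  shows "(\<Sum>i<k. card (row_edges Z i)) + card (column_edges Z) \<le> card Z"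
proof -
  have fin: "finite (row_edges Z i)" "finite (column_edges Z)" for i
    using assms by (auto simp: row_edges_def column_edges_def)
  have "(\<Sum>i<k. card (row_edges Z i)) = card (\<Union>i<k. row_edges Z i)"
    using fin by (intro card_UN_disjoint[symmetric]) (auto simp: row_edges_def h_def)
  moreover have "card (\<Union>i<k. row_edges Z i) + card (column_edges Z) = card ((\<Union>i<k. row_edges Z i) \<union> column_edges Z)"
    using fin by (intro card_Un_disjoint[symmetric]) (auto simp: row_edges_def column_edges_def)
  moreover have "\<dots> \<le> card Z"
    using assms by (intro card_mono) (auto simp: row_edges_def column_edges_def)
  ultimately show ?thesis by simp
qed

text \<open>Each row accounts for one edge, and each row with several edges for at least one
  more.\<close>

lemma card_nonsingle_rows_le:
  assumes "finite Z" "\<And>i. i < k \<Longrightarrow> row_edges Z i \<noteq> {}"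
  shows "k + card {i. i < k \<and> card (row_edges Z i) \<noteq> 1} + card (column_edges Z) \<le> card Z"
proof -
  have fin: "finite (row_edges Z i)" for i using assms by (auto simp: row_edges_def)
  have "k + card {i. i < k \<and> card (row_edges Z i) \<noteq> 1} =
      (\<Sum>i<k. 1 + (if card (row_edges Z i) \<noteq> 1 then 1 else 0))"
    by (subst sum.distrib) (simp add: sum.If_cases Int_def)
  also have "\<dots> \<le> (\<Sum>i<k. card (row_edges Z i))"
  proof (rule sum_mono)
    fix i assume "i \<in> {..<k}"
    then have "card (row_edges Z i) \<noteq> 0" using fin assms(2) by simp
    then show "1 + (if card (row_edges Z i) \<noteq> 1 then 1 else 0) \<le> card (row_edges Z i)" by auto
  qed
  finally show ?thesis using card_row_edges_le[OF assms(1)] by simp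
qed

end

subsection \<open>Cordons\<close>

context compressed_cylinder
begin

text \<open>The tolerance is \<open>k\<close> because among \<open>k\<close> consecutive residues
  there is one at which fewer than \<open>k\<close> vertical edges do not block a change of
  rows.\<close>

definition near :: "nat \<Rightarrow> int \<Rightarrow> int \<Rightarrow> bool" where
  "near N x y \<longleftrightarrow> (\<exists>e. \<bar>e\<bar> \<le> int k \<and> int N dvd x - y - e)"

lemma row_edges_nonempty: "h i j \<in> Z \<Longrightarrow> j + 1 < T \<Longrightarrow> row_edges Z i \<noteq> {}"
  unfolding row_edges_def by blast

text \<open>If \<open>x\<close> and \<open>y\<close> were more than \<open>k\<close> apart on the
  cycle of length \<open>N\<close>, the path could switch to row \<open>i1\<close> before the
  residue of \<open>x\<close> and back to row \<open>i0\<close> before that of \<open>y\<close>,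
  again and again with period \<open>N\<close>. It avoids the only blocked class of each row, and
  \<open>N\<close> divides all periods involved.\<close>

lemma near_if_not_joined:
  assumes a: "a < a'" "in_ends a" "in_ends a'" and free: "free_column Z a" "free_column Z a'"
    and not: "\<not> joined Z a a'"
    and Z: "finite Z" "card (column_edges Z) < k"
    and i: "i0 < k" "i1 < k"
    and A: "A \<subseteq> {..<k}" "joins_rows A i0 i1"
    and N: "B \<le> N" "N dvd h_period i0" "N dvd h_period i1" "\<And>r. r \<in> A \<Longrightarrow> N dvd v_period r"
    and x: "x + 1 < T" "row_edges Z i0 = {h i0 x}" and y: "y + 1 < T" "row_edges Z i1 = {h i1 y}"
  shows "near N (int x) (int y)"
proof (rule ccontr)
  assume far: "\<not> near N (int x) (int y)"
  have kN: "8 * k \<le> N" using N(1) by (simp add: B_def)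
  have N0: "0 < N" using kN k_ge by simp
  \<comment> \<open>The residue relative to \<open>y\<close>; adding \<open>N - y mod N\<close>
    avoids subtraction on naturals.\<close>
  define \<phi> where "\<phi> j = (j + (N - y mod N)) mod N" for j
  have \<phi>_less: "\<phi> j < N" for j using N0 by (simp add: \<phi>_def)
  have \<phi>_cong: "\<phi> j = \<phi> j'" if "[j = j'] (mod N)" for j j'
    using that unfolding \<phi>_def unique_euclidean_semiring_class.cong_def by (metis mod_add_left_eq)
  have \<phi>_dvd: "int N dvd int x - int y - int (\<phi> x)"
  proof -
    have "y mod N \<le> N" using N0 by (simp add: less_imp_le)
    then have "int (\<phi> x) = (int x + (int N - int y mod int N)) mod int N"
      by (simp add: \<phi>_def zmod_int of_nat_diff add_diff_eq)
    also have "\<dots> = (int x - int y) mod int N"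
      by (metis (no_types, opaque_lifting) add_diff_eq diff_add_eq mod_add_self2 mod_diff_right_eq)
    finally show ?thesis by (simp add: mod_eq_dvd_iff[symmetric])
  qed
  have \<phi>y: "\<phi> y = 0"
  proof -
    have "y mod N < N" using N0 by simp
    then have "y + (N - y mod N) = N * (y div N) + N" using mult_div_mod_eq[of N y] by linarith
    then show ?thesis by (simp add: \<phi>_def)
  qed
  have x1: "k < \<phi> x"
  proof (rule ccontr)
    assume "\<not> k < \<phi> x"
    then show False using far \<phi>_dvd unfolding near_def by (auto simp: not_less)
  qed
  have x2: "\<phi> x + k < N"
  proof (rule ccontr)
    assume *: "\<not> \<phi> x + k < N"
    have "int N dvd (int x - int y - int (\<phi> x)) + int N" using \<phi>_dvd by simp
    then have "int N dvd int x - int y - (int (\<phi> x) - int N)" by (simp add: algebra_simps)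
    moreover have "\<bar>int (\<phi> x) - int N\<bar> \<le> int k" using * \<phi>_less[of x] by linarith
    ultimately show False using far unfolding near_def by blast
  qed
  define bad where "bad = {\<phi> j |r j. r \<in> A \<and> v r j \<in> Z}"
  \<comment> \<open>The residue of a vertical edge does not depend on the representing column,
    because \<open>N\<close> divides its period. So there are at most as many bad residues as
    vertical edges in \<open>Z\<close>.\<close>
  define g where "g e = \<phi> (SOME j. \<exists>r\<in>A. e = v r j)" for e
  have g: "g (v r j) = \<phi> j" if "r \<in> A" for r j
  proof -
    define j' where "j' = (SOME j'. \<exists>r'\<in>A. v r j = v r' j')"
    have "\<exists>r'\<in>A. v r j = v r' j'"
      unfolding j'_def by (rule someI[of "\<lambda>j'. \<exists>r'\<in>A. v r j = v r' j'" j]) (use that in blast)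
    then have "j = j' \<or> [j = j'] (mod v_period r)"
      unfolding v_eq_mid_cong mid_cong_def by blast
    then have "\<phi> j = \<phi> j'"
      using \<phi>_cong cong_dvd_modulus_nat[OF _ N(4)[OF that]] by blast
    then show ?thesis by (simp add: g_def j'_def)
  qed
  have bad_g: "bad \<subseteq> g ` column_edges Z"
  proof
    fix z assume "z \<in> bad"
    then obtain r j where "z = \<phi> j" "r \<in> A" "v r j \<in> Z" unfolding bad_def by blast
    then show "z \<in> g ` column_edges Z"
      using g[of r j] by (intro image_eqI[of _ _ "v r j"]) (auto simp: column_edges_def)
  qed
  have fincol: "finite (column_edges Z)" using Z(1) by (simp add: column_edges_def)
  have cardbad: "card bad < k"
    using card_mono[OF finite_imageI[OF fincol] bad_g] card_image_le[OF fincol, of g] Z(2) by linarith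
  have finbad: "finite bad" using finite_subset[OF bad_g finite_imageI[OF fincol]] .
  \<comment> \<open>Each of the two arcs between the residues of \<open>y\<close> and
    \<open>x\<close> offers at least \<open>k\<close> switching positions, of which fewer than
    \<open>k\<close> are bad.\<close>
  have "\<not> {1..\<phi> x} \<subseteq> bad" using card_mono[OF finbad, of "{1..\<phi> x}"] cardbad x1 by auto
  then obtain b where b: "1 \<le> b" "b \<le> \<phi> x" "b \<notin> bad" unfolding subset_iff atLeastAtMost_iff by blast
  have "\<not> {\<phi> x + 1..<N} \<subseteq> bad" using card_mono[OF finbad, of "{\<phi> x + 1..<N}"] cardbad x2 by auto
  then obtain e where "\<phi> x + 1 \<le> e" and e: "e < N" "e \<notin> bad"
    unfolding subset_iff atLeastLessThan_iff by blast
  then have e: "\<phi> x < e" "e < N" "e \<notin> bad" by simp_all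
  define S where "S j \<longleftrightarrow> b \<le> \<phi> j \<and> \<phi> j < e" for j
  define Sw where "Sw j \<longleftrightarrow> \<phi> j = b \<or> \<phi> j = e" for j
  have step: "\<phi> j = (if \<phi> (j - 1) + 1 = N then 0 else \<phi> (j - 1) + 1)" if "0 < j" for j
  proof -
    have j: "j + (N - y mod N) = Suc (j - 1 + (N - y mod N))" using that by simp
    show ?thesis unfolding \<phi>_def j Suc_eq_plus1[symmetric] by (rule mod_Suc)
  qed
  have S_cong: "S j \<longleftrightarrow> S j'" if "mid_cong M j j'" "N dvd M" for M j j'
    using that \<phi>_cong[of j j'] cong_dvd_modulus_nat unfolding S_def mid_cong_def by metis
  have "joined Z a a'"
  proof (rule joined_path[OF a free i A, of Sw S])
    fix j :: nat assume "0 < j"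
    show "Sw j \<longleftrightarrow> S j \<noteq> S (j - 1)"
      unfolding Sw_def S_def step[OF \<open>0 < j\<close>] using b(1,2) e(1,2) \<phi>_less[of "j - 1"] by (auto split: if_splits)
  next
    fix j j' assume "mid_cong (h_period i0) j j' \<or> mid_cong (h_period i1) j j'"
    then show "S j \<longleftrightarrow> S j'" using S_cong N by blast
  next
    fix r j j' assume "r \<in> A" "mid_cong (v_period r) j j'"
    then have "\<phi> j = \<phi> j'" using \<phi>_cong cong_dvd_modulus_nat N(4) unfolding mid_cong_def by blast
    then show "Sw j \<longleftrightarrow> Sw j'" by (simp add: Sw_def)
  next
    fix j assume j: "a \<le> j" "j < a'"
    have jT: "j + 1 < T" using j a(3) by (simp add: in_ends_def)
    show "h (if S j then i1 else i0) j \<notin> Z"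
    proof
      assume Z: "h (if S j then i1 else i0) j \<in> Z"
      show False
      proof (cases "S j")
        case True
        then have "h i1 j \<in> row_edges Z i1" using Z jT by (auto simp: row_edges_def)
        then have "\<phi> j = \<phi> y" using y(2) \<phi>_cong cong_dvd_modulus_nat[OF _ N(3)]
          by (auto simp: h_eq_mid_cong mid_cong_def)
        then show False using True \<phi>y b(1) by (simp add: S_def)
      next
        case False
        then have "h i0 j \<in> row_edges Z i0" using Z jT by (auto simp: row_edges_def)
        then have "\<phi> j = \<phi> x" using x(2) \<phi>_cong cong_dvd_modulus_nat[OF _ N(2)]
          by (auto simp: h_eq_mid_cong mid_cong_def)
        then show False using False b(2) e(1) by (simp add: S_def)
      qed
    qed
  next
    fix r j assume "Sw j" "r \<in> A"
    then show "v r j \<notin> Z" using b(3) e(3) unfolding Sw_def bad_def by auto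
  qed
  then show False using not by simp
qed

text \<open>A cordon \<open>t\<close> is a virtual column of the cyclic cylinder of length \<open>B * Q\<close> near which every
  row with only one edge in \<open>Z\<close> is blocked.\<close>

definition cordon :: "edge set \<Rightarrow> int \<Rightarrow> bool" where
  "cordon Z t \<longleftrightarrow> (\<forall>i<k. row_edges Z i \<noteq> {}) \<and>
     (\<forall>i<k. \<forall>x. x + 1 < T \<longrightarrow> row_edges Z i = {h i x} \<longrightarrow> near (h_period i) (int x) t)"

text \<open>A row with a single edge in \<open>Y\<close> has the same single edge in
  \<open>Z\<close>, since the cordon of \<open>Z\<close> leaves no row empty.\<close>

lemma cordon_mono:
  assumes "cordon Z t" "Z \<subseteq> Y"
  shows "cordon Y t"
proof -
  have sub: "row_edges Z i \<subseteq> row_edges Y i" for i using assms(2) by (auto simp: row_edges_def)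
  then have "row_edges Z i = {e}" if "row_edges Y i = {e}" "i < k" for i e
    using assms(1) that unfolding cordon_def by (metis subset_singletonD)
  moreover have "row_edges Y i \<noteq> {}" if "i < k" for i
    using assms(1) that sub[of i] unfolding cordon_def by auto
  ultimately show ?thesis using assms(1) unfolding cordon_def by simp
qed

lemma dvd_small_eq:
  assumes "int B dvd e - e'" "\<bar>e - e'\<bar> < int B"
  shows "e = e'"
  using assms dvd_imp_le_int[of "e - e'" "int B"] by auto

lemma single_rowE:
  assumes "card (row_edges Z i) = 1"
  obtains x where "x + 1 < T" "row_edges Z i = {h i x}"
proof -
  obtain e where e: "row_edges Z i = {e}" using assms by (rule card_1_singletonE)
  then have "e \<in> row_edges Z i" by simp
  then show ?thesis using that e unfolding row_edges_def by auto
qed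

lemma rows_containing:
  assumes "q < k"
  shows "card {i. i < k \<and> q \<in> P i} = c + 1"
proof -
  have "row_dist q ` {i. i < k \<and> q \<in> P i} = {..c}"
  proof (intro equalityI subsetI)
    fix d assume "d \<in> {..c}"
    then have d: "d \<le> c" by simp
    let ?i = "if d \<le> q then q - d else q + k - d"
    have "?i < k" "row_dist q ?i = d" using d c_less assms by (auto simp: row_dist_eq)
    then show "d \<in> row_dist q ` {i. i < k \<and> q \<in> P i}"
      using d mem_P_iff[OF assms] by (intro image_eqI[of _ _ ?i]) auto
  qed (use mem_P_iff[OF assms] in auto)
  moreover have "inj_on (row_dist q) {i. i < k \<and> q \<in> P i}"
    using row_dist_inj[OF assms] by (auto simp: inj_on_def)
  ultimately show ?thesis by (metis card_atMost card_image Suc_eq_plus1)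
qed

lemma B_dvd_h_period: "B dvd h_period i"
  by (simp add: h_period_def)

lemma Bp_dvd_h_period: "q \<in> P i \<Longrightarrow> B * p q dvd h_period i"
  unfolding h_period_def by (intro mult_dvd_mono dvd_refl dvd_prodI) auto

lemma Bp_dvd_v_period: "q \<in> P i \<inter> P (nxt i) \<Longrightarrow> B * p q dvd v_period i"
  unfolding v_period_def by (intro mult_dvd_mono dvd_refl dvd_prodI) auto

lemma prod_p_dvd:
  assumes "S \<subseteq> {..<k}" "\<And>q. q \<in> S \<Longrightarrow> int (p q) dvd w"
  shows "int (\<Prod>q\<in>S. p q) dvd w"
proof -
  have "[w = 0] (mod (\<Prod>q\<in>S. int (p q)))"
  proof (rule cong_cong_prod_coprime)
    show "\<forall>q\<in>S. [w = 0] (mod int (p q))" using assms(2) by (simp add: cong_0_iff)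
    show "\<forall>q\<in>S. \<forall>q'\<in>S. q \<noteq> q' \<longrightarrow> coprime (int (p q)) (int (p q'))"
      using p_coprime assms(1) by auto
  qed
  then show ?thesis by (simp add: cong_0_iff)
qed

text \<open>At most \<open>c\<close> rows have several edges, so every prime occurs in some row with
  a single edge. Both cordons are within \<open>k\<close> of that edge, so their difference is small
  modulo the period of the row. As \<open>B\<close> exceeds \<open>4 * k\<close>, the small
  remainder is the same for all rows, and the coprime moduli combine.\<close>

lemma cordon_unique:
  assumes Y: "finite Y" "card Y \<le> k + c" and t: "cordon Y t" "cordon Y t'"
  shows "\<exists>e. \<bar>e\<bar> \<le> 2 * int k \<and> int (B * Q) dvd t - t' - e"
proof -
  define S where "S = {i. i < k \<and> card (row_edges Y i) = 1}"
  have ne: "row_edges Y i \<noteq> {}" if "i < k" for i using t(1) that by (simp add: cordon_def)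
  have non: "card {i. i < k \<and> card (row_edges Y i) \<noteq> 1} \<le> c"
    using card_nonsingle_rows_le[OF Y(1) ne] Y(2) by linarith
  have ex_q: "\<exists>i\<in>S. q \<in> P i" if "q < k" for q
  proof (rule ccontr)
    assume "\<not> ?thesis"
    then have "{i. i < k \<and> q \<in> P i} \<subseteq> {i. i < k \<and> card (row_edges Y i) \<noteq> 1}" by (auto simp: S_def)
    then have "card {i. i < k \<and> q \<in> P i} \<le> card {i. i < k \<and> card (row_edges Y i) \<noteq> 1}"
      by (intro card_mono) auto
    then show False using non rows_containing[OF that] by simp
  qed
  have close: "\<exists>e. \<bar>e\<bar> \<le> 2 * int k \<and> int (h_period i) dvd t - t' - e" if "i \<in> S" for i
  proof -
    have i: "i < k" "card (row_edges Y i) = 1" using that by (auto simp: S_def)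
    obtain x where x: "x + 1 < T" "row_edges Y i = {h i x}" using i(2) by (rule single_rowE)
    have "near (h_period i) (int x) t" "near (h_period i) (int x) t'"
      using t i(1) x unfolding cordon_def by blast+
    then obtain d d' where d: "\<bar>d\<bar> \<le> int k" "int (h_period i) dvd int x - t - d"
      "\<bar>d'\<bar> \<le> int k" "int (h_period i) dvd int x - t' - d'" unfolding near_def by blast
    have "int (h_period i) dvd (int x - t' - d') - (int x - t - d)" using d(4,2) by (rule dvd_diff)
    then have "int (h_period i) dvd t - t' - (d' - d)" by (simp add: algebra_simps)
    then show ?thesis using d by (intro exI[of _ "d' - d"]) auto
  qed
  obtain i0 where i0: "i0 \<in> S" using ex_q[of 0] k_ge by auto
  obtain e where e: "\<bar>e\<bar> \<le> 2 * int k" "int (h_period i0) dvd t - t' - e" using close[OF i0] by blast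
  have Be: "int B dvd t - t' - e" using e(2) B_dvd_h_period[of i0] by (meson dvd_trans of_nat_dvd_iff)
  then obtain w where w: "t - t' - e = int B * w" by (rule dvdE)
  have "int (p q) dvd w" if q: "q < k" for q
  proof -
    obtain i where i: "i \<in> S" "q \<in> P i" using ex_q[OF q] by blast
    obtain e' where e': "\<bar>e'\<bar> \<le> 2 * int k" "int (h_period i) dvd t - t' - e'" using close[OF i(1)] by blast
    have "int B dvd t - t' - e'" using e'(2) B_dvd_h_period[of i] by (meson dvd_trans of_nat_dvd_iff)
    then have "int B dvd (t - t' - e') - (t - t' - e)" using Be by (rule dvd_diff)
    then have "int B dvd e - e'" by simp
    moreover have "\<bar>e - e'\<bar> < int B" using e(1) e'(1) k_ge by (simp add: B_def)
    ultimately have "e = e'" by (rule dvd_small_eq)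
    then have "int (B * p q) dvd int B * w"
      using e'(2) Bp_dvd_h_period[OF i(2)] w by (metis dvd_trans of_nat_dvd_iff)
    then show ?thesis using B_ge by simp
  qed
  then have "int Q dvd w" unfolding Q_def by (intro prod_p_dvd) auto
  then have "int (B * Q) dvd t - t' - e" by (simp add: w)
  then show ?thesis using e(1) by blast
qed

text \<open>No row is empty, which takes \<open>k\<close> of the fewer than \<open>2 * k\<close>
  edges and leaves fewer than \<open>k\<close> vertical ones. Modulo \<open>B\<close> any arc of
  rows serves for switching; modulo \<open>B * p q\<close> it must consist of rows that share
  \<open>q\<close>.\<close>

lemma near_rows:
  assumes a: "a < a'" "in_ends a" "in_ends a'" and free: "free_column Z a" "free_column Z a'"
    and not: "\<not> joined Z a a'" and Z: "finite Z" "card Z < 2 * k"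
    and i: "i0 < k" "i1 < k"
    and x: "x + 1 < T" "row_edges Z i0 = {h i0 x}" and y: "y + 1 < T" "row_edges Z i1 = {h i1 y}"
  shows "near B (int x) (int y)" and "\<And>q. q \<in> P i0 \<Longrightarrow> q \<in> P i1 \<Longrightarrow> near (B * p q) (int x) (int y)"
proof -
  have "row_edges Z i \<noteq> {}" if i: "i < k" for i
  proof -
    obtain j where "j < a'" "h i j \<in> Z"
      using row_edge_if_not_joined[OF a free not i] by blast
    moreover have "j + 1 < T" using \<open>j < a'\<close> a(3) by (simp add: in_ends_def)
    ultimately show ?thesis by (intro row_edges_nonempty)
  qed
  then have col: "card (column_edges Z) < k" using card_nonsingle_rows_le[OF Z(1)] Z(2) by fastforce
  note near = near_if_not_joined[OF a free not Z(1) col i _ _ _ _ _ _ x y]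
  obtain A where "A \<subseteq> {..<k}" "joins_rows A i0 i1" using joins_rows_exists[OF i] by blast
  then show "near B (int x) (int y)"
    by (rule near) (auto simp: B_dvd_h_period v_period_def)
  fix q assume q: "q \<in> P i0" "q \<in> P i1"
  obtain A where A: "A \<subseteq> {..<k}" "joins_rows A i0 i1" "\<forall>r\<in>A. q \<in> P r \<inter> P (nxt r)"
    using joins_rows_common[OF i q] by blast
  have "0 < p q" using q(1) p_pos by (simp add: P_def)
  then have "B \<le> B * p q" by simp
  then show "near (B * p q) (int x) (int y)"
    using A(3) Bp_dvd_h_period[OF q(1)] Bp_dvd_h_period[OF q(2)] Bp_dvd_v_period
    by (intro near[OF A(1,2)]) auto
qed

text \<open>Corrected by small offsets \<open>\<delta>\<close>, the single edges of all rows agree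
  modulo \<open>B\<close>, and those of two rows also modulo every prime that these share. The
  Chinese remainder theorem then yields one virtual column for all rows.\<close>

lemma cordon_exists:
  assumes a: "a < a'" "in_ends a" "in_ends a'" and free: "free_column Z a" "free_column Z a'"
    and not: "\<not> joined Z a a'" and Z: "finite Z" "card Z < 2 * k"
  shows "\<exists>t. cordon Z t"
proof -
  have ne: "row_edges Z i \<noteq> {}" if i: "i < k" for i
  proof -
    obtain j where "j < a'" "h i j \<in> Z"
      using row_edge_if_not_joined[OF a free not i] by blast
    moreover have "j + 1 < T" using \<open>j < a'\<close> a(3) by (simp add: in_ends_def)
    ultimately show ?thesis by (intro row_edges_nonempty)
  qed
  define S where "S = {i. i < k \<and> card (row_edges Z i) = 1}"
  show ?thesis
  proof (cases "S = {}")
    case True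
    then have "cordon Z 0" using ne unfolding cordon_def S_def by auto
    then show ?thesis ..
  next
    case False
    then obtain i0 where i0: "i0 \<in> S" by blast
    have "\<forall>i\<in>S. \<exists>x. x + 1 < T \<and> row_edges Z i = {h i x}"
    proof
      fix i assume "i \<in> S"
      then have "card (row_edges Z i) = 1" by (simp add: S_def)
      then show "\<exists>x. x + 1 < T \<and> row_edges Z i = {h i x}" by (rule single_rowE) blast
    qed
    from bchoice[OF this] obtain x where "\<forall>i\<in>S. x i + 1 < T \<and> row_edges Z i = {h i (x i)}" ..
    then have x: "x i + 1 < T" "row_edges Z i = {h i (x i)}" if "i \<in> S" for i
      using that by simp_all
    have Sk: "i < k" if "i \<in> S" for i using that by (simp add: S_def)
    have near: "near B (int (x i)) (int (x i'))"
      "\<And>q. q \<in> P i \<Longrightarrow> q \<in> P i' \<Longrightarrow> near (B * p q) (int (x i)) (int (x i'))"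
      if i: "i \<in> S" "i' \<in> S" for i i'
      using near_rows[OF a free not Z Sk[OF i(1)] Sk[OF i(2)] x[OF i(1)] x[OF i(2)]] .
    have "\<forall>i\<in>S. \<exists>d. \<bar>d\<bar> \<le> int k \<and> int B dvd int (x i) - int (x i0) - d"
    proof
      fix i assume "i \<in> S"
      then show "\<exists>d. \<bar>d\<bar> \<le> int k \<and> int B dvd int (x i) - int (x i0) - d"
        using near(1)[of i i0] i0 unfolding near_def by simp
    qed
    from bchoice[OF this] obtain \<delta> where "\<forall>i\<in>S. \<bar>\<delta> i\<bar> \<le> int k \<and>
      int B dvd int (x i) - int (x i0) - \<delta> i" ..
    then have \<delta>: "\<bar>\<delta> i\<bar> \<le> int k" "int B dvd int (x i) - int (x i0) - \<delta> i" if "i \<in> S" for i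
      using that by simp_all
    define u where "u i = (int (x i) - int (x i0) - \<delta> i) div int B" for i
    have u: "int (x i) - \<delta> i = int (x i0) + int B * u i" if "i \<in> S" for i
      using \<delta>(2)[OF that] by (simp add: u_def)
    have u_cong: "int (p q) dvd u i - u i'" if i: "i \<in> S" "i' \<in> S" "q \<in> P i" "q \<in> P i'" for i i' q
    proof -
      obtain d where d: "\<bar>d\<bar> \<le> int k" "int (B * p q) dvd int (x i) - int (x i') - d"
        using near(2)[OF i] unfolding near_def by blast
      have eq: "int (x i) - int (x i') - d = int B * (u i - u i') + (\<delta> i - \<delta> i' - d)"
        using u[OF i(1)] u[OF i(2)] by (simp add: algebra_simps)
      have "int B dvd int B * (u i - u i') + (\<delta> i - \<delta> i' - d)"
        using d(2) unfolding eq[symmetric] by (metis dvd_mult_left of_nat_mult)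
      \<comment> \<open>The offset found modulo \<open>B * p q\<close> agrees modulo
        \<open>B\<close> with the difference of the chosen offsets; all are small, so they are
        equal.\<close>
      then have "int B dvd \<delta> i - \<delta> i' - d" by (simp add: dvd_add_right_iff)
      moreover have "\<bar>\<delta> i - \<delta> i' - d\<bar> < int B"
        using \<delta>(1)[OF i(1)] \<delta>(1)[OF i(2)] d(1) k_ge by (simp add: B_def)
      ultimately have "\<delta> i - \<delta> i' - d = 0" using dvd_small_eq[of "\<delta> i - \<delta> i' - d" 0] by simp
      then have "int (B * p q) dvd int B * (u i - u i')" using d(2) eq by simp
      then show ?thesis using B_ge by simp
    qed
    \<comment> \<open>By \<open>u_cong\<close> the residue modulo \<open>p q\<close> does not depend
      on the chosen row; a prime in no row of \<open>S\<close> gets an arbitrary residue.\<close>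
    define \<rho> where "\<rho> q = (SOME i. i \<in> S \<and> q \<in> P i)" for q
    have \<rho>: "\<rho> q \<in> S \<and> q \<in> P (\<rho> q)" if "i \<in> S" "q \<in> P i" for i q
      unfolding \<rho>_def by (rule someI[of _ i]) (use that in blast)
    have "\<exists>U. \<forall>q\<in>{..<k}. [U = nat (u (\<rho> q) mod int (p q))] (mod p q)"
      by (rule chinese_remainder_nat) (use p_coprime in auto)
    then obtain U where U: "\<And>q. q < k \<Longrightarrow> [U = nat (u (\<rho> q) mod int (p q))] (mod p q)" by auto
    have U_dvd: "int (p q) dvd int U - u i" if i: "i \<in> S" "q \<in> P i" for i q
    proof -
      have q: "q < k" using i(2) by (simp add: P_def)
      have "[int U = int (nat (u (\<rho> q) mod int (p q)))] (mod int (p q))"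
        using U[OF q] by (simp only: cong_int_iff)
      moreover have "int (nat (u (\<rho> q) mod int (p q))) = u (\<rho> q) mod int (p q)"
        using p_pos[OF q] by simp
      ultimately have "[int U = u (\<rho> q)] (mod int (p q))" by (simp add: unique_euclidean_semiring_class.cong_def)
      then have "int (p q) dvd int U - u (\<rho> q)" by (simp add: cong_iff_dvd_diff)
      moreover have "int (p q) dvd u (\<rho> q) - u i" using u_cong \<rho>[OF i] i by blast
      ultimately have "int (p q) dvd (int U - u (\<rho> q)) + (u (\<rho> q) - u i)" by (rule dvd_add)
      then show ?thesis by simp
    qed
    have "cordon Z (int (x i0) + int B * int U)"
      unfolding cordon_def
    proof (intro conjI allI impI ne)
      fix i y assume i: "i < k" "y + 1 < T" "row_edges Z i = {h i y}"
      then have iS: "i \<in> S" by (simp add: S_def)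
      have "h i y = h i (x i)" using x(2)[OF iS] i(3) by simp
      then have "y = x i \<or> [y = x i] (mod h_period i)" by (auto simp: h_eq_mid_cong mid_cong_def)
      then have "[int y = int (x i)] (mod int (h_period i))" by (auto simp: cong_int_iff)
      then have y: "int (h_period i) dvd int y - int (x i)" by (simp add: cong_iff_dvd_diff)
      have "int (\<Prod>q\<in>P i. p q) dvd int U - u i"
        using U_dvd[OF iS] by (intro prod_p_dvd P_subset) auto
      then have "int (h_period i) dvd int B * (int U - u i)" by (simp add: h_period_def)
      with y have "int (h_period i) dvd (int y - int (x i)) - int B * (int U - u i)" by (rule dvd_diff)
      also have "(int y - int (x i)) - int B * (int U - u i) = int y - (int (x i0) + int B * int U) - \<delta> i"
        using u[OF iS] by (simp add: algebra_simps)
      finally show "near (h_period i) (int y) (int (x i0) + int B * int U)"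
        unfolding near_def using \<delta>(1)[OF iS] by blast
    qed
    then show ?thesis ..
  qed
qed

text \<open>Columns of an end are not identified with others, so the single edges really lie between
  \<open>a\<close> and \<open>a'\<close>, less than \<open>E\<close> apart. At such distances
  nearness modulo \<open>B\<close> means a distance of at most \<open>k\<close>, and any of these
  edges gives an actual column as cordon.\<close>

lemma cordon_exists_in_end:
  assumes a: "a < a'" "in_ends a" "in_ends a'" "a' < E \<or> T - E \<le> a"
    and free: "free_column Z a" "free_column Z a'"
    and not: "\<not> joined Z a a'" and Z: "finite Z" "card Z < 2 * k"
  shows "\<exists>t. a \<le> t \<and> t < a' \<and> cordon Z (int t)"
proof -
  have ex: "\<exists>j. a \<le> j \<and> j < a' \<and> h i j \<in> Z" if i: "i < k" for i
    using row_edge_if_not_joined[OF a(1-3) free not i] .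
  have aT: "j + 1 < T" if "j < a'" for j using that a(3) by (simp add: in_ends_def)
  have ne: "row_edges Z i \<noteq> {}" if i: "i < k" for i
    using ex[OF i] aT row_edges_nonempty by blast
  have loc: "a \<le> x \<and> x < a'" if i: "i < k" "x + 1 < T" "row_edges Z i = {h i x}" for i x
  proof -
    obtain j where j: "a \<le> j" "j < a'" "h i j \<in> Z" using ex[OF i(1)] by blast
    then have "h i j = h i x" using i(3) aT by (auto simp: row_edges_def)
    then have "j = x" using j a by (auto simp: h_eq_mid_cong mid_cong_def)
    then show ?thesis using j by simp
  qed
  show ?thesis
  proof (cases "\<exists>i<k. card (row_edges Z i) = 1")
    case False
    then have "cordon Z (int a)" using ne unfolding cordon_def by auto
    then show ?thesis using a(1) by blast
  next
    case True
    then obtain i0 where i0: "i0 < k" "card (row_edges Z i0) = 1" by blast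
    obtain x0 where x0: "x0 + 1 < T" "row_edges Z i0 = {h i0 x0}" using i0(2) by (rule single_rowE)
    have "cordon Z (int x0)"
      unfolding cordon_def
    proof (intro conjI allI impI ne)
      fix i x assume i: "i < k" "x + 1 < T" "row_edges Z i = {h i x}"
      obtain d where d: "\<bar>d\<bar> \<le> int k" "int B dvd int x - int x0 - d"
        using near_rows(1)[OF a(1-3) free not Z i(1) i0(1) i(2,3) x0] unfolding near_def by blast
      have "a' < E \<or> a' - a < E" using a(3,4) T_ge by (auto simp: in_ends_def)
      then have "\<bar>int x - int x0\<bar> < int E"
        using loc[OF i] loc[OF i0(1) x0] by linarith
      then have "int x - int x0 = d"
        using d k_ge by (intro dvd_small_eq) (auto simp: B_def E_def)
      then show "near (h_period i) (int x) (int x0)"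
        unfolding near_def using d(1) by (intro exI[of _ d]) simp
    qed
    then show ?thesis using loc[OF i0(1) x0] by blast
  qed
qed

end

subsection \<open>The walk through a refutation\<close>

context compressed_cylinder
begin

definition end_column :: "bool \<Rightarrow> nat \<Rightarrow> bool" where
  "end_column b a \<longleftrightarrow> a < T \<and> (if b then T - E \<le> a else a < E)"

lemma end_column_in_ends: "end_column b a \<Longrightarrow> in_ends a"
  by (auto simp: end_column_def in_ends_def split: if_splits)

definition violates_only :: "(edge \<Rightarrow> bool) \<Rightarrow> nat \<Rightarrow> nat \<Rightarrow> bool" where
  "violates_only \<sigma> r a \<longleftrightarrow> r < k \<and>
     (\<forall>i<k. \<forall>j<T. (parity \<sigma> i j \<noteq> (i = 0 \<and> j = 0)) = (i = r \<and> j = a))"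

lemma violates_only_move:
  assumes "violates_only \<sigma> r a" "joined Z a a'" "r' < k"
  shows "\<exists>\<sigma>'. violates_only \<sigma>' r' a' \<and> (\<forall>e\<in>Z. \<sigma> e = \<sigma>' e)"
proof -
  have r: "r < k" using assms(1) by (simp add: violates_only_def)
  obtain F where F: "\<forall>e\<in>Z. \<not> F e" "moves F r a r' a'"
    using assms(2,3) r unfolding joined_def by blast
  have "violates_only (\<lambda>e. \<sigma> e \<noteq> F e) r' a'"
    unfolding violates_only_def
  proof (intro conjI allI impI assms(3))
    fix i j assume ij: "i < k" "j < T"
    have "parity F i j = ((i = r \<and> j = a) \<noteq> (i = r' \<and> j = a'))"
      using F(2) ij unfolding moves_def by blast
    moreover have "(parity \<sigma> i j \<noteq> (i = 0 \<and> j = 0)) = (i = r \<and> j = a)"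
      using assms(1) ij unfolding violates_only_def by blast
    ultimately show "(parity (\<lambda>e. \<sigma> e \<noteq> F e) i j \<noteq> (i = 0 \<and> j = 0)) = (i = r' \<and> j = a')"
      unfolding parity_xor[OF ij(1)] by argo
  qed
  then show ?thesis using F(1) by (intro exI[of _ "\<lambda>e. \<sigma> e \<noteq> F e"]) auto
qed

text \<open>Otherwise each of the \<open>2 * k\<close> uncompressed columns would contain its own
  edge of \<open>Y\<close>.\<close>

lemma free_end_column_exists:
  assumes "finite Y" "card Y < 2 * k"
  shows "\<exists>a. end_column b a \<and> free_column Y a"
proof (rule ccontr)
  assume none: "\<not> ?thesis"
  define W where "W = (if b then {T - E..<T} else {..<E})"
  have ET: "2 * E \<le> T" "0 < E" using T_ge k_ge by (auto simp: E_def)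
  have W: "end_column b a" if "a \<in> W" for a
    using that ET by (auto simp: W_def end_column_def split: if_splits)
  have cardW: "card W = 2 * k" using ET by (simp add: W_def E_def)
  have "\<forall>a\<in>W. \<exists>r. v r a \<in> Y"
    using none W unfolding free_column_def by blast
  from bchoice[OF this] obtain r where r: "\<forall>a\<in>W. v (r a) a \<in> Y" ..
  have "inj_on (\<lambda>a. v (r a) a) W"
    by (rule inj_onI) (use ET in \<open>auto simp: v_eq_mid_cong mid_cong_def W_def split: if_splits\<close>)
  then have "card W \<le> card Y"
    using r assms(1) by (intro card_inj_on_le[of "\<lambda>a. v (r a) a"]) auto
  then show False using assms(2) cardW by simp
qed

text \<open>As \<open>e\<close> runs through the representatives of \<open>t - w\<close>, this
  bounds from below the distance between \<open>t\<close> and the end on the cycle of length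
  \<open>B * Q\<close>.\<close>

definition far :: "bool \<Rightarrow> int \<Rightarrow> int \<Rightarrow> bool" where
  "far b t x \<longleftrightarrow> (\<forall>w e. end_column b w \<longrightarrow> int (B * Q) dvd t - int w - e \<longrightarrow> x \<le> \<bar>e\<bar>)"

lemma far_mono: "far b t x \<Longrightarrow> y \<le> x \<Longrightarrow> far b t y"
  unfolding far_def by (meson order_trans)

lemma far_step:
  assumes "far b t x" "int (B * Q) dvd t' - t - d" "\<bar>d\<bar> \<le> 2 * int k"
  shows "far b t' (x - 2 * int k)"
  unfolding far_def
proof (intro allI impI)
  fix w e assume w: "end_column b w" "int (B * Q) dvd t' - int w - e"
  have "int (B * Q) dvd (t' - int w - e) - (t' - t - d)" using w(2) assms(2) by (rule dvd_diff)
  also have "(t' - int w - e) - (t' - t - d) = t - int w - (e - d)" by simp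
  finally have "x \<le> \<bar>e - d\<bar>" using assms(1) w(1) unfolding far_def by blast
  then show "x - 2 * int k \<le> \<bar>e\<bar>" using assms(3) by linarith
qed

text \<open>The two ends are antipodal on the cycle of length \<open>B * Q\<close>.\<close>

lemma far_from_some_end:
  assumes "2 * x \<le> int T - 2 * int E"
  shows "\<exists>b. far b t x"
proof (rule ccontr)
  assume none: "\<not> ?thesis"
  obtain w e where w: "end_column True w" "int (B * Q) dvd t - int w - e" "\<bar>e\<bar> < x"
    using none unfolding far_def by (metis not_le)
  obtain w' e' where w': "end_column False w'" "int (B * Q) dvd t - int w' - e'" "\<bar>e'\<bar> < x"
    using none unfolding far_def by (metis not_le)
  have "int (B * Q) dvd (t - int w' - e') - (t - int w - e)" using w'(2) w(2) by (rule dvd_diff)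
  then have dvd: "int (B * Q) dvd int w - int w' + (e - e')" by (simp add: algebra_simps)
  have ww: "int T - int E \<le> int w" "int w < int T" "int w' < int E"
    using w(1) w'(1) by (auto simp: end_column_def)
  have "2 * T \<le> B * Q" by (simp add: T_def)
  then have BQ: "2 * int T \<le> int (B * Q)" by linarith
  have "0 < int w - int w' + (e - e')" using ww w(3) w'(3) assms by linarith
  moreover have "int w - int w' + (e - e') < int (B * Q)" using ww w(3) w'(3) assms BQ by linarith
  ultimately show False using dvd zdvd_not_zless by blast
qed

text \<open>If they were not joined, some column of this very end would be a cordon, at distance
  0.\<close>

lemma joined_same_end:
  assumes a: "end_column b a" "end_column b a'" and free: "free_column Z a" "free_column Z a'"
    and Z: "finite Z" "card Z < 2 * k" and far: "\<And>t. cordon Z t \<Longrightarrow> far b t 1"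
  shows "joined Z a a'"
proof -
  have lt: "joined Z a a'" if l: "a < a'" and a: "end_column b a" "end_column b a'"
    and free: "free_column Z a" "free_column Z a'" for a a'
  proof (rule ccontr)
    assume not: "\<not> joined Z a a'"
    have "a' < E \<or> T - E \<le> a" using a by (auto simp: end_column_def split: if_splits)
    from cordon_exists_in_end[OF l end_column_in_ends[OF a(1)] end_column_in_ends[OF a(2)] this free not Z]
    obtain t where t: "a \<le> t" "t < a'" "cordon Z (int t)" by blast
    have "end_column b t" using a t by (auto simp: end_column_def split: if_splits)
    then have "1 \<le> \<bar>0::int\<bar>" using far[OF t(3)] unfolding far_def by (metis diff_self diff_zero dvd_0_right)
    then show False by simp
  qed
  consider "a < a'" | "a = a'" | "a' < a" by linarith
  then show ?thesis
  proof cases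
    case 2
    then show ?thesis using joined_refl end_column_in_ends a free by blast
  qed (use lt a free joined_sym in blast)+
qed

lemma joined_if_no_cordon:
  assumes a: "end_column b a" "end_column b' a'" and free: "free_column Z a" "free_column Z a'"
    and Z: "finite Z" "card Z < 2 * k" and none: "\<And>t. \<not> cordon Z t"
  shows "joined Z a a'"
proof -
  note ends = end_column_in_ends[OF a(1)] end_column_in_ends[OF a(2)]
  consider "a < a'" | "a = a'" | "a' < a" by linarith
  then show ?thesis
  proof cases
    case 1
    then show ?thesis using cordon_exists[OF 1 ends free _ Z] none by blast
  next
    case 2
    then show ?thesis using joined_refl ends free by blast
  next
    case 3
    then show ?thesis using cordon_exists[OF 3 ends(2,1) free(2,1) _ Z] none joined_sym by blast
  qed
qed

text \<open>The walk goes from the empty clause to premises that remain falsified. Its invariant is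
  that the only violated constraint lies in a free column of an end far from all cordons; each step
  costs \<open>2 * k\<close> of this distance.\<close>

lemma depth_lower_bound:
  assumes R: "is_refutation (lift_formula m G) R" and m: "1 \<le> m"
    and size: "real (refutation_size R) \<le> ((real m + 1) / 2) ^ (k + c)"
  shows "Q - 3 \<le> depth R"
proof -
  define cls where "cls i = fst (R ! i)" for i
  have lines: "is_clause (cls i)" "case snd (R ! i) of
           Axiom \<Rightarrow> cls i \<in> lift_formula m G
         | Resolvent a b \<Rightarrow> a < i \<and> b < i \<and> resolves_to (cls a) (cls b) (cls i)"
    if "i < length R" for i
    using R that unfolding is_refutation_def cls_def by blast+
  have last: "0 < length R" "cls (length R - 1) = {}"
    using R by (auto simp: is_refutation_def cls_def last_conv_nth)
  have set: "C \<in> set (map fst R) \<longleftrightarrow> (\<exists>i<length R. C = cls i)" for C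
    unfolding in_set_conv_nth cls_def by auto
  have wpos: "1 \<le> k + c" using k_ge by simp
  have clauses: "is_clause C" if "C \<in> set (map fst R)" for C
    using that lines(1) unfolding set by blast
  have empty: "{} \<in> set (map fst R)"
    unfolding set by (intro exI[of _ "length R - 1"]) (use last in simp)
  have short: "real (length (map fst R)) \<le> ((real m + 1) / 2) ^ (k + c)"
    using size by (simp add: refutation_size_def)
  have "\<exists>\<iota> \<beta>. (\<forall>x. \<iota> x < m) \<and> (\<forall>C\<in>set (map fst R). \<forall>\<sigma>.
      falsifies (gadget_assignment \<iota> \<beta> \<sigma>) C \<longrightarrow> card (live \<iota> C) < k + c)"
    by (rule restriction_exists[OF m wpos clauses empty short]) blast+
  then obtain \<iota> \<beta> where \<iota>: "\<And>x. \<iota> x < m" and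
    small: "\<And>C \<sigma>. C \<in> set (map fst R) \<Longrightarrow> falsifies (gadget_assignment \<iota> \<beta> \<sigma>) C \<Longrightarrow> card (live \<iota> C) < k + c"
    by blast
  define Z where "Z i = live \<iota> (cls i)" for i
  have finZ: "finite (Z i)" if "i < length R" for i
    using lines(1)[OF that] finite_live by (auto simp: Z_def is_clause_def)
  define cons where "cons b i \<longleftrightarrow> (\<exists>\<sigma> r a. end_column b a \<and> free_column (Z i) a \<and> violates_only \<sigma> r a \<and>
    falsifies (gadget_assignment \<iota> \<beta> \<sigma>) (cls i))" for b i
  have cardZ: "card (Z i) < k + c" if "i < length R" "cons b i" for i b
    using small set that unfolding cons_def Z_def by blast
  \<comment> \<open>Half the distance between the ends, which a cordon keeps from at least one of
    them.\<close>
  define X where "X = (int T - 2 * int E) div 2"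
  have X: "2 * X \<le> int T - 2 * int E" unfolding X_def by linarith
  \<comment> \<open>A falsified axiom would come from the one violated constraint, so a vertical
    edge of column \<open>a\<close> would be live although the column is free.\<close>
  have not_axiom: "snd (R ! i) \<noteq> Axiom" if i: "i < length R" and co: "cons b i" for i b
  proof
    assume "snd (R ! i) = Axiom"
    then have ax: "cls i \<in> lift_formula m G" using lines(2)[OF i] by simp
    obtain \<sigma> r a where s: "free_column (Z i) a" "violates_only \<sigma> r a"
      "falsifies (gadget_assignment \<iota> \<beta> \<sigma>) (cls i)" using co unfolding cons_def by blast
    obtain C where C: "C \<in> G" "falsifies \<sigma> C" "var ` C \<subseteq> Z i"
      using falsifies_lift_formula[OF ax s(3) \<iota>] unfolding Z_def by blast
    obtain i' j where ij: "i' < k" "j < T" "var ` C = star i' j" "parity \<sigma> i' j \<noteq> (i' = 0 \<and> j = 0)"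
      using falsifies_G[OF C(1,2)] by blast
    then have "j = a" using s(2) unfolding violates_only_def by blast
    moreover have "v i' j \<in> Z i" using C(3) ij(3) by (auto simp: star_def)
    ultimately show False using s(1) ij(1) unfolding free_column_def by blast
  qed
  have walk: "\<exists>j. (j, i) \<in> dag_edges R ^^ l"
    if "i < length R" "cons b i" "\<And>t. cordon (Z i) t \<Longrightarrow> far b t x" "x \<le> X" "2 * int k * int l < x" for i b x l
    using that
  proof (induction l arbitrary: i b x)
    case 0
    show ?case by (intro exI[of _ i]) simp
  next
    case (Suc l)
    note i = Suc.prems(1)
    have x1: "2 * int k * int l < x - 2 * int k" using Suc.prems(5) by (simp add: algebra_simps)
    have "0 \<le> 2 * int k * int l" by simp
    then have x0: "2 * int k < x" using x1 by linarith
    obtain p q where pq: "snd (R ! i) = Resolvent p q"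
      using not_axiom[OF i Suc.prems(2)] by (cases "snd (R ! i)") auto
    then have pq_less: "p < i" "q < i" and res: "resolves_to (cls p) (cls q) (cls i)"
      using lines(2)[OF i] by auto
    obtain y where y: "Z p \<subseteq> insert y (Z i)" "Z q \<subseteq> insert y (Z i)"
      "\<And>\<tau>. falsifies \<tau> (cls i) \<Longrightarrow> falsifies \<tau> (cls p) \<or> falsifies \<tau> (cls q)"
      using falsifies_resolvent[OF res, of \<iota>] unfolding Z_def by blast
    \<comment> \<open>The free column is chosen with respect to \<open>Y\<close>, which contains the
      live edges of both premises, before it is known which of them stays falsified.\<close>
    define Y where "Y = insert y (Z i)"
    have Y: "finite Y" "card Y \<le> k + c" "Z i \<subseteq> Y"
      using finZ[OF i] cardZ[OF i Suc.prems(2)] by (auto simp: Y_def card_insert_if)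
    have Zi: "finite (Z i)" "card (Z i) < 2 * k" using finZ[OF i] cardZ[OF i Suc.prems(2)] c_less by auto
    \<comment> \<open>If \<open>Z i\<close> has a cordon, the violation stays in its end and any
      cordon of \<open>Y\<close> is a small shift of that one. Otherwise the ends are joined, and
      the violation can go to whichever end is far from the cordons of \<open>Y\<close>.\<close>
    have "\<exists>b'. cons b' i \<and> (\<forall>t. cordon (Z i) t \<longrightarrow> far b' t 1) \<and> (\<forall>t. cordon Y t \<longrightarrow> far b' t (x - 2 * int k))"
    proof (cases "\<exists>t. cordon (Z i) t")
      case True
      then obtain t where t: "cordon (Z i) t" by blast
      have "far b t' (x - 2 * int k)" if t': "cordon Y t'" for t'
      proof -
        obtain d where "\<bar>d\<bar> \<le> 2 * int k" "int (B * Q) dvd t' - t - d"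
          using cordon_unique[OF Y(1,2) t' cordon_mono[OF t Y(3)]] by blast
        then show ?thesis using far_step Suc.prems(3)[OF t] by blast
      qed
      moreover have "far b t' 1" if "cordon (Z i) t'" for t'
        using far_mono[OF Suc.prems(3)[OF that]] x0 k_ge by simp
      ultimately show ?thesis using Suc.prems(2) by blast
    next
      case False
      have "\<exists>b'. \<forall>t. cordon Y t \<longrightarrow> far b' t (x - 2 * int k)"
      proof (cases "\<exists>t. cordon Y t")
        case True
        then obtain t where t: "cordon Y t" by blast
        obtain b' where b': "far b' t X" using far_from_some_end[OF X] by blast
        have "far b' t' (x - 2 * int k)" if t': "cordon Y t'" for t'
        proof -
          obtain d where "\<bar>d\<bar> \<le> 2 * int k" "int (B * Q) dvd t' - t - d"
            using cordon_unique[OF Y(1,2) t' t] by blast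
          then have "far b' t' (X - 2 * int k)" using far_step[OF b'] by blast
          then show ?thesis by (rule far_mono) (use Suc.prems(4) in simp)
        qed
        then show ?thesis by blast
      qed blast
      then obtain b' where b': "\<forall>t. cordon Y t \<longrightarrow> far b' t (x - 2 * int k)" by blast
      obtain \<sigma> r a where s: "end_column b a" "free_column (Z i) a" "violates_only \<sigma> r a"
        "falsifies (gadget_assignment \<iota> \<beta> \<sigma>) (cls i)" using Suc.prems(2) unfolding cons_def by blast
      obtain a' where a': "end_column b' a'" "free_column (Z i) a'"
        using free_end_column_exists[OF Zi] by blast
      have "joined (Z i) a a'" using joined_if_no_cordon[OF s(1) a'(1) s(2) a'(2) Zi] False by blast
      moreover have "r < k" using s(3) by (simp add: violates_only_def)
      ultimately obtain \<sigma>' where \<sigma>': "violates_only \<sigma>' r a'" "\<forall>e\<in>Z i. \<sigma> e = \<sigma>' e"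
        using violates_only_move[OF s(3)] by blast
      have "falsifies (gadget_assignment \<iota> \<beta> \<sigma>') (cls i)"
        by (rule falsifies_cong_live[OF s(4)]) (use \<sigma>'(2) in \<open>simp add: Z_def\<close>)
      then have "cons b' i" using a' \<sigma>'(1) unfolding cons_def by blast
      then show ?thesis using b' False by blast
    qed
    then obtain b' where b': "cons b' i" "\<And>t. cordon (Z i) t \<Longrightarrow> far b' t 1"
      "\<And>t. cordon Y t \<Longrightarrow> far b' t (x - 2 * int k)" by blast
    obtain \<sigma> r a where s: "end_column b' a" "free_column (Z i) a" "violates_only \<sigma> r a"
      "falsifies (gadget_assignment \<iota> \<beta> \<sigma>) (cls i)" using b'(1) unfolding cons_def by blast
    obtain a' where a': "end_column b' a'" "free_column Y a'"
      using free_end_column_exists[OF Y(1), of b'] Y(2) c_less by auto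
    have a'Z: "free_column (Z i) a'" using a'(2) Y(3) unfolding free_column_def by blast
    have "joined (Z i) a a'" using joined_same_end[OF s(1) a'(1) s(2) a'Z Zi b'(2)] .
    moreover have "r < k" using s(3) by (simp add: violates_only_def)
    ultimately obtain \<sigma>' where \<sigma>': "violates_only \<sigma>' r a'" "\<forall>e\<in>Z i. \<sigma> e = \<sigma>' e"
      using violates_only_move[OF s(3)] by blast
    have "falsifies (gadget_assignment \<iota> \<beta> \<sigma>') (cls i)"
      by (rule falsifies_cong_live[OF s(4)]) (use \<sigma>'(2) in \<open>simp add: Z_def\<close>)
    then obtain u where u: "u = p \<or> u = q" "falsifies (gadget_assignment \<iota> \<beta> \<sigma>') (cls u)"
      using y(3) by blast
    have uY: "Z u \<subseteq> Y" using u(1) y(1,2) by (auto simp: Y_def)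
    have uR: "u < length R" using u(1) pq_less i by auto
    have "free_column (Z u) a'" using a'(2) uY unfolding free_column_def by blast
    then have "cons b' u" using a'(1) \<sigma>'(1) u(2) unfolding cons_def by blast
    moreover have "far b' t (x - 2 * int k)" if "cordon (Z u) t" for t
      using b'(3) cordon_mono[OF that uY] .
    ultimately obtain j where j: "(j, u) \<in> dag_edges R ^^ l"
      using Suc.IH[OF uR, of b' "x - 2 * int k"] Suc.prems(4) x1 by auto
    have "(u, i) \<in> dag_edges R" using u(1) pq i by (auto simp: dag_edges_def)
    then show ?case using relpow_Suc_I[OF j] by blast
  qed
  have root: "length R - 1 < length R" using last(1) by simp
  have Z0: "Z (length R - 1) = {}" using last(2) by (simp add: Z_def live_def)
  have "violates_only (\<lambda>_. False) 0 0" using k_ge by (auto simp: violates_only_def parity_def)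
  moreover have "end_column False 0" using T_ge k_ge by (simp add: end_column_def E_def)
  ultimately have "cons False (length R - 1)"
    unfolding cons_def Z0 last(2) by (auto simp: free_column_def falsifies_def)
  moreover have "\<not> cordon (Z (length R - 1)) t" for t
    using k_ge unfolding Z0 cordon_def row_edges_def by (auto intro: exI[of _ 0])
  \<comment> \<open>Rounding in \<open>Q div 2\<close> and the width of the ends cost one step each,
    the strict inequality a third.\<close>
  moreover have "2 * int k * int (Q - 3) < X"
  proof (cases "3 \<le> Q")
    case True
    have "int Q \<le> 2 * int (Q div 2) + 1" by linarith
    then have "4 * int k * (int Q - 3) \<le> 4 * int k * (2 * int (Q div 2) - 2)"
      by (intro mult_left_mono) auto
    moreover have "int T = 8 * int k * int (Q div 2)" by (simp add: T_def B_def)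
    ultimately have "4 * int k * (int Q - 3) + 8 * int k \<le> int T" by (simp add: algebra_simps)
    then have "2 * (2 * int k * int (Q - 3)) + 2 \<le> int T - 2 * int E"
      using True k_ge by (simp add: E_def of_nat_diff algebra_simps)
    then show ?thesis unfolding X_def by linarith
  next
    case False
    then show ?thesis using T_ge k_ge by (simp add: X_def E_def)
  qed
  ultimately obtain j where "(j, length R - 1) \<in> dag_edges R ^^ (Q - 3)"
    using walk[OF root, of False X "Q - 3"] by blast
  then show ?thesis by (rule depth_ge[OF R])
qed

end

section \<open>Primes between \<open>n\<close> and \<open>2 n\<close>\<close>

lemma prod_primes_dvd:
  fixes N :: nat
  assumes "finite S" "\<And>p. p \<in> S \<Longrightarrow> prime p \<and> p dvd N"
  shows "\<Prod>S dvd N"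
  using assms
proof (induction S rule: finite_induct)
  case (insert p S)
  have "coprime p (\<Prod>S)"
    using insert by (intro prod_coprime_right) (auto intro: primes_coprime)
  then show ?case
    using insert by (simp add: divides_mult)
qed simp

lemma prod_subset_le:
  fixes f :: "'a \<Rightarrow> nat"
  assumes "finite B" "A \<subseteq> B" "\<And>b. b \<in> B \<Longrightarrow> 0 < f b"
  shows "prod f A \<le> prod f B"
  using prod_dvd_prod_subset[OF assms(1,2), of f] prod_pos[of B f] assms(3) by (intro dvd_imp_le) auto

lemma choose_odd_middle_le: "(2 * m + 1 choose m) \<le> 4 ^ m"
proof -
  have "2 * (2 * m + 1 choose m) = (2 * m + 1 choose m) + (2 * m + 1 choose (m + 1))"
    using binomial_symmetric[of m "2 * m + 1"] by simp
  also have "\<dots> = (\<Sum>i\<in>{m, m + 1}. 2 * m + 1 choose i)" by simp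
  also have "\<dots> \<le> (\<Sum>i\<le>2 * m + 1. 2 * m + 1 choose i)" by (intro sum_mono2) auto
  also have "\<dots> = 2 ^ (2 * m + 1)" by (rule choose_row_sum)
  also have "\<dots> = 2 * 4 ^ m" by (simp add: power_mult)
  finally show ?thesis by simp
qed

text \<open>These primes divide the numerator of the binomial coefficient but neither factorial in
  its denominator.\<close>

lemma prod_primes_upper_half_le: "\<Prod>{p. prime p \<and> m + 1 < p \<and> p \<le> 2 * m + 1} \<le> (4::nat) ^ m"
proof -
  have "p dvd (2 * m + 1 choose m)" if p: "prime p" "m + 1 < p" "p \<le> 2 * m + 1" for p
  proof -
    have "fact m * fact (m + 1) * (2 * m + 1 choose m) = fact (2 * m + 1)"
      using binomial_fact_lemma[of m "2 * m + 1"] by simp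
    moreover have "p dvd fact (2 * m + 1)" "\<not> p dvd fact m" "\<not> p dvd fact (m + 1)"
      using p by (auto simp: prime_dvd_fact_iff simp del: fact_Suc)
    ultimately show ?thesis using p(1) by (metis prime_dvd_mult_iff)
  qed
  then have "\<Prod>{p. prime p \<and> m + 1 < p \<and> p \<le> 2 * m + 1} dvd (2 * m + 1 choose m)"
    by (intro prod_primes_dvd) auto
  then have "\<Prod>{p. prime p \<and> m + 1 < p \<and> p \<le> 2 * m + 1} \<le> (2 * m + 1 choose m)"
    by (rule dvd_imp_le) simp
  then show ?thesis using choose_odd_middle_le by (rule order_trans)
qed

text \<open>Erdos' induction: an even \<open>n > 2\<close> is not prime, and for
  \<open>n = 2 * m + 1\<close> the primes above \<open>m + 1\<close> are covered by a binomial
  coefficient.\<close>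

lemma primorial_le: "\<Prod>{p. prime p \<and> p \<le> n} \<le> (4::nat) ^ n"
proof (induction n rule: less_induct)
  case (less n)
  consider "n \<le> 1" | "n = 2" | "2 < n" "even n" | m where "n = 2 * m + 1" "0 < m"
  proof (cases "even n")
    case True
    then show thesis using that(1-3) by linarith
  next
    case False
    then obtain m where "n = 2 * m + 1" by (elim oddE)
    then show thesis using that(1) that(4)[of m] by (cases "m = 0") auto
  qed
  then show ?case
  proof cases
    case 1
    then have empty: "{p. prime p \<and> p \<le> n} = {}" by (auto dest: prime_gt_1_nat)
    show ?thesis unfolding empty by simp
  next
    case 2
    have two: "{p::nat. prime p \<and> p \<le> 2} = {2}" by (auto dest: prime_ge_2_nat)
    show ?thesis unfolding 2 two by simp
  next
    case 3
    have "\<not> prime n" using 3 prime_odd_nat by blast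
    then have "prime p \<and> p \<le> n \<longleftrightarrow> prime p \<and> p \<le> n - 1" for p
      by (cases "p = n") auto
    then have "\<Prod>{p. prime p \<and> p \<le> n} = \<Prod>{p. prime p \<and> p \<le> n - 1}" by simp
    also have "\<dots> \<le> 4 ^ (n - 1)" using less.IH[of "n - 1"] 3 by simp
    also have "\<dots> \<le> (4::nat) ^ n" by (intro power_increasing) auto
    finally show ?thesis .
  next
    case 4
    let ?L = "{p. prime p \<and> p \<le> m + 1}" and ?U = "{p. prime p \<and> m + 1 < p \<and> p \<le> 2 * m + 1}"
    have union: "{p. prime p \<and> p \<le> n} = ?L \<union> ?U" using 4 by auto
    have "\<Prod>{p. prime p \<and> p \<le> n} = \<Prod>(?L \<union> ?U)" unfolding union ..
    also have "\<Prod>(?L \<union> ?U) = \<Prod>?L * \<Prod>?U" by (intro prod.union_disjoint) auto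
    also have "\<dots> \<le> 4 ^ (m + 1) * 4 ^ m"
      using less.IH[of "m + 1"] 4 prod_primes_upper_half_le[of m] by (intro mult_mono) auto
    also have "\<dots> = 4 ^ n" using 4 by (simp add: power_add[symmetric] mult_2)
    finally show ?thesis .
  qed
qed

section \<open>Legendre's formula and the prime factors of the central binomial coefficient\<close>

lemma multiplicity_fact:
  fixes p :: nat
  assumes p: "prime p" and n: "n < p ^ Suc K"
  shows "multiplicity p (fact n :: nat) = (\<Sum>i=1..K. n div p ^ i)"
  using n
proof (induction n)
  case (Suc n)
  have p1: "1 < p" using p by (rule prime_gt_1_nat)
  have dvd: "p ^ i dvd Suc n \<longleftrightarrow> i \<le> multiplicity p (Suc n)" for i
    using p1 by (intro power_dvd_iff_le_multiplicity) auto
  have le: "multiplicity p (Suc n) \<le> K"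
  proof (rule ccontr)
    assume "\<not> ?thesis"
    then have "p ^ Suc K dvd Suc n" unfolding dvd by simp
    then have "p ^ Suc K \<le> Suc n" by (rule dvd_imp_le) simp
    then show False using Suc.prems by linarith
  qed
  have "{i \<in> {1..K}. p ^ i dvd Suc n} = {1..multiplicity p (Suc n)}" unfolding dvd using le by auto
  then have "multiplicity p (Suc n) = card {i \<in> {1..K}. p ^ i dvd Suc n}" by simp
  also have "\<dots> = (\<Sum>i=1..K. if p ^ i dvd Suc n then 1 else 0)"
    by (subst sum.inter_filter[symmetric]) auto
  finally have m: "multiplicity p (Suc n) = (\<Sum>i=1..K. if p ^ i dvd Suc n then 1 else 0)" .
  have "multiplicity p (fact (Suc n) :: nat) = multiplicity p (Suc n) + multiplicity p (fact n :: nat)"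
    unfolding fact_Suc of_nat_id using p by (intro prime_elem_multiplicity_mult_distrib) auto
  also have "\<dots> = (\<Sum>i=1..K. (if p ^ i dvd Suc n then 1 else 0) + n div p ^ i)"
    using Suc m by (simp add: sum.distrib)
  also have "\<dots> = (\<Sum>i=1..K. Suc n div p ^ i)"
    using p1 by (intro sum.cong) (auto simp: div_Suc dvd_eq_mod_eq_0)
  finally show ?case .
qed simp

text \<open>Each term in the difference of the Legendre sums is 0 or 1.\<close>

lemma multiplicity_central_binomial:
  fixes p :: nat
  assumes p: "prime p" and n: "2 * n < p ^ Suc K"
  shows "multiplicity p (2 * n choose n) = (\<Sum>i=1..K. 2 * n div p ^ i - 2 * (n div p ^ i))"
    and "multiplicity p (2 * n choose n) \<le> K"
proof -
  have le: "2 * (n div q) \<le> 2 * n div q" for q :: nat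
  proof (cases "q = 0")
    case False
    have "2 * (n div q) * q \<le> 2 * n" using div_times_less_eq_dividend[of n q] by linarith
    then show ?thesis using False by (simp add: less_eq_div_iff_mult_less_eq)
  qed simp
  have le1: "2 * n div q - 2 * (n div q) \<le> 1" for q :: nat
  proof (cases "q = 0")
    case False
    have "2 * n < q * (2 * (n div q) + 2)"
      using dividend_less_times_div[of q n] False by (simp add: algebra_simps)
    then have "2 * n div q < 2 * (n div q) + 2" using False by (simp add: div_less_iff_less_mult mult.commute)
    then show ?thesis by simp
  qed simp
  have "fact n * fact n * (2 * n choose n) = (fact (2 * n) :: nat)"
    using binomial_fact_lemma[of n "2 * n"] by simp
  then have "multiplicity p (fact (2 * n) :: nat) = multiplicity p (fact n * fact n * (2 * n choose n) :: nat)"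
    by simp
  also have "\<dots> = multiplicity p (fact n :: nat) + multiplicity p (fact n :: nat) + multiplicity p (2 * n choose n)"
    using p by (simp add: prime_elem_multiplicity_mult_distrib)
  finally have "multiplicity p (2 * n choose n) = (\<Sum>i=1..K. 2 * n div p ^ i) - (\<Sum>i=1..K. 2 * (n div p ^ i))"
    using multiplicity_fact[OF p n] multiplicity_fact[of p n K] p n by (simp add: sum_distrib_left[symmetric])
  also have "\<dots> = (\<Sum>i=1..K. 2 * n div p ^ i - 2 * (n div p ^ i))"
    by (rule sum_subtractf_nat[symmetric]) (rule le)
  finally show *: "multiplicity p (2 * n choose n) = (\<Sum>i=1..K. 2 * n div p ^ i - 2 * (n div p ^ i))" .
  also have "\<dots> \<le> (\<Sum>i=1..K. 1)" by (intro sum_mono le1)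
  finally show "multiplicity p (2 * n choose n) \<le> K" by simp
qed

lemma prime_power_central_binomial_le:
  fixes p :: nat
  assumes p: "prime p" and n: "1 \<le> n"
  shows "p ^ multiplicity p (2 * n choose n) \<le> 2 * n"
proof -
  have p1: "1 < p" using p by (rule prime_gt_1_nat)
  obtain K where K: "p ^ K \<le> 2 * n" "2 * n < p ^ (K + 1)"
    using ex_power_ivl1[of p "2 * n"] p1 n by auto
  have "p ^ multiplicity p (2 * n choose n) \<le> p ^ K"
    using multiplicity_central_binomial(2)[OF p, of n K] K(2) p1 by (intro power_increasing) auto
  then show ?thesis using K(1) by simp
qed

lemma multiplicity_central_binomial_large:
  fixes p :: nat
  assumes "prime p" "2 * n < p ^ 2"
  shows "multiplicity p (2 * n choose n) = 2 * n div p - 2 * (n div p)"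
  using multiplicity_central_binomial(1)[of p n 1] assms by (simp add: power2_eq_square)

text \<open>Only the first Legendre term remains, and it vanishes: the quotients are 2 and 1 in the
  first gap, 6 and 3 in the second.\<close>

lemma prime_gap_multiplicity_zero:
  fixes p :: nat
  assumes "prime p" "2 * n < p ^ 2" "p \<le> n" "2 * n < 3 * p \<or> 3 * p \<le> n \<and> 2 * n < 7 * p"
  shows "multiplicity p (2 * n choose n) = 0"
proof -
  from assms(4) have "2 * n div p - 2 * (n div p) = 0"
  proof
    assume "2 * n < 3 * p"
    then have "2 * n div p = 2" "n div p = 1" using assms(3) by (auto intro!: div_nat_eqI)
    then show ?thesis by simp
  next
    assume "3 * p \<le> n \<and> 2 * n < 7 * p"
    then have "2 * n div p = 6" "n div p = 3" by (auto intro!: div_nat_eqI)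
    then show ?thesis by simp
  qed
  then show ?thesis using multiplicity_central_binomial_large[OF assms(1,2)] by simp
qed

text \<open>The factorization from Erdos' proof of Bertrand's postulate, with a second gap. The gap
  from 2n/3 to n alone would leave \<open>ln 4 / 3\<close>, about 0.46, short of the 1/2 needed for
  \<open>n / (2 * ln n)\<close> primes. The gap from 2n/7 to n/3 lowers the exponent of 4 to 13n/21,
  which leaves \<open>8 / 21 * ln 4\<close>, about 0.53.\<close>

lemma central_binomial_upper_bound:
  assumes n: "1 \<le> n"
  shows "(2 * n choose n) \<le> (2 * n) ^ (card {p. prime p \<and> p ^ 2 \<le> 2 * n} + card {p. prime p \<and> n < p \<and> p \<le> 2 * n} + 1)
      * 4 ^ (2 * n div 7 + n div 3)"
proof -
  let ?N = "2 * n choose n" and ?m = "n div 3"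
  let ?v = "\<lambda>p. p ^ multiplicity p ?N"
  define S1 where "S1 = {p. prime p \<and> p ^ 2 \<le> 2 * n}"
  define S2 where "S2 = {p. prime p \<and> 2 * n < p ^ 2 \<and> 7 * p \<le> 2 * n}"
  define S3 where "S3 = {p. prime p \<and> 2 * n < p ^ 2 \<and> 2 * n < 7 * p \<and> p \<le> n \<and> (3 * p \<le> n \<or> 2 * n < 3 * p)}"
  define S4 where "S4 = {p. prime p \<and> 2 * n < p ^ 2 \<and> 2 * n < 7 * p \<and> n < 3 * p \<and> 3 * p \<le> 2 * n}"
  define S5 where "S5 = {p. prime p \<and> 2 * n < p ^ 2 \<and> n < p \<and> p \<le> 2 * n}"
  have le2n: "p \<le> 2 * n" if "p ^ 2 \<le> 2 * n" for p :: nat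
    by (rule order_trans[OF le_square[of p]]) (use that in \<open>simp add: power2_eq_square\<close>)
  have fin: "finite S1" "finite S2" "finite S3" "finite S4" "finite S5"
    by (rule finite_subset[of _ "{..2 * n}"]; force simp: S1_def S2_def S3_def S4_def S5_def dest: le2n)+
  have N: "?N = (\<Prod>p\<in>prime_factors ?N. ?v p)"
    using prime_factorization_nat[of ?N] by simp
  have pf: "prime_factors ?N \<subseteq> S1 \<union> S2 \<union> S3 \<union> S4 \<union> S5"
  proof
    fix p assume "p \<in> prime_factors ?N"
    then have p: "prime p" "p dvd ?N" by auto
    have "?N dvd fact (2 * n)" using binomial_fact_lemma[of n "2 * n"] by (metis dvd_triv_right le_add1 mult_2)
    then have "p dvd fact (2 * n)" using p(2) dvd_trans by blast
    then have "p \<le> 2 * n" using p(1) prime_dvd_fact_iff by blast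
    then show "p \<in> S1 \<union> S2 \<union> S3 \<union> S4 \<union> S5" using p(1)
      unfolding S1_def S2_def S3_def S4_def S5_def by auto
  qed
  note N
  also have "(\<Prod>p\<in>prime_factors ?N. ?v p) \<le> (\<Prod>p\<in>S1 \<union> S2 \<union> S3 \<union> S4 \<union> S5. ?v p)"
    by (rule prod_subset_le) (use fin pf in \<open>auto simp: S1_def S2_def S3_def S4_def S5_def dest: prime_gt_0_nat\<close>)
  also have "\<dots> = (\<Prod>p\<in>S1. ?v p) * (\<Prod>p\<in>S2. ?v p) * (\<Prod>p\<in>S3. ?v p) * (\<Prod>p\<in>S4. ?v p) * (\<Prod>p\<in>S5. ?v p)"
    using fin by (subst prod.union_disjoint; (subst prod.union_disjoint; (subst prod.union_disjoint; (subst prod.union_disjoint)?)?)?)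
      (auto simp: S1_def S2_def S3_def S4_def S5_def)
  also have "\<dots> \<le> (2 * n) ^ card S1 * 4 ^ (2 * n div 7) * 1 * (2 * n * 4 ^ ?m) * (2 * n) ^ card S5"
  proof (intro mult_mono)
    show "(\<Prod>p\<in>S1. ?v p) \<le> (2 * n) ^ card S1"
      using prime_power_central_binomial_le[OF _ n] n by (intro prod_le_power) (auto simp: S1_def)
    show "(\<Prod>p\<in>S5. ?v p) \<le> (2 * n) ^ card S5"
      using prime_power_central_binomial_le[OF _ n] n by (intro prod_le_power) (auto simp: S5_def)
    have vle: "?v p \<le> p" if p: "prime p" "2 * n < p ^ 2" for p
    proof -
      have "multiplicity p ?N \<le> 1"
        using multiplicity_central_binomial(2)[of p n 1] p by (simp add: power2_eq_square)
      then have "?v p \<le> p ^ 1" using prime_gt_0_nat[OF p(1)] by (intro power_increasing) auto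
      then show ?thesis by simp
    qed
    have "(\<Prod>p\<in>S2. ?v p) \<le> \<Prod>S2" using vle by (intro prod_mono) (auto simp: S2_def)
    also have "\<dots> \<le> \<Prod>{p. prime p \<and> p \<le> 2 * n div 7}"
    proof (rule prod_subset_le)
      show "S2 \<subseteq> {p. prime p \<and> p \<le> 2 * n div 7}" by (auto simp: S2_def)
    qed (auto dest: prime_gt_0_nat simp del: less_eq_div_iff_mult_less_eq)
    also have "\<dots> \<le> 4 ^ (2 * n div 7)" by (rule primorial_le)
    finally show "(\<Prod>p\<in>S2. ?v p) \<le> 4 ^ (2 * n div 7)" .
    show "(\<Prod>p\<in>S3. ?v p) \<le> 1"
      using prime_gap_multiplicity_zero by (intro prod_le_1) (auto simp: S3_def)
    have "(\<Prod>p\<in>S4. ?v p) \<le> \<Prod>S4" using vle by (intro prod_mono) (auto simp: S4_def)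
    also have "\<dots> \<le> \<Prod>(insert (?m + 1) {p. prime p \<and> ?m + 1 < p \<and> p \<le> 2 * ?m + 1})"
    proof (rule prod_subset_le)
      \<comment> \<open>\<open>?m + 1\<close> may itself be prime but is not covered by
        \<open>prod_primes_upper_half_le\<close>; it accounts for the additional factor
        \<open>2 * n\<close>.\<close>
      show "S4 \<subseteq> insert (?m + 1) {p. prime p \<and> ?m + 1 < p \<and> p \<le> 2 * ?m + 1}"
      proof
        fix p assume p: "p \<in> S4"
        then have "n < 3 * p" "3 * p \<le> 2 * n" by (auto simp: S4_def)
        then have "?m + 1 \<le> p" "p \<le> 2 * ?m + 1" by linarith+
        then show "p \<in> insert (?m + 1) {p. prime p \<and> ?m + 1 < p \<and> p \<le> 2 * ?m + 1}"
          using p by (auto simp: S4_def)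
      qed
    qed (auto dest: prime_gt_0_nat)
    also have "\<dots> = (?m + 1) * \<Prod>{p. prime p \<and> ?m + 1 < p \<and> p \<le> 2 * ?m + 1}"
      by (subst prod.insert) auto
    also have "\<dots> \<le> (2 * n) * 4 ^ ?m"
      using prod_primes_upper_half_le n by (intro mult_mono) auto
    finally show "(\<Prod>p\<in>S4. ?v p) \<le> 2 * n * 4 ^ ?m" .
  qed auto
  also have "\<dots> = (2 * n) ^ (card S1 + card S5 + 1) * 4 ^ (2 * n div 7 + ?m)"
    by (simp add: power_add algebra_simps)
  also have "\<dots> \<le> (2 * n) ^ (card S1 + card {p. prime p \<and> n < p \<and> p \<le> 2 * n} + 1) * 4 ^ (2 * n div 7 + ?m)"
  proof -
    have "card S5 \<le> card {p. prime p \<and> n < p \<and> p \<le> 2 * n}"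
      by (rule card_mono) (auto simp: S5_def)
    then show ?thesis using n by (intro mult_right_mono power_increasing) auto
  qed
  finally show ?thesis unfolding S1_def .
qed

text \<open>Just strong enough: it makes \<open>8 / 21 * ln 4\<close> at least 32/63. The value
  157/144 is \<open>1 + x + x^2\<close> at x = 1/12.\<close>

lemma ln_2_ge: "2 / 3 \<le> ln (2::real)"
proof -
  have "exp (2 / 3 :: real) = exp (1 / 12) ^ 8" by (simp flip: exp_of_nat_mult)
  also have "\<dots> \<le> (157 / 144) ^ 8"
    using exp_bound[of "1 / 12"] by (intro power_mono) (auto simp: power2_eq_square)
  also have "\<dots> \<le> (2::real)" by (simp add: eval_nat_numeral)
  finally show ?thesis by (subst ln_ge_iff) auto
qed

lemma card_primes_lower_bound:
  assumes n: "1 \<le> n"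
  shows "(32 / 63) * real n / ln (2 * real n) - sqrt (2 * real n) - 2 \<le> real (card {p. prime p \<and> n < p \<and> p \<le> 2 * n})"
proof -
  let ?A = "card {p::nat. prime p \<and> n < p \<and> p \<le> 2 * n}" and ?S = "{p::nat. prime p \<and> p ^ 2 \<le> 2 * n}"
  have "?S \<subseteq> {1..nat \<lfloor>sqrt (2 * real n)\<rfloor>}"
  proof
    fix p assume "p \<in> ?S"
    then have p: "prime p" "p ^ 2 \<le> 2 * n" by auto
    have "real p ^ 2 \<le> 2 * real n" using p(2) using of_nat_mono[OF p(2), where ?'a = real] by simp
    then have "real p \<le> sqrt (2 * real n)" by (rule real_le_rsqrt)
    then have "p \<le> nat \<lfloor>sqrt (2 * real n)\<rfloor>" by (simp add: le_nat_floor)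
    then show "p \<in> {1..nat \<lfloor>sqrt (2 * real n)\<rfloor>}" using prime_gt_0_nat[OF p(1)] by auto
  qed
  then have "card ?S \<le> card {1..nat \<lfloor>sqrt (2 * real n)\<rfloor>}" by (intro card_mono) auto
  then have S: "real (card ?S) \<le> sqrt (2 * real n)" by (simp add: le_nat_iff le_floor_iff)
  have "4 ^ n \<le> (2 * n choose n) * (2 * n)"
  proof -
    have "0 < 2 * real n" using n by simp
    then have "4 ^ n \<le> real (2 * n choose n) * (2 * real n)"
      using central_binomial_lower_bound[of n] n by (simp add: pos_divide_le_eq)
    then have "real (4 ^ n) \<le> real ((2 * n choose n) * (2 * n))" by simp
    then show ?thesis by (simp only: of_nat_le_iff)
  qed
  also have "\<dots> \<le> ((2 * n) ^ (card ?S + ?A + 1) * 4 ^ (2 * n div 7 + n div 3)) * (2 * n)"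
    by (intro mult_right_mono central_binomial_upper_bound n) auto
  also have "\<dots> = (2 * n) ^ (card ?S + ?A + 2) * 4 ^ (2 * n div 7 + n div 3)" by simp
  finally have "real (4 ^ n) \<le> real ((2 * n) ^ (card ?S + ?A + 2) * 4 ^ (2 * n div 7 + n div 3))"
    by (simp only: of_nat_le_iff)
  then have "ln (4 ^ n) \<le> ln ((2 * real n) ^ (card ?S + ?A + 2) * 4 ^ (2 * n div 7 + n div 3))"
    using n by (subst ln_le_cancel_iff) auto
  also have "\<dots> = real (card ?S + ?A + 2) * ln (2 * real n) + real (2 * n div 7 + n div 3) * ln 4"
  proof -
    have x: "0 < 2 * real n" using n by simp
    have "ln ((2 * real n) ^ a * 4 ^ b) = real a * ln (2 * real n) + real b * ln 4" for a b
    proof -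
      have "ln ((2 * real n) ^ a * 4 ^ b) = ln ((2 * real n) ^ a) + ln (4 ^ b)"
        using x by (intro ln_mult_pos) auto
      also have "ln ((2 * real n) ^ a) = real a * ln (2 * real n)" by (rule ln_realpow)
      also have "ln (4 ^ b :: real) = real b * ln 4" by (rule ln_realpow)
      finally show ?thesis .
    qed
    then show ?thesis .
  qed
  finally have "real n * ln 4 \<le> real (card ?S + ?A + 2) * ln (2 * real n) + real (2 * n div 7 + n div 3) * ln 4"
    unfolding ln_realpow .
  moreover have "real (2 * n div 7 + n div 3) * ln 4 \<le> (13 / 21 * real n) * ln 4"
  proof (rule mult_right_mono)
    have "21 * (a + b) \<le> 13 * n" if "7 * a \<le> 2 * n" "3 * b \<le> n" for a b
      using that by presburger
    then have "21 * (2 * n div 7 + n div 3) \<le> 13 * n" by simp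
    then have "real (21 * (2 * n div 7 + n div 3)) \<le> real (13 * n)" by (simp only: of_nat_le_iff)
    then show "real (2 * n div 7 + n div 3) \<le> 13 / 21 * real n" by simp
  qed simp
  ultimately have 1: "8 / 21 * real n * ln 4 \<le> real (card ?S + ?A + 2) * ln (2 * real n)" by (simp add: algebra_simps)
  have "ln (4::real) = 2 * ln 2" using ln_realpow[of 2 2] by simp
  then have "4 / 3 \<le> ln (4::real)" using ln_2_ge by simp
  then have "8 / 21 * real n * (4 / 3) \<le> 8 / 21 * real n * ln 4" by (intro mult_left_mono) auto
  with 1 have "32 / 63 * real n \<le> real (card ?S + ?A + 2) * ln (2 * real n)" by linarith
  moreover have "0 < ln (2 * real n)" using n by (intro ln_gt_zero) auto
  ultimately have "(32 / 63) * real n / ln (2 * real n) \<le> real (card ?S + ?A + 2)"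
    by (simp add: divide_le_eq)
  then show ?thesis using S by simp
qed

text \<open>The excess of 32/63 over 1/2 absorbs \<open>ln 2\<close>, the square root and the
  constants. The summand 1 is there because the theorem bounds \<open>k - 1\<close>, while
  \<open>k\<close> primes are needed.\<close>

lemma eventually_many_primes:
  "\<forall>\<^sub>F n in sequentially. real n / (2 * ln (real n)) + 1 \<le> real (card {p. prime p \<and> n < p \<and> p \<le> 2 * n})"
proof -
  have "\<forall>\<^sub>F n in sequentially. real n / (2 * ln (real n)) + 1 \<le>
      (32 / 63) * real n / ln (2 * real n) - sqrt (2 * real n) - 2"
    by real_asymp
  moreover have "\<forall>\<^sub>F n in sequentially. (1::nat) \<le> n" by (rule eventually_ge_at_top)
  ultimately show ?thesis
    by eventually_elim (use card_primes_lower_bound in fastforce)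
qed

section \<open>The trade-off\<close>

instance edge :: countable
  by countable_datatype

lemma bij_gvar_nat: "\<exists>f :: edge gvar \<Rightarrow> nat. bij f"
proof -
  have "infinite (range (\<lambda>j. Sel (H 0 j) 0))"
    by (rule range_inj_infinite) (auto simp: inj_def)
  then have "infinite (UNIV :: edge gvar set)" by (rule infinite_super[OF subset_UNIV])
  then have "bij (to_nat_on (UNIV :: edge gvar set))" by (rule to_nat_on_infinite[OF countableI_type])
  then show ?thesis by blast
qed

lemma rename_inv:
  assumes "bij f"
  shows "rename (inv_into UNIV f) ` rename f ` F = F"
proof -
  have "inv_into UNIV f \<circ> f = id" using assms by (simp add: bij_is_inj)
  then have "map_literal (inv_into UNIV f) (map_literal f l) = l" for l
    by (simp add: literal.map_comp literal.map_id0)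
  then have "rename (inv_into UNIV f) (rename f C) = C" for C
    by (simp add: rename_def image_image)
  then show ?thesis by (simp add: image_image)
qed

section \<open>Size estimates and the formula for a single \<open>n\<close>\<close>

context compressed_cylinder
begin

lemma card_P_le: "i < k \<Longrightarrow> card (P i) \<le> c + 1"
proof -
  assume i: "i < k"
  have "inj_on (\<lambda>q. row_dist q i) (P i)"
    using i by (auto simp: inj_on_def P_def row_dist_eq split: if_splits)
  moreover have "(\<lambda>q. row_dist q i) ` P i \<subseteq> {..c}"
    by (auto simp: P_def row_dist_def)
  ultimately have "card (P i) \<le> card {..c}" by (rule card_inj_on_le) simp
  then show ?thesis by simp
qed

text \<open>There are at most \<open>13 * k * (2 * n) ^ (c + 1)\<close> columns to count per row and
  16 clauses per vertex, hence the factor 208 in both constants. The \<open>2 ^ k\<close>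
  assignments to a cut turn \<open>(2 * n) ^ k\<close> into \<open>(4 * n) ^ k\<close>.\<close>

lemma size_bounds:
  assumes p: "\<And>q. q < k \<Longrightarrow> p q \<le> 2 * n" and n: "1 \<le> n" and m: "1 \<le> m"
  shows "card (vars (lift_formula m G)) \<le> 3328 * (m * k ^ 2 * (2 * n) ^ (c + 1))"
    and "formula_size (lift_formula m G) \<le> 21632 * (m ^ 4 * k ^ 2 * (2 * n) ^ (c + 1))"
    and "k * T * 2 ^ (k + 8) * (7 * m ^ (k + 4)) \<le> 7168 * (m ^ (k + 4) * k ^ 2 * (4 * n) ^ k)"
proof -
  let ?N = "(2 * n) ^ (c + 1)"
  have N: "1 \<le> ?N" using n by simp
  have "h_period i \<le> 8 * k * ?N" if i: "i < k" for i
  proof -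
    have "(\<Prod>q\<in>P i. p q) \<le> (2 * n) ^ card (P i)"
      using p n by (intro prod_le_power) (auto simp: P_def)
    also have "\<dots> \<le> ?N" using card_P_le[OF i] n by (intro power_increasing) auto
    finally show ?thesis unfolding h_period_def B_def by (intro mult_left_mono) auto
  qed
  then have "card G \<le> 16 * (k * (2 * E + 1 + 8 * k * ?N))" by (rule card_G_le)
  also have "2 * E + 1 \<le> 5 * k * 1" using k_ge by (simp add: E_def)
  also have "5 * k * 1 \<le> 5 * k * ?N" using N by (intro mult_left_mono) auto
  finally have "card G \<le> 16 * (k * (5 * k * ?N + 8 * k * ?N))" by simp
  also have "\<dots> = 208 * (k ^ 2 * ?N)" by (simp add: power2_eq_square algebra_simps)
  finally have cG: "card G \<le> 208 * (k ^ 2 * ?N)" .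
  have "card (vars (lift_formula m G)) \<le> 4 * m * (4 * card G)"
    using card_vars_lift_formula_le[OF is_cnf_G m] .
  also have "\<dots> \<le> 4 * m * (4 * (208 * (k ^ 2 * ?N)))" using cG by (intro mult_left_mono) auto
  finally show "card (vars (lift_formula m G)) \<le> 3328 * (m * k ^ 2 * ?N)" by (simp add: mult_ac)
  have "formula_size (lift_formula m G) \<le> 2 * 4 * card (lift_formula m G)"
    by (rule formula_size_le[OF is_cnf_lift_formula[OF is_cnf_G]]) simp
  also have "\<dots> \<le> 2 * 4 * ((1 + 3 * 4) * m ^ 4 * card G)"
    by (intro mult_left_mono card_lift_formula_le[OF is_cnf_G m]) auto
  also have "\<dots> \<le> 2 * 4 * ((1 + 3 * 4) * m ^ 4 * (208 * (k ^ 2 * ?N)))"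
    using cG by (intro mult_left_mono) auto
  finally show "formula_size (lift_formula m G) \<le> 21632 * (m ^ 4 * k ^ 2 * ?N)" by (simp add: mult_ac)
  have "Q \<le> (2 * n) ^ card {..<k}" unfolding Q_def using p n by (intro prod_le_power) auto
  then have Q: "Q \<le> (2 * n) ^ k" by simp
  have "T \<le> 4 * k * Q" unfolding T_def B_def by (simp add: mult.assoc)
  also have "\<dots> \<le> 4 * k * (2 * n) ^ k" using Q by (intro mult_left_mono) auto
  finally have "k * T * 2 ^ (k + 8) * (7 * m ^ (k + 4)) \<le> k * (4 * k * (2 * n) ^ k) * 2 ^ (k + 8) * (7 * m ^ (k + 4))"
    by (intro mult_right_mono mult_left_mono) auto
  also have "\<dots> = 7168 * (m ^ (k + 4) * k ^ 2 * ((2 * n) ^ k * 2 ^ k))"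
  proof -
    have "(2::nat) ^ (k + 8) = 256 * 2 ^ k" by (simp add: power_add)
    then have "k * (4 * k * a) * 2 ^ (k + 8) * (7 * b) = 7168 * (b * (k * k) * (a * 2 ^ k))" for a b
      by simp
    then show ?thesis unfolding power2_eq_square .
  qed
  also have "(2 * n) ^ k * 2 ^ k = (4 * n) ^ k" unfolding power_mult_distrib[symmetric] by simp
  finally show "k * T * 2 ^ (k + 8) * (7 * m ^ (k + 4)) \<le> 7168 * (m ^ (k + 4) * k ^ 2 * (4 * n) ^ k)" .
qed

end

text \<open>Kept apart from \<open>within_bounds\<close>: this part must hold for every
  \<open>n\<close>, the asymptotic bounds only for large ones.\<close>

definition refutable_deeply ::
    "nat \<Rightarrow> nat \<Rightarrow> nat \<Rightarrow> nat formula \<Rightarrow> nat derivation \<Rightarrow> nat \<Rightarrow> bool" where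
  "refutable_deeply m k c F R d \<longleftrightarrow> is_cnf 8 F \<and> \<not> satisfiable F \<and> is_refutation F R \<and>
    (\<forall>R'. is_refutation F R' \<and> real (refutation_size R') \<le> ((real m + 1) / 2) ^ (k + c) \<longrightarrow> d \<le> depth R')"

definition within_bounds ::
    "nat \<Rightarrow> nat \<Rightarrow> nat \<Rightarrow> nat \<Rightarrow> nat formula \<Rightarrow> nat derivation \<Rightarrow> nat \<Rightarrow> bool" where
  "within_bounds n m k c F R d \<longleftrightarrow>
    card (vars F) \<le> 3328 * (m * k ^ 2 * (2 * n) ^ (c + 1)) \<and>
    formula_size F \<le> 21632 * (m ^ 4 * k ^ 2 * (2 * n) ^ (c + 1)) \<and>
    refutation_size R \<le> 7168 * (m ^ (k + 4) * k ^ 2 * (4 * n) ^ k) \<and>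
    n ^ k \<le> 2 * d"

lemma trade_off_instance:
  assumes m: "1 \<le> m" and c: "3 \<le> c" "c < k" and n: "2 \<le> n"
    and primes: "k \<le> card {p. prime p \<and> n < p \<and> p \<le> 2 * n}"
  shows "\<exists>F R d. refutable_deeply m k c F R d \<and> within_bounds n m k c F R d"
proof -
  obtain S where S: "S \<subseteq> {p. prime p \<and> n < p \<and> p \<le> 2 * n}" "card S = k"
    using primes by (rule obtain_subset_with_card_n)
  have "finite S" by (rule finite_subset[OF S(1)]) simp
  then obtain p where p: "bij_betw p {..<k} S"
    using ex_bij_betw_nat_finite[of S] S(2) by (auto simp: atLeast0LessThan)
  have p_prime: "prime (p q)" "n < p q" "p q \<le> 2 * n" if "q < k" for q
    using bij_betwE[OF p] S(1) that by auto
  have p_inj: "p q \<noteq> p q'" if "q < k" "q' < k" "q \<noteq> q'" for q q'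
    using p that by (auto simp: bij_betw_def inj_on_def)
  have "(\<Prod>q<k. n) \<le> (\<Prod>q<k. p q)"
    using p_prime(2) by (intro prod_mono) (auto intro: less_imp_le)
  then have Qn: "n ^ k \<le> (\<Prod>q<k. p q)" by simp
  have "2 ^ 4 \<le> (2::nat) ^ k" using c by (intro power_increasing) auto
  also have "\<dots> \<le> n ^ k" using n by (rule power_mono) simp
  finally have n16: "16 \<le> n ^ k" by simp
  interpret compressed_cylinder k c p
  proof
    show "coprime (p q) (p q')" if "q < k" "q' < k" "q \<noteq> q'" for q q'
      using p_prime(1) p_inj that by (intro primes_coprime) auto
  qed (use c n16 Qn p_prime prime_gt_0_nat in auto)
  obtain f :: "edge gvar \<Rightarrow> nat" where f: "bij f" using bij_gvar_nat by blast
  have inj: "inj f" "inj (inv_into UNIV f)" using f by (auto simp: bij_is_inj bij_imp_bij_inv)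
  define F where "F = rename f ` lift_formula m G"
  obtain R where R: "is_refutation (lift_formula m G) R"
    "refutation_size R \<le> k * T * 2 ^ (k + 8) * (7 * m ^ (k + 4))"
    using lifted_G_refutation[OF m] by blast
  have RF: "is_refutation F (rename_derivation f R)"
    unfolding F_def by (rule is_refutation_rename[OF inj(1) R(1)])
  have n1: "1 \<le> n" using n by simp
  note bounds = size_bounds[OF p_prime(3) n1 m]
  have "is_cnf 8 F"
    unfolding F_def is_cnf_rename[OF inj(1)] using is_cnf_lift_formula[OF is_cnf_G, of m] by simp
  moreover have "\<not> satisfiable F" using RF by (rule refutation_unsat)
  moreover have "n ^ k - 3 \<le> depth R'"
    if "is_refutation F R'" "real (refutation_size R') \<le> ((real m + 1) / 2) ^ (k + c)" for R'
  proof -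
    have "is_refutation (lift_formula m G) (rename_derivation (inv_into UNIV f) R')"
      using is_refutation_rename[OF inj(2) that(1)] rename_inv[OF f] by (simp add: F_def)
    then have "Q - 3 \<le> depth (rename_derivation (inv_into UNIV f) R')"
      using that(2) by (intro depth_lower_bound[OF _ m]) (simp_all add: refutation_size_def)
    then show ?thesis using Qn by (simp add: depth_rename_derivation Q_def)
  qed
  moreover have "card (vars F) \<le> 3328 * (m * k ^ 2 * (2 * n) ^ (c + 1))"
    unfolding F_def vars_rename using bounds(1) inj(1) by (simp add: card_image inj_on_subset)
  moreover have "formula_size F \<le> 21632 * (m ^ 4 * k ^ 2 * (2 * n) ^ (c + 1))"
    unfolding F_def formula_size_rename[OF inj(1)] by (rule bounds(2))
  moreover have "refutation_size (rename_derivation f R) \<le> 7168 * (m ^ (k + 4) * k ^ 2 * (4 * n) ^ k)"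
    using order_trans[OF R(2) bounds(3)] unfolding refutation_size_def length_rename_derivation .
  \<comment> \<open>With \<open>n ^ k\<close> at least 16, losing 3 costs at most a factor 2, so
    \<open>d\<close> can be \<open>n ^ k - 3\<close>.\<close>
  moreover have "n ^ k \<le> 2 * (n ^ k - 3)" using n16 by simp
  ultimately show ?thesis
    using RF unfolding refutable_deeply_def within_bounds_def by blast
qed

lemma trivial_trade_off: "refutable_deeply m k c {{}} [({}, Axiom)] 0"
  by (auto simp: refutable_deeply_def is_cnf_def is_clause_def satisfiable_def is_refutation_def)

lemma bigo_of_nat:
  fixes f g :: "nat \<Rightarrow> nat"
  assumes "\<forall>\<^sub>F n in sequentially. f n \<le> C * g n"
  shows "(\<lambda>n. real (f n)) \<in> O(\<lambda>n. real (g n))"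
proof (rule bigoI[of _ "real C"])
  show "\<forall>\<^sub>F n in sequentially. norm (real (f n)) \<le> real C * norm (real (g n))"
    using assms by eventually_elim (simp flip: of_nat_mult)
qed

theorem mainTheorem10:
  fixes m k c :: "nat \<Rightarrow> nat"
  assumes "\<forall>\<^sub>F n in sequentially. 1 \<le> m n"
    and "\<forall>\<^sub>F n in sequentially.
           3 \<le> c n \<and> c n \<le> k n - 1 \<and> real (k n - 1) < real n / (2 * ln (real n))"
  shows "\<exists>F :: nat \<Rightarrow> nat formula.
     (\<forall>n. is_cnf 8 (F n) \<and> \<not> satisfiable (F n)) \<and>
     (\<lambda>n. real (card (vars (F n))))
       \<in> O(\<lambda>n. real (m n) * real (k n) ^ 2 * (2 * real n) ^ (c n + 1)) \<and>
     (\<lambda>n. real (formula_size (F n)))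
       \<in> O(\<lambda>n. real (m n) ^ 4 * real (k n) ^ 2 * (2 * real n) ^ (c n + 1)) \<and>
     (\<exists>R. (\<forall>n. is_refutation (F n) (R n)) \<and>
        (\<lambda>n. real (refutation_size (R n)))
          \<in> O(\<lambda>n. real (m n) ^ (k n + 4) * real (k n) ^ 2 * (4 * real n) ^ k n)) \<and>
     (\<exists>d :: nat \<Rightarrow> nat. (\<lambda>n. real (d n)) \<in> \<Omega>(\<lambda>n. real n ^ k n) \<and>
        (\<forall>n R. is_refutation (F n) R \<and>
            real (refutation_size R) \<le> ((real (m n) + 1) / 2) ^ (k n + c n) \<longrightarrow>
            d n \<le> depth R))"
proof -
  define good where "good n \<longleftrightarrow> 1 \<le> m n \<and> 3 \<le> c n \<and> c n < k n \<and> 2 \<le> n \<and>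
    k n \<le> card {p. prime p \<and> n < p \<and> p \<le> 2 * n}" for n
  have "\<forall>\<^sub>F n in sequentially. (2::nat) \<le> n" by (rule eventually_ge_at_top)
  with assms eventually_many_primes have ev: "\<forall>\<^sub>F n in sequentially. good n"
  proof eventually_elim
    case (elim n)
    have "real (k n - 1) + 1 < real (card {p. prime p \<and> n < p \<and> p \<le> 2 * n})"
      using elim(2,3) by linarith
    moreover have "1 \<le> k n" using elim(2) by linarith
    ultimately have "real (k n) < real (card {p. prime p \<and> n < p \<and> p \<le> 2 * n})"
      by (simp add: of_nat_diff)
    then show ?case using elim unfolding good_def by auto
  qed
  have "\<exists>F R d. refutable_deeply (m n) (k n) (c n) F R d \<and>
      (good n \<longrightarrow> within_bounds n (m n) (k n) (c n) F R d)" for n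
  proof (cases "good n")
    case True
    then show ?thesis
      using trade_off_instance[of "m n" "c n" "k n" n] unfolding good_def by blast
  qed (use trivial_trade_off in blast)
  then obtain F R d where FRd: "\<And>n. refutable_deeply (m n) (k n) (c n) (F n) (R n) (d n)"
    "\<And>n. good n \<Longrightarrow> within_bounds n (m n) (k n) (c n) (F n) (R n) (d n)" by metis
  note wb = FRd(2)[unfolded within_bounds_def]
  have "(\<lambda>n. real (card (vars (F n)))) \<in> O(\<lambda>n. real (m n) * real (k n) ^ 2 * (2 * real n) ^ (c n + 1))"
    using bigo_of_nat[OF eventually_mono[OF ev wb[THEN conjunct1]]]
    by (simp only: of_nat_mult of_nat_power of_nat_numeral)
  moreover have "(\<lambda>n. real (formula_size (F n))) \<in> O(\<lambda>n. real (m n) ^ 4 * real (k n) ^ 2 * (2 * real n) ^ (c n + 1))"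
    using bigo_of_nat[OF eventually_mono[OF ev wb[THEN conjunct2, THEN conjunct1]]]
    by (simp only: of_nat_mult of_nat_power of_nat_numeral)
  moreover have "(\<lambda>n. real (refutation_size (R n))) \<in> O(\<lambda>n. real (m n) ^ (k n + 4) * real (k n) ^ 2 * (4 * real n) ^ k n)"
    using bigo_of_nat[OF eventually_mono[OF ev wb[THEN conjunct2, THEN conjunct2, THEN conjunct1]]]
    by (simp only: of_nat_mult of_nat_power of_nat_numeral)
  moreover have "(\<lambda>n. real (n ^ k n)) \<in> O(\<lambda>n. real (d n))"
    using bigo_of_nat[OF eventually_mono[OF ev wb[THEN conjunct2, THEN conjunct2, THEN conjunct2]]] .
  then have "(\<lambda>n. real (d n)) \<in> \<Omega>(\<lambda>n. real n ^ k n)"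
    by (simp add: bigomega_iff_bigo)
  ultimately show ?thesis
    using FRd(1) unfolding refutable_deeply_def
    by (intro exI[of _ F] exI[of _ R] exI[of _ d] conjI allI) auto
qed

end
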